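(* Let $d\in\mathbb{N}$ and let $\mathcal{R}:=\mathbb{Z}\langle t_1,\ldots,t_d\rangle$ be the commutative rng of integer polynomials in commuting variables $t_1,\ldots,t_d$ with zero constant term. Then there are $n_0\in\mathbb{N}$ and $\varepsilon>0$ such that for every $n\geq n_0$, the elements \[ \Delta:=\sum_{i\neq j}\sum_{r=1}^d (1-e_{i,j}(t_r))^*(1-e_{i,j}(t_r)) \quad\text{and}\quad \Delta^{(2)}:=\sum_{i\neq j}\sum_{r,s=1}^d (1-e_{i,j}(t_rt_s))^*(1-e_{i,j}(t_rt_s)) \] of $\mathbb{R}[\mathrm{EL}_n(\mathcal{R})]$ (where $i,j$ range over $\{1,\ldots,n\}$) satisfy \[ \Delta^2-n\,\varepsilon\,\Delta^{(2)}\in\overline{\Sigma^2\mathbb{R}[\mathrm{EL}_n(\mathcal{R})]}. \]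
   Context: A rng is a ring not assumed to have an identity. $\mathcal{R}^1$ denotes the unitization of $\mathcal{R}$ (here $\mathbb{Z}[t_1,\ldots,t_d]$), in which $\mathcal{R}$ is an ideal. For a commutative rng $\mathcal{R}$, $\mathrm{EL}_n(\mathcal{R})\subset\mathrm{SL}_n(\mathcal{R}^1)$ is the subgroup generated by the elementary matrices $e_{i,j}(r)$, $i\neq j$, $r\in\mathcal{R}$, which have $1$'s on the diagonal, $r$ in the $(i,j)$-th entry and $0$ elsewhere. For a group $\Gamma$, $\mathbb{R}[\Gamma]$ is the real group algebra with the involution $*$ that linearly extends $x^*:=x^{-1}$ for $x\in\Gamma$; $1$ denotes the identity element. $\Sigma^2\mathbb{R}[\Gamma]:=\{\sum_i\xi_i^*\xi_i:\xi_i\in\mathbb{R}[\Gamma]\}$ (finite sums), and its archimedean closure is $\overline{\Sigma^2\mathbb{R}[\Gamma]}:=\{\xi\in\mathbb{R}[\Gamma]:\forall\epsilon>0,\ \xi+\epsilon\cdot 1\in\Sigma^2\mathbb{R}[\Gamma]\}$, which coincides with the set of $\xi\in\mathbb{R}[\Gamma]$ that are positive in the full group $C^*$-algebra of $\Gamma$. *)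

theory Defs
  imports
    "HOL-Library.Poly_Mapping"
    "HOL-Algebra.Generated_Groups"
    "Jordan_Normal_Form.Determinant"
begin

(* Multivariate integer polynomials: finitely supported maps from exponent vectors to
   coefficients, with the convolution product of Poly_Mapping.  The d variables
   are indexed by {..<d}. *)

type_synonym zpoly = "(nat \<Rightarrow>\<^sub>0 nat) \<Rightarrow>\<^sub>0 int"

definition tvar :: "nat \<Rightarrow> zpoly" where
  "tvar r = Poly_Mapping.single (Poly_Mapping.single r 1) 1"

definition int_polys :: "nat \<Rightarrow> zpoly set" where
  "int_polys d = {p. \<forall>m \<in> Poly_Mapping.keys p. Poly_Mapping.keys m \<subseteq> {..<d}}"

definition int_polys_zero_const :: "nat \<Rightarrow> zpoly set" where
  "int_polys_zero_const d = {p \<in> int_polys d. Poly_Mapping.lookup p 0 = 0}"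

(* S is the carrier of a unital subring of the ambient ring. *)

definition SL_group :: "nat \<Rightarrow> 'a::comm_ring_1 set \<Rightarrow> 'a mat monoid" where
  "SL_group n S =
     \<lparr>carrier = {A \<in> carrier_mat n n. (\<forall>i<n. \<forall>j<n. A $$ (i, j) \<in> S) \<and> det A = 1},
      monoid.mult = (*),
      one = 1\<^sub>m n\<rparr>"

(* Matrix indices are 0-based. For i \<noteq> j, addrow_mat n r i j has 1 on the diagonal,
   r in entry (i, j), and 0 elsewhere. *)

definition elem_mat :: "nat \<Rightarrow> nat \<Rightarrow> nat \<Rightarrow> 'a::comm_ring_1 \<Rightarrow> 'a mat" where
  "elem_mat n i j r = addrow_mat n r i j"

(* R is (the carrier of) a rng that is an ideal in S, its unitization. *)

definition EL_group :: "nat \<Rightarrow> 'a::comm_ring_1 set \<Rightarrow> 'a set \<Rightarrow> 'a mat monoid" where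
  "EL_group n R S =
     (SL_group n S)
       \<lparr>carrier := generate (SL_group n S)
          {elem_mat n i j r | i j r. i < n \<and> j < n \<and> i \<noteq> j \<and> r \<in> R}\<rparr>"

definition EL_poly :: "nat \<Rightarrow> nat \<Rightarrow> zpoly mat monoid" where
  "EL_poly d n = EL_group n (int_polys_zero_const d) (int_polys d)"

(* The real group algebra of G: finitely supported real functions with support in the
   carrier. Addition is that of Poly_Mapping. Its multiplication would refer to
   addition of keys, so the product is defined separately. *)

definition galg :: "('a, 'b) monoid_scheme \<Rightarrow> ('a \<Rightarrow>\<^sub>0 real) set" where
  "galg G = {\<xi>. Poly_Mapping.keys \<xi> \<subseteq> carrier G}"

definition gelem :: "'a \<Rightarrow> 'a \<Rightarrow>\<^sub>0 real" where
  "gelem x = Poly_Mapping.single x 1"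

definition gone :: "('a, 'b) monoid_scheme \<Rightarrow> 'a \<Rightarrow>\<^sub>0 real" where
  "gone G = gelem \<one>\<^bsub>G\<^esub>"

definition gscale :: "real \<Rightarrow> ('a \<Rightarrow>\<^sub>0 real) \<Rightarrow> 'a \<Rightarrow>\<^sub>0 real" where
  "gscale c \<xi> = Poly_Mapping.map (\<lambda>a. c * a) \<xi>"

definition gmult ::
  "('a, 'b) monoid_scheme \<Rightarrow> ('a \<Rightarrow>\<^sub>0 real) \<Rightarrow> ('a \<Rightarrow>\<^sub>0 real) \<Rightarrow> 'a \<Rightarrow>\<^sub>0 real" where
  "gmult G \<xi> \<eta> =
     (\<Sum>x\<in>Poly_Mapping.keys \<xi>. \<Sum>y\<in>Poly_Mapping.keys \<eta>.
        Poly_Mapping.single (x \<otimes>\<^bsub>G\<^esub> y) (Poly_Mapping.lookup \<xi> x * Poly_Mapping.lookup \<eta> y))"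

definition gstar :: "('a, 'b) monoid_scheme \<Rightarrow> ('a \<Rightarrow>\<^sub>0 real) \<Rightarrow> 'a \<Rightarrow>\<^sub>0 real" where
  "gstar G \<xi> =
     (\<Sum>x\<in>Poly_Mapping.keys \<xi>. Poly_Mapping.single (inv\<^bsub>G\<^esub> x) (Poly_Mapping.lookup \<xi> x))"

definition sum_squares :: "('a, 'b) monoid_scheme \<Rightarrow> ('a \<Rightarrow>\<^sub>0 real) set" where
  "sum_squares G =
     {(\<Sum>\<xi>\<leftarrow>\<xi>s. gmult G (gstar G \<xi>) \<xi>) | \<xi>s. set \<xi>s \<subseteq> galg G}"

definition arch_closure_sum_squares :: "('a, 'b) monoid_scheme \<Rightarrow> ('a \<Rightarrow>\<^sub>0 real) set" where
  "arch_closure_sum_squares G =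
     {\<xi> \<in> galg G. \<forall>\<epsilon>>0. \<xi> + gscale \<epsilon> (gone G) \<in> sum_squares G}"

definition one_minus_sq :: "('a, 'b) monoid_scheme \<Rightarrow> 'a \<Rightarrow> 'a \<Rightarrow>\<^sub>0 real" where
  "one_minus_sq G x = gmult G (gstar G (gone G - gelem x)) (gone G - gelem x)"

definition Delta :: "nat \<Rightarrow> nat \<Rightarrow> zpoly mat \<Rightarrow>\<^sub>0 real" where
  "Delta d n =
     (\<Sum>(i, j)\<in>{(i, j). i < n \<and> j < n \<and> i \<noteq> j}. \<Sum>r<d.
        one_minus_sq (EL_poly d n) (elem_mat n i j (tvar r)))"

definition Delta2 :: "nat \<Rightarrow> nat \<Rightarrow> zpoly mat \<Rightarrow>\<^sub>0 real" where
  "Delta2 d n =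
     (\<Sum>(i, j)\<in>{(i, j). i < n \<and> j < n \<and> i \<noteq> j}. \<Sum>r<d. \<Sum>s<d.
        one_minus_sq (EL_poly d n) (elem_mat n i j (tvar r * tvar s)))"

end

theory Submission
  imports Defs
begin

text \<open>
  Let $x_j, y_j$ ($j \in J$, $|J| = N$) be unitaries with $x_j y_j = z y_j x_j$, $z$ central, all other
  pairs commuting, and put $X_j = |1 - x_j|^2$, $Y_j = |1 - y_j|^2$, $w = |1 - z|^2$.  In the picture
  $X_j \approx p_j^2$, $Y_j \approx q_j^2$ of $N$ harmonic oscillators with $[p_j, q_j] = i\theta$, the
  element $\sum_j X_j \sum_j Y_j$ exceeds a sum of squares by about $N^2 \theta^2 / 4$, because
  $S = \sum_j p_j q_j$ satisfies $S - S^* = i N \theta$.  Exact identities in the group ring turn this into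
  a sum-of-squares certificate for
  $c N w \le \sum_j (X_j Y_j + Y_j X_j) + \kappa \sum_{j \ne k} X_j Y_k
    + (\kappa / N) \sum_{j \ne k} (X_j X_k + Y_j Y_k)$,
  for every $\kappa > 0$ and all large $N$; the last sum is needed where $w$ is not small.
  With $x_j = e_{ij}(t_r)$, $y_j = e_{jk}(t_s)$, $z = e_{ik}(t_r t_s)$ the sum of these inequalities over
  $i \ne k$ and $r, s$ is bounded by $\Delta^2$: the first terms occur once, the others often enough to
  be absorbed when $\kappa (d + 1) \le 1$.
\<close>

section \<open>Ordered star-algebras\<close>

text \<open>The budget is tight. The anticommutators X_j Y_j + Y_j X_j occur exactly once in the
  square of Delta, and so does \<open>Op\<close>, the sum of X_j Y_k over j \<noteq> k. The
  anticommutators are not nonnegative: near the identity each is only bounded below by about -2 w, a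
  loss of 2 N w in all, while the oscillator argument that produces a gain costs 2
  \<open>Op\<close>. The way out is that the gain grows faster than N w. Taken at the scale r = sqrt
  N it is about r N w, so a weight of order 1 / r already outweighs the loss and charges
  \<open>Op\<close> only with order 1 / r. This is the picture near the identity. Elsewhere errors w
  X_j or w Y_j with coefficient of order 1 appear, whereas the products X_j X_k and Y_j Y_k, at the
  permitted coefficient \<kappa> / N, pay only for small multiples of them. For each j either one of
  the two errors can be avoided, and playing the two options against each other with multipliers Y_k
  leaves a damped error w q^m Y_j, where q = 1 - w / 32, plus products of the permitted kinds. Hence
  the order in which the constants are fixed: \<kappa>, then the small coefficient t, then the
  exponent m, and N last.\<close>

class star_algebra = real_algebra_1 + ordered_real_vector +
  fixes star :: "'a \<Rightarrow> 'a"
  assumes star_add: "star (a + b) = star a + star b"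
    and star_mult: "star (a * b) = star b * star a"
    and star_scaleR: "star (c *\<^sub>R a) = c *\<^sub>R star a"
    and star_star [simp]: "star (star a) = a"
    and zero_le_one_star: "0 \<le> (1::'a)"
    and conj_nonneg: "0 \<le> p \<Longrightarrow> 0 \<le> star a * p * a"

lemma star_zero [simp]: "star (0::'a::star_algebra) = 0"
  using star_scaleR[of 0 0] by simp

lemma star_one [simp]: "star (1::'a::star_algebra) = 1"
  by (metis mult_1 mult_1_right star_mult star_star)

lemma star_minus [simp]: "star (- a) = - star (a::'a::star_algebra)"
  using star_scaleR[of "-1" a] by simp

lemma star_diff: "star (a - b) = star a - star (b::'a::star_algebra)"
  by (metis diff_conv_add_uminus star_add star_minus)

lemma star_sum: "star (sum f S) = (\<Sum>i\<in>S. star (f i :: 'a::star_algebra))"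
  by (induction S rule: infinite_finite_induct) (simp_all add: star_add)

lemmas star_simps = star_add star_mult star_scaleR star_diff

lemma sq_nonneg: "0 \<le> star a * (a::'a::star_algebra)"
  using conj_nonneg[OF zero_le_one_star, of a] by simp

text \<open>Reduces an identity between real linear combinations to real arithmetic.\<close>
lemma linear_functional_eqI:
  fixes a b :: "'a::real_vector"
  assumes "\<And>f :: 'a \<Rightarrow> real. \<lbrakk>\<And>u v. f (u + v) = f u + f v; \<And>u v. f (u - v) = f u - f v;
      \<And>u. f (- u) = - f u; f 0 = 0; \<And>c u. f (c *\<^sub>R u) = c * f u\<rbrakk> \<Longrightarrow> f a = f b"
  shows "a = b"
proof (rule ccontr)
  assume "a \<noteq> b"
  then have "independent {a - b}" by simp
  from linear_independent_extend[OF this, of "\<lambda>_. 1::real"]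
  obtain g where g: "linear g" "g (a - b) = (1::real)" by auto
  then show False using assms[of g]
    by (simp add: linear_add linear_diff linear_neg linear_0 linear_scale)
qed

section \<open>Commutation, unitaries and the elements \<open>lap u\<close>\<close>

definition comm :: "'a::times \<Rightarrow> 'a \<Rightarrow> bool"
  where "comm a b \<longleftrightarrow> a * b = b * a"

definition unitary :: "'a::star_algebra \<Rightarrow> bool"
  where "unitary u \<longleftrightarrow> star u * u = 1 \<and> u * star u = 1"

definition lap :: "'a::star_algebra \<Rightarrow> 'a"
  where "lap u = star (1 - u) * (1 - u)"

lemma commD: "comm a b \<Longrightarrow> a * b = b * a"
  by (simp add: comm_def)

lemma comm_left: "comm a b \<Longrightarrow> a * (b * c) = b * (a * (c::'a::semigroup_mult))"
  by (simp add: comm_def flip: mult.assoc)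

lemma comm_sym: "comm a b \<Longrightarrow> comm b a"
  by (simp add: comm_def)

lemma comm_refl: "comm a a"
  by (simp add: comm_def)

lemma comm_one: "comm (a::'a::monoid_mult) 1"
  by (simp add: comm_def)

lemma comm_add: "comm a b \<Longrightarrow> comm a c \<Longrightarrow> comm a (b + c :: 'a::semiring)"
  by (simp add: comm_def algebra_simps)

lemma comm_diff: "comm a b \<Longrightarrow> comm a c \<Longrightarrow> comm a (b - c :: 'a::ring)"
  by (simp add: comm_def algebra_simps)

lemma comm_mult: "comm a b \<Longrightarrow> comm a c \<Longrightarrow> comm a (b * c :: 'a::semigroup_mult)"
proof -
  assume b: "comm a b" and c: "comm a c"
  have "a * (b * c) = (a * b) * c" by (simp only: mult.assoc)
  also have "\<dots> = b * (a * c)" using b by (simp only: comm_def mult.assoc)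
  also have "\<dots> = (b * c) * a" using c by (simp only: comm_def mult.assoc)
  finally show "comm a (b * c)" by (simp only: comm_def)
qed

lemma comm_scaleR: "comm a b \<Longrightarrow> comm a (r *\<^sub>R b :: 'a::real_algebra)"
  by (simp add: comm_def)

lemma comm_power: "comm a b \<Longrightarrow> comm a (b ^ n :: 'a::monoid_mult)"
  by (induction n) (auto intro: comm_one comm_mult)

lemma comm_sum: "(\<And>i. i \<in> S \<Longrightarrow> comm a (f i)) \<Longrightarrow> comm a (sum f S :: 'a::semiring_0)"
  by (auto simp: comm_def sum_distrib_left sum_distrib_right intro: sum.cong)

lemma unitary_star: "unitary u \<Longrightarrow> unitary (star u)"
  by (simp add: unitary_def)

lemma comm_star: "unitary u \<Longrightarrow> comm a u \<Longrightarrow> comm a (star u)"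
proof -
  assume u: "unitary u" and c: "comm a u"
  have "star u * (u * a) * star u = star u * (a * u) * star u"
    using c by (simp add: comm_def)
  then have "(star u * u) * a * star u = star u * a * (u * star u)"
    by (simp only: mult.assoc)
  then show "comm a (star u)"
    using u by (simp add: unitary_def comm_def)
qed

lemma comm_lap: "unitary u \<Longrightarrow> comm a u \<Longrightarrow> comm a (lap u)"
  unfolding lap_def star_diff star_one by (intro comm_mult comm_diff comm_one comm_star)

lemmas comm_intros = comm_one comm_add comm_diff comm_mult comm_scaleR comm_power comm_sum comm_lap comm_star

lemma lap_eq: "unitary u \<Longrightarrow> lap u = 2 *\<^sub>R 1 - u - star u"
  by (simp add: unitary_def lap_def star_simps algebra_simps scaleR_2)

lemma lap_star: "unitary u \<Longrightarrow> lap (star u) = lap u"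
  by (simp add: lap_eq unitary_star)

lemma lap_nonneg: "0 \<le> lap u"
  unfolding lap_def by (rule sq_nonneg)

text \<open>The axioms alone do not make a product of commuting nonnegative elements nonnegative.
  Here one factor is an explicit square, and sliding \<open>c\<close> past \<open>p\<close> turns
  the product into the conjugate \<open>star c * p * c\<close>. Most products below are nonnegative
  for this reason, with \<open>c = 1 - u\<close>.\<close>

lemma sq_mult_nonneg:
  assumes "0 \<le> p" "comm c (p::'a::star_algebra)" shows "0 \<le> star c * c * p"
  using conj_nonneg[OF assms(1), of c] assms(2) by (simp add: comm_def mult.assoc)

lemma lap_mult_nonneg: "0 \<le> p \<Longrightarrow> comm u p \<Longrightarrow> 0 \<le> lap u * p"
  unfolding lap_def
  by (intro sq_mult_nonneg) (auto simp: comm_def algebra_simps)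

text \<open>The difference is \<open>star (1 + u) * (1 + u) * p\<close>, by the parallelogram law
  for \<open>1\<close> and \<open>u\<close>.\<close>

lemma lap_mult_le:
  assumes "unitary u" "0 \<le> p" "comm u p" shows "lap u * p \<le> 4 *\<^sub>R p"
proof -
  have "0 \<le> star (1 + u) * (1 + u) * p"
    using assms by (intro sq_mult_nonneg) (auto simp: comm_def algebra_simps)
  also have "\<dots> = 4 *\<^sub>R p - lap u * p"
  proof -
    have [simp]: "star u * u = 1" "star u * (u * p) = p"
      using assms(1) by (simp_all add: unitary_def flip: mult.assoc)
    show ?thesis
      unfolding lap_eq[OF assms(1)]
      by (rule linear_functional_eqI) (simp (no_asm_simp) add: star_simps algebra_simps)
  qed
  finally show ?thesis by simp
qed

lemma lap_le: "unitary u \<Longrightarrow> lap u \<le> 4 *\<^sub>R 1"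
  using lap_mult_le[OF _ zero_le_one_star, of u] comm_one[of u] by simp

text \<open>Since $w \le 8 (X + Y)$ (lemma \<open>w_le\<close> below), $1 - Y/4$ is at most $1 - w/32$ up to $X/4$.\<close>
definition damp :: "'a::star_algebra \<Rightarrow> 'a"
  where "damp z = 1 - (1/32) *\<^sub>R lap z"

lemma damp_mult:
  assumes "unitary z" "0 \<le> p" "comm z p"
  shows "0 \<le> damp z * p" "damp z * p \<le> p"
proof -
  have "0 \<le> (1/32) *\<^sub>R (4 *\<^sub>R p - lap z * p) + (7/8) *\<^sub>R p"
    using lap_mult_le[OF assms] assms(2) by (intro add_nonneg_nonneg scaleR_nonneg_nonneg) auto
  also have "\<dots> = damp z * p"
    by (rule linear_functional_eqI) (simp (no_asm_simp) add: damp_def algebra_simps)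
  finally show "0 \<le> damp z * p" .
  have "0 \<le> (1/32) *\<^sub>R (lap z * p)"
    using lap_mult_nonneg[OF assms(2,3)] by (intro scaleR_nonneg_nonneg) auto
  then show "damp z * p \<le> p" by (simp add: damp_def algebra_simps)
qed

lemma comm_damp: "unitary z \<Longrightarrow> comm a z \<Longrightarrow> comm a (damp z)"
  unfolding damp_def by (intro comm_intros)

lemma damp_power_mult:
  assumes "unitary z" "0 \<le> p" "comm z p"
  shows "0 \<le> damp z ^ n * p \<and> damp z ^ n * p \<le> p"
proof (induction n)
  case 0
  then show ?case using assms by simp
next
  case (Suc n)
  have "comm z (damp z ^ n * p)"
    using assms by (intro comm_mult comm_power comm_damp comm_refl)
  from damp_mult[OF assms(1) conjunct1[OF Suc] this] Suc show ?case
    by (auto simp: mult.assoc)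
qed

text \<open>Telescoping of $1 - q^n = u (1 + q + \dots + q^{n-1})$ with $u = 1 - q$.\<close>
lemma lap_damp_power_le:
  assumes "unitary z" "0 \<le> p" "comm z p"
  shows "(n / 32) *\<^sub>R (lap z * (damp z ^ n * p)) \<le> p - damp z ^ n * p"
proof (induction n)
  case (Suc n)
  let ?p = "damp z ^ n * p"
  have zp: "comm z ?p" and zd: "comm z (damp z)"
    using assms by (auto intro!: comm_intros comm_damp comm_refl)
  \<comment> \<open>Passing from exponent \<open>n\<close> to \<open>Suc n\<close> only decreases
    the summands of the telescoped sum.\<close>
  have *: "0 \<le> lap z * (?p - damp z * ?p)"
    using damp_mult[OF assms(1) _ zp] damp_power_mult[OF assms, of n]
    by (intro lap_mult_nonneg comm_diff comm_mult[OF zd] zp) auto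
  have "0 \<le> (p - damp z ^ n * p - (n / 32) *\<^sub>R (lap z * ?p)) + (Suc n / 32) *\<^sub>R (lap z * (?p - damp z * ?p))"
    using Suc * by (intro add_nonneg_nonneg scaleR_nonneg_nonneg) auto
  also have "\<dots> = p - damp z ^ Suc n * p - (Suc n / 32) *\<^sub>R (lap z * (damp z ^ Suc n * p))"
    unfolding power_Suc mult.assoc
    by (rule linear_functional_eqI)
      (simp (no_asm_simp) add: damp_def algebra_simps add_divide_distrib)
  finally show ?case by simp
qed simp

section \<open>A single Heisenberg pair\<close>

locale heisenberg_pair =
  fixes x y z :: "'a::star_algebra"
  assumes ux: "unitary x" and uy: "unitary y" and uz: "unitary z"
    and xy: "x * y = z * (y * x)"
    and zx: "comm z x" and zy: "comm z y"
begin

lemma cancel: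
  "star x * x = 1" "x * star x = 1" "star y * y = 1" "y * star y = 1"
  "star z * z = 1" "z * star z = 1"
  "star x * (x * p) = p" "x * (star x * p) = p" "star y * (y * p) = p" "y * (star y * p) = p"
  "star z * (z * p) = p" "z * (star z * p) = p"
  using ux uy uz unfolding unitary_def by (simp_all flip: mult.assoc)

lemma central:
  "x * z = z * x" "x * star z = star z * x" "star x * z = z * star x"
  "star x * star z = star z * star x"
  "y * z = z * y" "y * star z = star z * y" "star y * z = z * star y"
  "star y * star z = star z * star y"
  using ux uy uz zx zy by (auto intro!: commD intro: comm_star comm_sym comm_sym[OF comm_star])

lemma swap:
  "y * x = star z * (x * y)"
  "y * star x = z * (star x * y)"
  "star y * x = z * (x * star y)"
  "star y * star x = star z * (star x * star y)"
proof -
  show 1: "y * x = star z * (x * y)" by (simp add: xy cancel)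
  show 2: "y * star x = z * (star x * y)" 
    by (metis xy mult.assoc cancel mult_1_right central(3))
  show "star y * star x = star z * (star x * star y)"
    using arg_cong[OF xy, of star] by (simp add: star_mult mult.assoc central) (metis central(4,8) mult.assoc)
  show "star y * x = z * (x * star y)"
    using arg_cong[OF 2, of star] by (simp add: star_mult mult.assoc central) (metis central cancel mult.assoc)
qed

text \<open>Oriented so that rewriting sorts every word in \<open>x\<close>, \<open>y\<close>,
  \<open>z\<close> and their adjoints into the order \<open>z\<close>, \<open>x\<close>,
  \<open>y\<close>; the added variants handle a subword followed by further letters. The identities
  below are checked by comparing these normal forms.\<close>

lemmas words = cancel central swap
  central[THEN arg_cong[where f = "\<lambda>t. t * p" for p], unfolded mult.assoc]
  swap[THEN arg_cong[where f = "\<lambda>t. t * p" for p], unfolded mult.assoc]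

abbreviation "a \<equiv> 1 - x"
abbreviation "b \<equiv> 1 - y"
abbreviation "w \<equiv> lap z"

text \<open>After expansion only
  \<open>2 *\<^sub>R lap y - star x * lap y * x - x * lap y * star x\<close> remains. Conjugation by
  \<open>x\<close> multiplies \<open>y\<close> by \<open>z\<close>, and conjugation by
  \<open>star x\<close> multiplies it by \<open>star z\<close>, so this remainder is the term with
  \<open>w\<close>.\<close>

lemma chain_eq_x:
  "lap x * lap y + lap y * lap x = star a * lap y * a + a * lap y * star a - w * (2 *\<^sub>R 1 - lap y)"
  unfolding lap_eq[OF ux] lap_eq[OF uy] lap_eq[OF uz]
  by (rule linear_functional_eqI) (simp (no_asm_simp) add: star_simps algebra_simps words)

lemma chain_eq_y:
  "lap x * lap y + lap y * lap x = star b * lap x * b + b * lap x * star b - w * (2 *\<^sub>R 1 - lap x)"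
  unfolding lap_eq[OF ux] lap_eq[OF uy] lap_eq[OF uz]
  by (rule linear_functional_eqI) (simp (no_asm_simp) add: star_simps algebra_simps words)


text \<open>Parallelogram law for \<open>a * b\<close> and \<open>b * a\<close>: their difference is
  \<open>x * y - y * x = (z - 1) * (y * x)\<close>, whose square is \<open>w\<close>.\<close>

lemma w_le: "w \<le> 8 *\<^sub>R (lap x + lap y)"
proof -
  have "0 \<le> star (a * b + b * a) * (a * b + b * a)"
    by (rule sq_nonneg)
  also have "\<dots> = 2 *\<^sub>R (star b * lap x * b) + 2 *\<^sub>R (star a * lap y * a) - w"
    unfolding lap_def
    by (rule linear_functional_eqI)
      (simp (no_asm_simp) add: star_simps algebra_simps words del: one_add_one)
  finally have 1: "w \<le> 2 *\<^sub>R (star b * lap x * b) + 2 *\<^sub>R (star a * lap y * a)"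
    by simp
  have 2: "star b * lap x * b \<le> 4 *\<^sub>R lap y"
    using conj_nonneg[of "4 *\<^sub>R 1 - lap x" b] lap_le[OF ux] by (simp add: lap_def[of y] algebra_simps)
  have 3: "star a * lap y * a \<le> 4 *\<^sub>R lap x"
    using conj_nonneg[of "4 *\<^sub>R 1 - lap y" a] lap_le[OF uy] by (simp add: lap_def[of x] algebra_simps)
  note 1
  also have "2 *\<^sub>R (star b * lap x * b) + 2 *\<^sub>R (star a * lap y * a) \<le> 2 *\<^sub>R (4 *\<^sub>R lap y) + 2 *\<^sub>R (4 *\<^sub>R lap x)"
    using 2 3 by (intro add_mono scaleR_left_mono) auto
  also have "\<dots> = 8 *\<^sub>R (lap x + lap y)"
    by (rule linear_functional_eqI) (simp (no_asm_simp) add: algebra_simps)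
  finally show ?thesis .
qed

definition "chain = lap x * lap y + lap y * lap x"
text \<open>The correction is symmetric in \<open>x\<close> and \<open>y\<close>, and its sum over a
  Heisenberg system is the term \<open>w * G\<close> that also occurs in \<open>gain\<close>. The
  price of the symmetry is an error \<open>w * lap x\<close> or \<open>w * lap y\<close>, at
  choice.\<close>

definition "xi = chain + w * (2 *\<^sub>R 1 - lap x - lap y)"

lemma xi_lower: "0 \<le> xi + w * lap x" "0 \<le> xi + w * lap y"
proof -
  have "0 \<le> star b * lap x * b + star (star b) * lap x * star b"
    by (intro add_nonneg_nonneg conj_nonneg lap_nonneg)
  also have "\<dots> = xi + w * lap y"
    unfolding xi_def chain_def chain_eq_y by (simp add: algebra_simps)
  finally show "0 \<le> xi + w * lap y" .
  have "0 \<le> star a * lap y * a + star (star a) * lap y * star a"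
    by (intro add_nonneg_nonneg conj_nonneg lap_nonneg)
  also have "\<dots> = xi + w * lap x"
    unfolding xi_def chain_def chain_eq_x by (simp add: algebra_simps)
  finally show "0 \<le> xi + w * lap x" .
qed

text \<open>\<open>chain\<close> is the mixed term in the square of
  \<open>c *\<^sub>R lap x + (1/c) *\<^sub>R lap y\<close> with \<open>c * c = r\<close>; the pure
  terms are bounded because \<open>lap u * lap u \<le> 4 *\<^sub>R lap u\<close>.\<close>

lemma chain_lower:
  assumes "r > 0"
  shows "0 \<le> chain + 4 *\<^sub>R (r *\<^sub>R lap x + (1/r) *\<^sub>R lap y)"
proof -
  have st: "star (lap x) = lap x" "star (lap y) = lap y"
    by (simp_all add: lap_def star_simps)
  define c where "c = sqrt r"
  have c: "c > 0" "c * c = r" using assms by (simp_all add: c_def)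
  let ?s = "c *\<^sub>R lap x + (1/c) *\<^sub>R lap y"
  have "0 \<le> star ?s * ?s + r *\<^sub>R (4 *\<^sub>R lap x - lap x * lap x) + (1/r) *\<^sub>R (4 *\<^sub>R lap y - lap y * lap y)"
    using assms lap_mult_le[OF ux lap_nonneg comm_lap[OF ux comm_refl]] lap_mult_le[OF uy lap_nonneg comm_lap[OF uy comm_refl]]
    by (intro add_nonneg_nonneg scaleR_nonneg_nonneg sq_nonneg) auto
  also have "star ?s * ?s = (c * c) *\<^sub>R (lap x * lap x) + (1 / (c * c)) *\<^sub>R (lap y * lap y) + chain"
    using c(1) by (simp add: star_simps st distrib_left distrib_right chain_def scaleR_right_distrib add_ac)
  finally show ?thesis
    unfolding c(2) by (simp add: scaleR_right_diff_distrib scaleR_right_distrib ac_simps)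
qed

end

section \<open>Heisenberg systems\<close>

locale heisenberg =
  fixes J :: "'i set" and x y :: "'i \<Rightarrow> 'a::star_algebra" and z :: 'a
  assumes finite_J: "finite J"
    and unitary_x: "\<And>j. j \<in> J \<Longrightarrow> unitary (x j)"
    and unitary_y: "\<And>j. j \<in> J \<Longrightarrow> unitary (y j)"
    and unitary_z: "unitary z"
    and xy: "\<And>j. j \<in> J \<Longrightarrow> x j * y j = z * (y j * x j)"
    and zx: "\<And>j. j \<in> J \<Longrightarrow> comm z (x j)"
    and zy: "\<And>j. j \<in> J \<Longrightarrow> comm z (y j)"
    and xx: "\<And>j k. j \<in> J \<Longrightarrow> k \<in> J \<Longrightarrow> comm (x j) (x k)"
    and yy: "\<And>j k. j \<in> J \<Longrightarrow> k \<in> J \<Longrightarrow> comm (y j) (y k)"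
    and xy_off: "\<And>j k. j \<in> J \<Longrightarrow> k \<in> J \<Longrightarrow> j \<noteq> k \<Longrightarrow> comm (x j) (y k)"
begin

abbreviation "X j \<equiv> lap (x j)"
abbreviation "Y j \<equiv> lap (y j)"
abbreviation "w \<equiv> lap z"
abbreviation "q \<equiv> damp z"

lemma pair: "j \<in> J \<Longrightarrow> heisenberg_pair (x j) (y j) z"
  by unfold_locales (simp_all add: unitary_x unitary_y unitary_z xy zx zy)

lemma yx_off: "j \<in> J \<Longrightarrow> k \<in> J \<Longrightarrow> j \<noteq> k \<Longrightarrow> comm (y k) (x j)"
  by (rule comm_sym) (rule xy_off)

lemma xz: "j \<in> J \<Longrightarrow> comm (x j) z" and yz: "j \<in> J \<Longrightarrow> comm (y j) z"
  by (simp_all add: comm_sym zx zy)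

lemma comm_q: "comm c z \<Longrightarrow> comm c q"
  by (rule comm_damp[OF unitary_z])

lemmas J_intros = unitary_x unitary_y unitary_z zx zy xx yy xy_off yx_off xz yz comm_q comm_refl

lemma XY_off: "j \<in> J \<Longrightarrow> k \<in> J \<Longrightarrow> j \<noteq> k \<Longrightarrow> Y k * X j = X j * Y k"
  by (intro commD comm_lap[OF unitary_x] comm_sym[OF comm_lap[OF unitary_y]] xy_off)

lemma XY_nonneg: "j \<in> J \<Longrightarrow> k \<in> J \<Longrightarrow> j \<noteq> k \<Longrightarrow> 0 \<le> X j * Y k"
  by (intro lap_mult_nonneg lap_nonneg comm_lap unitary_y xy_off)

lemma XX_nonneg: "j \<in> J \<Longrightarrow> k \<in> J \<Longrightarrow> 0 \<le> X j * X k"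
  by (intro lap_mult_nonneg lap_nonneg comm_lap unitary_x xx)

lemma YY_nonneg: "j \<in> J \<Longrightarrow> k \<in> J \<Longrightarrow> 0 \<le> Y j * Y k"
  by (intro lap_mult_nonneg lap_nonneg comm_lap unitary_y yy)

lemma w_le: "j \<in> J \<Longrightarrow> w \<le> 8 *\<^sub>R (X j + Y j)"
  by (rule heisenberg_pair.w_le[OF pair])

lemma comm_z: "j \<in> J \<Longrightarrow> comm z (X j)" "j \<in> J \<Longrightarrow> comm z (Y j)" "comm z w" "comm z (q ^ n)"
  by (auto intro!: comm_intros J_intros)

lemma w_move: "j \<in> J \<Longrightarrow> X j * w = w * X j" "j \<in> J \<Longrightarrow> Y j * w = w * Y j"
  by (auto intro!: commD comm_lap[OF unitary_z] comm_sym[OF comm_z(1)] comm_sym[OF comm_z(2)])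

lemma q_move: "j \<in> J \<Longrightarrow> X j * q ^ n = q ^ n * X j" "j \<in> J \<Longrightarrow> Y j * q ^ n = q ^ n * Y j"
    "q ^ n * w = w * q ^ n"
  by (auto intro!: commD comm_power comm_q comm_lap[OF unitary_z]
      comm_sym[OF comm_z(1)] comm_sym[OF comm_z(2)] comm_sym[OF comm_z(4)])

text \<open>Induction on $M$: by the first lower bound on $\Phi$ and the induction hypothesis,
  $\Phi = (Y_k/4) \Phi + (1 - Y_k/4) \Phi$ is bounded below by a combination in which every product
  $Y_k X_j$ is acceptable, and $1 - Y_k/4 \le q + X_k/4$ turns the remaining $(1 - Y_k/4) q^m Y_j$ into
  $q^{m+1} Y_j$ and the acceptable $X_k Y_j$.\<close>
lemma mixing:
  assumes j: "j \<in> J" and M: "finite M" "M \<subseteq> J - {j}"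
    and \<Phi>: "\<And>k. k \<in> J - {j} \<Longrightarrow> comm (y k) \<Phi>"
    and low1: "0 \<le> \<Phi> + w * (L *\<^sub>R X j + \<eta> *\<^sub>R Y j)"
    and low2: "0 \<le> \<Phi> + w * (\<eta> *\<^sub>R X j + L *\<^sub>R Y j)"
    and pos: "0 \<le> L" "0 \<le> \<eta>"
  shows "0 \<le> \<Phi> + \<eta> *\<^sub>R (w * (X j + Y j)) + L *\<^sub>R (w * (q ^ card M * Y j))
           + L *\<^sub>R (\<Sum>k\<in>M. X j * Y k + X k * Y j)"
  using M
proof (induction M rule: finite_induct)
  case empty
  have "0 \<le> (\<Phi> + w * (\<eta> *\<^sub>R X j + L *\<^sub>R Y j)) + \<eta> *\<^sub>R (w * Y j)"
    by (rule add_nonneg_nonneg[OF low2 scaleR_nonneg_nonneg[OF pos(2) lap_mult_nonneg[OF lap_nonneg comm_lap]]])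
      (intro J_intros j)+
  then show ?case
    by (simp add: algebra_simps)
next
  case (insert k M)
  let ?m = "card M"
  let ?S = "\<Sum>k\<in>M. X j * Y k + X k * Y j"
  let ?P = "\<eta> *\<^sub>R (w * (X j + Y j)) + L *\<^sub>R (w * (q ^ ?m * Y j)) + L *\<^sub>R ?S"
  let ?c = "w * (q ^ ?m * Y j)"
  have k: "k \<in> J" "k \<noteq> j" and MJ: "\<And>l. l \<in> M \<Longrightarrow> l \<in> J \<and> l \<noteq> j \<and> l \<noteq> k"
    using insert by auto
  have uk: "unitary (- y k)"
    using unitary_y[OF k(1)] by (simp add: unitary_def)
  have yS: "comm (y k) ?S"
    using j k MJ by (intro comm_intros J_intros) auto
  have P1: "0 \<le> Y k * (w * X j)" 
    using j k by (intro lap_mult_nonneg lap_nonneg comm_intros J_intros) auto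
  have S0: "0 \<le> ?S"
    using j MJ by (intro sum_nonneg add_nonneg_nonneg XY_nonneg) auto
  have P2: "0 \<le> Y k * ?S"
    by (intro lap_mult_nonneg S0 yS)
  have P3: "0 \<le> 4 *\<^sub>R (X j * Y k) - w * (X j * Y k)"
    using lap_mult_le[OF unitary_z XY_nonneg comm_mult[OF comm_z(1) comm_z(2)], of j k] j k by simp
  have "0 \<le> Y j * (8 *\<^sub>R (X k + Y k) - w)"
    using j k w_le[OF k(1)] by (intro lap_mult_nonneg comm_intros J_intros) auto
  moreover have zY: "comm z (Y j * (8 *\<^sub>R (X k + Y k) - w))"
    using j k by (intro comm_diff comm_mult comm_add comm_scaleR comm_z)
  ultimately have P4: "0 \<le> w * (q ^ ?m * (Y j * (8 *\<^sub>R (X k + Y k) - w)))"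
    using damp_power_mult[OF unitary_z] by (intro lap_mult_nonneg comm_mult[OF comm_z(4)]) auto
  have zXY: "comm z (X k * Y j)"
    using j k by (intro comm_mult comm_z)
  have *: "0 \<le> q ^ ?m * (X k * Y j) \<and> q ^ ?m * (X k * Y j) \<le> X k * Y j"
    using j k by (intro damp_power_mult unitary_z XY_nonneg zXY) auto
  then have "w * (q ^ ?m * (X k * Y j)) \<le> 4 *\<^sub>R (q ^ ?m * (X k * Y j))"
    by (intro lap_mult_le unitary_z comm_mult[OF comm_z(4) zXY]) auto
  also have "\<dots> \<le> 4 *\<^sub>R (X k * Y j)"
    using * by (intro scaleR_left_mono) auto
  finally have P5: "0 \<le> 4 *\<^sub>R (X k * Y j) - w * (q ^ ?m * (X k * Y j))"
    by simp
  have IH: "0 \<le> \<Phi> + ?P" using insert by (simp add: algebra_simps)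
  have "comm (y k) (\<Phi> + ?P)"
    using j k by (intro comm_intros J_intros \<Phi> yS) auto
  then have 1: "0 \<le> 4 *\<^sub>R (\<Phi> + ?P) - Y k * (\<Phi> + ?P)"
    using lap_mult_le[OF unitary_y IH] k by simp
  have 2: "0 \<le> Y k * (\<Phi> + w * (L *\<^sub>R X j + \<eta> *\<^sub>R Y j))"
    using j k \<Phi> by (intro lap_mult_nonneg low1 comm_intros J_intros) auto
  \<comment> \<open>The first two summands carry out the split of \<open>\<Phi>\<close>.
    \<open>P3\<close> and \<open>P5\<close> spend \<open>w \<le> 4\<close>, which is why the new
    products enter with coefficient \<open>L\<close> and not \<open>L / 4\<close>. \<open>P1\<close>
    and \<open>P2\<close> cover what the factor \<open>1 - Y k / 4\<close> subtracts from the errors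
    already present.\<close>
  have "0 \<le> (1/4) *\<^sub>R (4 *\<^sub>R (\<Phi> + ?P) - Y k * (\<Phi> + ?P))
      + (1/4) *\<^sub>R (Y k * (\<Phi> + w * (L *\<^sub>R X j + \<eta> *\<^sub>R Y j)))
      + (\<eta>/4) *\<^sub>R (Y k * (w * X j)) + (L/4) *\<^sub>R (Y k * ?S)
      + (L/4) *\<^sub>R (4 *\<^sub>R (X j * Y k) - w * (X j * Y k))
      + (L/32) *\<^sub>R (w * (q ^ ?m * (Y j * (8 *\<^sub>R (X k + Y k) - w))))
      + (L/4) *\<^sub>R (4 *\<^sub>R (X k * Y j) - w * (q ^ ?m * (X k * Y j)))"
    using 1 2 P1 P2 P3 P4 P5 pos by (intro add_nonneg_nonneg scaleR_nonneg_nonneg) auto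
  also have "\<dots> = \<Phi> + \<eta> *\<^sub>R (w * (X j + Y j)) + L *\<^sub>R (w * (q ^ Suc ?m * Y j))
           + L *\<^sub>R ?S + L *\<^sub>R (X j * Y k + X k * Y j)"
  proof -
    define Q S where "Q = q ^ ?m" and "S = ?S"
    have QS: "q ^ Suc ?m * Y j = Q * Y j - (1/32) *\<^sub>R (Q * (w * Y j))"
      by (simp only: power_Suc2 damp_def[of z]) (simp add: algebra_simps Q_def damp_def)
    have YY: "Y k * Y j = Y j * Y k"
      using j k by (intro commD comm_intros comm_sym[OF comm_lap] J_intros) auto
    have move: "Y k * (w * p) = w * (Y k * p)" "Y j * (w * p) = w * (Y j * p)"
      "Y k * (Q * p) = Q * (Y k * p)" "Q * (w * p) = w * (Q * p)" for p
      using w_move[of k] w_move[of j] q_move(1,2)[of k ?m] q_move(3)[of ?m] j k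
      by (simp_all add: Q_def flip: mult.assoc)
    show ?thesis
      unfolding QS unfolding Q_def[symmetric] S_def[symmetric]
      by (rule linear_functional_eqI)
        (use j k in \<open>simp (no_asm_simp) add: algebra_simps move YY XY_off w_move\<close>)
  qed
  finally show ?case
    using insert by (simp add: algebra_simps)
qed

end

section \<open>Averaging over subsets, and summation over the system\<close>

lemma sum_over_subsets:
  fixes g :: "'i \<Rightarrow> 'a::real_vector"
  assumes "finite I" "I \<noteq> {}"
  shows "(\<Sum>M | M \<subseteq> I \<and> card M = m. \<Sum>k\<in>M. g k)
    = ((card I choose m) * m / card I) *\<^sub>R (\<Sum>k\<in>I. g k)"
proof (cases m)
  case 0
  have "(\<Sum>M | M \<subseteq> I \<and> card M = m. \<Sum>k\<in>M. g k) = 0"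
  proof (rule sum.neutral, rule ballI)
    fix M assume "M \<in> {M. M \<subseteq> I \<and> card M = m}"
    then have "M = {}" using 0 assms(1) by (auto dest: finite_subset)
    then show "(\<Sum>k\<in>M. g k) = 0" by simp
  qed
  then show ?thesis using 0 by simp
next
  case (Suc l)
  let ?\<M> = "{M. M \<subseteq> I \<and> card M = m}"
  have count: "card {M \<in> ?\<M>. k \<in> M} = (card I - 1) choose l" if k: "k \<in> I" for k
  proof -
    have "{M \<in> ?\<M>. k \<in> M} = insert k ` {M. M \<subseteq> I - {k} \<and> card M = l}"
    proof (intro equalityI subsetI)
      fix M assume M: "M \<in> {M \<in> ?\<M>. k \<in> M}"
      then have "card (M - {k}) = l" using Suc by simp
      moreover have "M = insert k (M - {k})" using M by auto
      ultimately show "M \<in> insert k ` {M. M \<subseteq> I - {k} \<and> card M = l}"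
        using M by blast
    next
      fix M assume "M \<in> insert k ` {M. M \<subseteq> I - {k} \<and> card M = l}"
      then obtain M' where "M = insert k M'" "M' \<subseteq> I - {k}" "card M' = l" by blast
      moreover from this have "finite M'" "k \<notin> M'" using assms(1) finite_subset by auto
      ultimately show "M \<in> {M \<in> ?\<M>. k \<in> M}" using k Suc by auto
    qed
    moreover have "inj_on (insert k) {M. M \<subseteq> I - {k} \<and> card M = l}"
      by (auto simp: inj_on_def)
    ultimately have "card {M \<in> ?\<M>. k \<in> M} = card {M. M \<subseteq> I - {k} \<and> card M = l}"
      by (simp add: card_image)
    then show ?thesis using assms k by (simp add: n_subsets)
  qed
  have fin: "finite ?\<M>" using assms(1) by simp
  have "(\<Sum>M\<in>?\<M>. \<Sum>k\<in>M. g k) = (\<Sum>M\<in>?\<M>. \<Sum>k | k \<in> I \<and> k \<in> M. g k)"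
    by (intro sum.cong refl) auto
  also have "\<dots> = (\<Sum>k\<in>I. \<Sum>M | M \<in> ?\<M> \<and> k \<in> M. g k)"
    by (rule sum.swap_restrict[OF fin assms(1)])
  also have "\<dots> = (\<Sum>k\<in>I. real ((card I - 1) choose l) *\<^sub>R g k)"
    by (intro sum.cong refl) (simp only: sum_constant_scaleR count)
  also have "real ((card I - 1) choose l) = (card I choose m) * m / card I"
  proof -
    have "card I > 0" using assms by (simp add: card_gt_0_iff)
    then obtain n where n: "card I = Suc n" by (cases "card I") auto
    have "Suc n * (n choose l) = (Suc n choose Suc l) * Suc l"
      by (rule Suc_times_binomial_eq)
    then have "real (Suc n) * real (n choose l) = real (Suc n choose Suc l) * real (Suc l)"
      by (simp only: flip: of_nat_mult)
    then show ?thesis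
      unfolding n Suc by (simp add: field_simps del: binomial_Suc_Suc)
  qed
  finally show ?thesis by (simp add: scaleR_sum_right)
qed

context heisenberg
begin

text \<open>Averaging \<open>mixing\<close> over all \<open>m\<close>-element subsets distributes
  the products evenly, since each \<open>k\<close> lies in the fraction
  \<open>m / (card J - 1)\<close> of them. For fixed \<open>m\<close> the coefficient of each
  product becomes of order \<open>1 / card J\<close>, while the damping keeps its exponent.\<close>

lemma mixing_average:
  assumes j: "j \<in> J" and m: "m < card J" and J: "1 < card J"
    and \<Phi>: "\<And>k. k \<in> J - {j} \<Longrightarrow> comm (y k) \<Phi>"
    and low1: "0 \<le> \<Phi> + w * (L *\<^sub>R X j + \<eta> *\<^sub>R Y j)"
    and low2: "0 \<le> \<Phi> + w * (\<eta> *\<^sub>R X j + L *\<^sub>R Y j)"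
    and pos: "0 \<le> L" "0 \<le> \<eta>"
  shows "0 \<le> \<Phi> + \<eta> *\<^sub>R (w * (X j + Y j)) + L *\<^sub>R (w * (q ^ m * Y j))
           + (L * m / (card J - 1)) *\<^sub>R (\<Sum>k\<in>J-{j}. X j * Y k + X k * Y j)"
proof -
  let ?I = "J - {j}" and ?\<M> = "{M. M \<subseteq> J - {j} \<and> card M = m}"
  let ?P = "\<Phi> + \<eta> *\<^sub>R (w * (X j + Y j)) + L *\<^sub>R (w * (q ^ m * Y j))"
  let ?g = "\<lambda>k. X j * Y k + X k * Y j"
  have cI: "card ?I = card J - 1" using j finite_J by simp
  have I: "?I \<noteq> {}" "finite ?I"
    using cI J finite_J by force+
  define c where "c = real (card ?I choose m)"
  have c: "c > 0" using m j cI by (simp add: c_def)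
  have cM: "real (card ?\<M>) = c"
    using I(2) by (simp add: n_subsets c_def)
  have average: "(1/c) *\<^sub>R (\<Sum>M\<in>?\<M>. P + L *\<^sub>R (\<Sum>k\<in>M. g k))
      = P + (L * m / (card J - 1)) *\<^sub>R (\<Sum>k\<in>?I. g k)" for P and g :: "'i \<Rightarrow> 'a"
  proof -
    have "(\<Sum>M\<in>?\<M>. P + L *\<^sub>R (\<Sum>k\<in>M. g k))
      = c *\<^sub>R P + L *\<^sub>R (c * m / card ?I) *\<^sub>R (\<Sum>k\<in>?I. g k)"
      by (simp add: sum.distrib sum_constant_scaleR cM sum_over_subsets[OF I(2,1)] c_def
          del: sum_constant flip: scaleR_sum_right)
    then show ?thesis using c by (simp add: scaleR_right_distrib cI)
  qed
  have "0 \<le> (1/c) *\<^sub>R (\<Sum>M\<in>?\<M>. ?P + L *\<^sub>R (\<Sum>k\<in>M. ?g k))"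
  proof (intro scaleR_nonneg_nonneg sum_nonneg)
    fix M assume "M \<in> ?\<M>"
    then have M: "finite M" "M \<subseteq> J - {j}" "card M = m"
      using I finite_subset by auto
    show "0 \<le> ?P + L *\<^sub>R (\<Sum>k\<in>M. ?g k)"
      using mixing[OF j M(1,2) \<Phi> low1 low2 pos] M(3) by simp
  qed (use c in auto)
  then show ?thesis unfolding average .
qed

abbreviation "chain j \<equiv> X j * Y j + Y j * X j"
abbreviation "xi j \<equiv> chain j + w * (2 *\<^sub>R 1 - X j - Y j)"

definition "A = (\<Sum>j\<in>J. X j)"
definition "B = (\<Sum>j\<in>J. Y j)"
definition "Chain = (\<Sum>j\<in>J. chain j)"
definition "Op = (\<Sum>j\<in>J. \<Sum>k\<in>J-{j}. X j * Y k)"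
definition "RX = (\<Sum>j\<in>J. \<Sum>k\<in>J-{j}. X j * X k)"
definition "RY = (\<Sum>j\<in>J. \<Sum>k\<in>J-{j}. Y j * Y k)"
text \<open>This is the sum of \<open>x j + star (x j) + y j + star (y j) - 2 *\<^sub>R 1\<close>,
  so it is close to \<open>2 * card J\<close> when all \<open>x j\<close> and \<open>y j\<close> are
  close to \<open>1\<close>.\<close>

definition "G = (2 * card J) *\<^sub>R 1 - A - B"

lemma sum_off_diag_swap: "(\<Sum>j\<in>J. \<Sum>k\<in>J-{j}. f j k) = (\<Sum>j\<in>J. \<Sum>k\<in>J-{j}. f k j)"
proof -
  have "{k \<in> J. k \<noteq> j} = J - {j}" "{k \<in> J. j \<noteq> k} = J - {j}" for j
    by auto
  then show ?thesis
    using sum.swap_restrict[OF finite_J finite_J, of f "\<lambda>j k. k \<noteq> j"] by simp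
qed

lemma sum_chain: "(\<Sum>j\<in>J. xi j) = Chain + w * G"
  by (simp add: Chain_def G_def A_def B_def sum.distrib sum_subtractf sum_constant_scaleR mult.commute del: sum_constant flip: sum_distrib_left)

text \<open>The error of \<open>mixing_average\<close> summed over \<open>j\<close>. The part with
  \<open>\<eta>\<close> is paid by \<open>w_AB_le\<close>, the damped part by
  \<open>damped_B_le\<close>, and the rest is a small multiple of \<open>Op\<close>.\<close>

definition "E L \<eta> m = \<eta> *\<^sub>R (w * (A + B)) + L *\<^sub>R (w * (q ^ m * B))
    + (L * m / (card J - 1)) *\<^sub>R (2 *\<^sub>R Op)"

lemma comm_z_sums: "comm z A" "comm z B" "comm z Chain" "comm z Op" "comm z (E L \<eta> m)" "comm z G"
  "comm z RX" "comm z RY"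
  by (auto simp: A_def B_def Chain_def Op_def E_def G_def RX_def RY_def
      intro!: comm_z comm_sum comm_add comm_mult comm_diff comm_scaleR comm_one)

lemma sums_nonneg: "0 \<le> A" "0 \<le> B" "0 \<le> Op" "0 \<le> RX" "0 \<le> RY"
  by (auto simp: A_def B_def Op_def RX_def RY_def intro!: sum_nonneg lap_nonneg XY_nonneg XX_nonneg YY_nonneg)

lemma E_nonneg:
  assumes "0 \<le> L" "0 \<le> \<eta>" "1 < card J" shows "0 \<le> E L \<eta> m"
proof -
  have "0 \<le> q ^ m * B"
    using damp_power_mult[OF unitary_z sums_nonneg(2) comm_z_sums(2), of m] ..
  then have "0 \<le> w * (q ^ m * B)"
    by (intro lap_mult_nonneg comm_mult[OF comm_z(4) comm_z_sums(2)])
  moreover have "0 \<le> w * (A + B)"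
    by (intro lap_mult_nonneg add_nonneg_nonneg sums_nonneg comm_add comm_z_sums)
  ultimately show ?thesis
    unfolding E_def using assms by (intro add_nonneg_nonneg scaleR_nonneg_nonneg sums_nonneg) auto
qed

lemma sum_mixing:
  assumes m: "m < card J" and J: "1 < card J"
    and \<Phi>: "\<And>j k. j \<in> J \<Longrightarrow> k \<in> J - {j} \<Longrightarrow> comm (y k) (\<Phi> j)"
    and low1: "\<And>j. j \<in> J \<Longrightarrow> 0 \<le> \<Phi> j + w * (L *\<^sub>R X j + \<eta> *\<^sub>R Y j)"
    and low2: "\<And>j. j \<in> J \<Longrightarrow> 0 \<le> \<Phi> j + w * (\<eta> *\<^sub>R X j + L *\<^sub>R Y j)"
    and pos: "0 \<le> L" "0 \<le> \<eta>"
  shows "0 \<le> (\<Sum>j\<in>J. \<Phi> j) + E L \<eta> m"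
proof -
  have "0 \<le> (\<Sum>j\<in>J. \<Phi> j + \<eta> *\<^sub>R (w * (X j + Y j)) + L *\<^sub>R (w * (q ^ m * Y j))
           + (L * m / (card J - 1)) *\<^sub>R (\<Sum>k\<in>J-{j}. X j * Y k + X k * Y j))"
    by (intro sum_nonneg mixing_average m J \<Phi> low1 low2 pos)
  also have "\<dots> = (\<Sum>j\<in>J. \<Phi> j) + \<eta> *\<^sub>R (w * (A + B)) + L *\<^sub>R (w * (q ^ m * B))
     + (L * m / (card J - 1)) *\<^sub>R (Op + (\<Sum>j\<in>J. \<Sum>k\<in>J-{j}. X k * Y j))"
    by (simp add: sum.distrib A_def B_def Op_def distrib_left sum_distrib_left scaleR_sum_right scaleR_right_distrib)
  also have "(\<Sum>j\<in>J. \<Sum>k\<in>J-{j}. X k * Y j) = Op"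
    unfolding Op_def by (rule sum_off_diag_swap)
  also have "Op + Op = 2 *\<^sub>R Op" by (simp add: scaleR_2)
  finally show ?thesis by (simp add: E_def add.assoc)
qed

text \<open>The bounds for one pair hold with weights 1 and 0. They are weakened to
  \<open>1 + 1/t\<close> and \<open>t\<close> so that the error is the same \<open>E\<close> as in
  \<open>chain_lower\<close>, and the two can be added in
  \<open>lower_bound_w_small\<close>.\<close>

lemma xi_lower: "0 \<le> Chain + w * G + E (1 + 1/t) t m"
  if t: "0 < t" and m: "m < card J" and J: "1 < card J"
proof -
  have "0 \<le> (\<Sum>j\<in>J. xi j) + E (1 + 1/t) t m"
  proof (rule sum_mixing[OF m J])
    show "comm (y k) (xi j)" if "j \<in> J" "k \<in> J - {j}" for j k
      using that by (intro comm_intros J_intros) auto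
  next
    fix j assume j: "j \<in> J"
    interpret p: heisenberg_pair "x j" "y j" z by (rule pair[OF j])
    have "0 \<le> (xi j + w * X j) + ((1/t) *\<^sub>R (w * X j) + t *\<^sub>R (w * Y j))"
      using t j by (intro add_nonneg_nonneg[OF p.xi_lower(1)[unfolded p.xi_def p.chain_def]]
          add_nonneg_nonneg scaleR_nonneg_nonneg lap_mult_nonneg lap_nonneg comm_z) auto
    then show "0 \<le> xi j + w * ((1 + 1 / t) *\<^sub>R X j + t *\<^sub>R Y j)"
      by (simp add: algebra_simps)
    have "0 \<le> (xi j + w * Y j) + ((1/t) *\<^sub>R (w * Y j) + t *\<^sub>R (w * X j))"
      using t j by (intro add_nonneg_nonneg[OF p.xi_lower(2)[unfolded p.xi_def p.chain_def]]
          add_nonneg_nonneg scaleR_nonneg_nonneg lap_mult_nonneg lap_nonneg comm_z) auto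
    then show "0 \<le> xi j + w * (t *\<^sub>R X j + (1 + 1 / t) *\<^sub>R Y j)"
      by (simp add: algebra_simps)
  qed (use t in auto)
  then show ?thesis by (simp add: sum_chain)
qed

lemma chain_lower: "0 \<le> (1/4) *\<^sub>R (w * Chain) + E (1 + 1/t) t m"
  if t: "0 < t" and m: "m < card J" and J: "1 < card J"
proof -
  have "0 \<le> (\<Sum>j\<in>J. (1/4) *\<^sub>R (w * chain j)) + E (1 + 1/t) t m"
  proof (rule sum_mixing[OF m J])
    show "comm (y k) ((1/4) *\<^sub>R (w * chain j))" if "j \<in> J" "k \<in> J - {j}" for j k
      using that by (intro comm_intros J_intros) auto
  next
    fix j assume j: "j \<in> J"
    interpret p: heisenberg_pair "x j" "y j" z by (rule pair[OF j])
    have *: "0 \<le> w * (chain j + 4 *\<^sub>R (r *\<^sub>R X j + (1/r) *\<^sub>R Y j))" if "r > 0" for r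
      using p.chain_lower[OF that] j unfolding p.chain_def
      by (intro lap_mult_nonneg) (auto intro!: comm_add comm_mult comm_scaleR comm_z)
    \<comment> \<open>The weights \<open>1/t\<close> here and \<open>t\<close> further down give the
      two opposite unbalanced bounds that \<open>mixing\<close> plays against each other.\<close>
    have "0 \<le> (1/4) *\<^sub>R (w * (chain j + 4 *\<^sub>R ((1/t) *\<^sub>R X j + (1/(1/t)) *\<^sub>R Y j))) + w * X j"
      using t j *[of "1/t"]
      by (intro add_nonneg_nonneg scaleR_nonneg_nonneg lap_mult_nonneg[OF lap_nonneg] comm_z) auto
    then show "0 \<le> (1/4) *\<^sub>R (w * chain j) + w * ((1 + 1 / t) *\<^sub>R X j + t *\<^sub>R Y j)"
      by (simp add: algebra_simps)
    have "0 \<le> (1/4) *\<^sub>R (w * (chain j + 4 *\<^sub>R (t *\<^sub>R X j + (1/t) *\<^sub>R Y j))) + w * Y j"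
      using t j *[of t]
      by (intro add_nonneg_nonneg scaleR_nonneg_nonneg lap_mult_nonneg[OF lap_nonneg] comm_z) auto
    then show "0 \<le> (1/4) *\<^sub>R (w * chain j) + w * (t *\<^sub>R X j + (1 + 1 / t) *\<^sub>R Y j)"
      by (simp add: algebra_simps)
  qed (use t in auto)
  then show ?thesis by (simp add: Chain_def sum_distrib_left scaleR_sum_right)
qed

end

section \<open>The gain from many commuting oscillators\<close>

lemma cross_square:
  fixes a b a' b' :: "'a::star_algebra"
  assumes "\<And>p q. p \<in> {a, b, star a, star b} \<Longrightarrow> q \<in> {a', b', star a', star b'} \<Longrightarrow> comm q p"
  shows "star (a * b' - a' * b) * (a * b' - a' * b)
    = star a * a * (star b' * b') + star a' * a' * (star b * b)
      - (star a * b) * star (star a' * b') - (star a' * b') * star (star a * b)"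
proof -
  have c: "q * p = p * q" "q * (p * s) = p * (q * s)"
    if "p \<in> {a, b, star a, star b}" "q \<in> {a', b', star a', star b'}" for p q s
    using commD[OF assms[OF that]] comm_left[OF assms[OF that]] by auto
  note [simp] =
    c[of a a'] c[of a b'] c[of a "star a'"] c[of a "star b'"]
    c[of b a'] c[of b b'] c[of b "star a'"] c[of b "star b'"]
    c[of "star a" a'] c[of "star a" b'] c[of "star a" "star a'"] c[of "star a" "star b'"]
    c[of "star b" a'] c[of "star b" b'] c[of "star b" "star a'"] c[of "star b" "star b'"]
  show ?thesis
    by (rule linear_functional_eqI) (simp (no_asm_simp) add: star_simps algebra_simps)
qed

lemma sum_mult_off_diagonal:
  fixes f g :: "'i \<Rightarrow> 'a::semiring_0"
  assumes "finite J"
  shows "sum f J * sum g J = (\<Sum>j\<in>J. f j * g j) + (\<Sum>j\<in>J. \<Sum>k\<in>J-{j}. f j * g k)"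
proof -
  have "(\<Sum>k\<in>J. f j * g k) = f j * g j + (\<Sum>k\<in>J-{j}. f j * g k)" if "j \<in> J" for j
    using assms that by (rule sum.remove)
  then show ?thesis by (simp add: sum_product sum.distrib)
qed

context heisenberg
begin

text \<open>Lagrange's identity without its diagonal: summing the squares of
  \<open>u j * v k - u k * v j\<close> over ordered pairs counts everything twice, hence the factor
  \<open>1/2\<close> in the proof. The diagonal is left out because \<open>u j\<close> and
  \<open>v j\<close> need not commute.\<close>

lemma off_diagonal_square:
  assumes j: "\<And>j k p q. j \<in> J \<Longrightarrow> k \<in> J \<Longrightarrow> j \<noteq> k \<Longrightarrow> p \<in> {u j, v j, star (u j), star (v j)}
        \<Longrightarrow> q \<in> {u k, v k, star (u k), star (v k)} \<Longrightarrow> comm q p"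
    and u: "\<And>j. j \<in> J \<Longrightarrow> star (u j) * u j = X j" and v: "\<And>j. j \<in> J \<Longrightarrow> star (v j) * v j = Y j"
  shows "0 \<le> Op - (\<Sum>j\<in>J. \<Sum>k\<in>J-{j}. (star (u j) * v j) * star (star (u k) * v k))"
proof -
  define S where "S j = star (u j) * v j" for j
  have "0 \<le> (\<Sum>j\<in>J. \<Sum>k\<in>J-{j}. star (u j * v k - u k * v j) * (u j * v k - u k * v j))"
    by (intro sum_nonneg sq_nonneg)
  also have "\<dots> = (\<Sum>j\<in>J. \<Sum>k\<in>J-{j}. X j * Y k + X k * Y j - S j * star (S k) - S k * star (S j))"
  proof (intro sum.cong refl)
    fix j k assume jk: "j \<in> J" "k \<in> J - {j}"
    then show "star (u j * v k - u k * v j) * (u j * v k - u k * v j)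
        = X j * Y k + X k * Y j - S j * star (S k) - S k * star (S j)"
      using j u v by (subst cross_square) (auto simp: S_def)
  qed
  also have "\<dots> = Op + (\<Sum>j\<in>J. \<Sum>k\<in>J-{j}. X k * Y j) - (\<Sum>j\<in>J. \<Sum>k\<in>J-{j}. S j * star (S k))
      - (\<Sum>j\<in>J. \<Sum>k\<in>J-{j}. S k * star (S j))"
    by (simp add: sum.distrib sum_subtractf Op_def)
  also have "(\<Sum>j\<in>J. \<Sum>k\<in>J-{j}. X k * Y j) = Op"
    unfolding Op_def by (rule sum_off_diag_swap)
  also have "(\<Sum>j\<in>J. \<Sum>k\<in>J-{j}. S k * star (S j)) = (\<Sum>j\<in>J. \<Sum>k\<in>J-{j}. S j * star (S k))"
    by (rule sum_off_diag_swap)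
  finally have "0 \<le> (1/2) *\<^sub>R (Op + Op - (\<Sum>j\<in>J. \<Sum>k\<in>J-{j}. S j * star (S k)) - (\<Sum>j\<in>J. \<Sum>k\<in>J-{j}. S j * star (S k)))"
    by (intro scaleR_nonneg_nonneg) auto
  also have "\<dots> = Op - (\<Sum>j\<in>J. \<Sum>k\<in>J-{j}. S j * star (S k))"
    by (rule linear_functional_eqI) (simp (no_asm_simp))
  finally show ?thesis by (simp add: S_def)
qed

lemma comm_ab:
  assumes jk: "j \<in> J" "k \<in> J" "j \<noteq> k"
    and p: "p \<in> {1 - x j, 1 - y j, star (1 - x j), star (1 - y j)}"
    and p': "p' \<in> {1 - x k, 1 - y k, star (1 - x k), star (1 - y k)}"
  shows "comm p' p"
proof -
  have *: "comm u p'" if u: "u \<in> {x j, y j}" for u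
  proof -
    have "comm u (x k)" "comm u (y k)"
      using u jk by (auto intro: J_intros)
    then show ?thesis
      using p' jk by (auto simp: star_diff intro!: comm_diff comm_one comm_star unitary_x unitary_y)
  qed
  have "comm p' (x j)" "comm p' (y j)"
    by (rule comm_sym, rule *, simp)+
  then show ?thesis
    using p jk by (auto simp: star_diff intro!: comm_diff comm_one comm_star unitary_x unitary_y)
qed

lemma normal_X: "j \<in> J \<Longrightarrow> (1 - x j) * star (1 - x j) = X j"
  and normal_Y: "j \<in> J \<Longrightarrow> (1 - y j) * star (1 - y j) = Y j"
  using unitary_x[of j] unitary_y[of j] by (auto simp: unitary_def lap_def star_simps algebra_simps)

text \<open>With $S = \sum_j a_j^* b_j$ and $T = \sum_j a_j b_j^*$, where $a_j = 1 - x_j$ and $b_j = 1 - y_j$, the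
  squares of $a_j b_k - a_k b_j$ and $a_j^* b_k^* - a_k^* b_j^*$ bound $S S^* + T^* T$ from above.  Twice this
  sum is $|S^* - T|^2 + |S^* + T|^2$, and $S^* - T = (z - 1) c$.\<close>
lemma gain_one_sign:
  defines "c \<equiv> \<Sum>j\<in>J. x j * star (y j)"
  shows "0 \<le> 2 *\<^sub>R Op + (\<Sum>j\<in>J. star (1 - x j) * Y j * (1 - x j) + (1 - y j) * X j * star (1 - y j))
     - (r/2) *\<^sub>R (w * (c + star c)) + (r * r / 2) *\<^sub>R w"
proof -
  let ?a = "\<lambda>j. 1 - x j" and ?b = "\<lambda>j. 1 - y j"
  define S T where "S j = star (?a j) * ?b j" and "T j = ?a j * star (?b j)" for j
  let ?S = "\<Sum>j\<in>J. S j" and ?T = "\<Sum>j\<in>J. T j"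
  have S1: "0 \<le> Op - (\<Sum>j\<in>J. \<Sum>k\<in>J-{j}. S j * star (S k))"
    unfolding S_def by (rule off_diagonal_square[OF comm_ab]) (assumption | simp add: lap_def)+
  \<comment> \<open>The same bound for the adjoints. Since \<open>1 - x j\<close> and
    \<open>1 - y j\<close> are normal, their squares are again \<open>X j\<close> and
    \<open>Y j\<close>, so \<open>Op\<close> is unchanged.\<close>
  have "0 \<le> Op - (\<Sum>j\<in>J. \<Sum>k\<in>J-{j}. (star (star (?a j)) * star (?b j)) * star (star (star (?a k)) * star (?b k)))"
    by (rule off_diagonal_square[of "\<lambda>j. star (?a j)" "\<lambda>j. star (?b j)"])
       (simp_all only: star_star normal_X normal_Y, rule comm_ab, auto simp only: insert_iff)
  also have "(\<Sum>j\<in>J. \<Sum>k\<in>J-{j}. (star (star (?a j)) * star (?b j)) * star (star (star (?a k)) * star (?b k)))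
     = (\<Sum>j\<in>J. \<Sum>k\<in>J-{j}. star (T k) * T j)"
  proof (intro sum.cong refl)
    fix j k assume jk: "j \<in> J" "k \<in> J - {j}"
    have "comm (?b k * star (?a k)) p" if "p \<in> {?a j, ?b j, star (?a j), star (?b j)}" for p
      by (rule comm_sym, rule comm_mult; rule comm_ab[OF _ _ _ _ that, of k]) (use jk in auto)
    then have "comm (star (T k)) (T j)"
      unfolding T_def star_mult star_star by (intro comm_mult) simp_all
    then show "(star (star (?a j)) * star (?b j)) * star (star (star (?a k)) * star (?b k)) = star (T k) * T j"
      by (simp add: comm_def T_def)
  qed
  also have "\<dots> = (\<Sum>j\<in>J. \<Sum>k\<in>J-{j}. star (T j) * T k)"
    by (rule sum_off_diag_swap)
  finally have T1: "0 \<le> Op - (\<Sum>j\<in>J. \<Sum>k\<in>J-{j}. star (T j) * T k)" .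
  have S2: "?S * star ?S = (\<Sum>j\<in>J. S j * star (S j)) + (\<Sum>j\<in>J. \<Sum>k\<in>J-{j}. S j * star (S k))"
    unfolding star_sum by (rule sum_mult_off_diagonal[OF finite_J])
  have T2: "star ?T * ?T = (\<Sum>j\<in>J. star (T j) * T j) + (\<Sum>j\<in>J. \<Sum>k\<in>J-{j}. star (T j) * T k)"
    unfolding star_sum by (rule sum_mult_off_diagonal[OF finite_J])
  have diag: "(\<Sum>j\<in>J. star (?a j) * Y j * ?a j + ?b j * X j * star (?b j))
     = (\<Sum>j\<in>J. S j * star (S j)) + (\<Sum>j\<in>J. star (T j) * T j)"
    unfolding sum.distrib[symmetric]
  proof (intro sum.cong refl)
    fix j assume j: "j \<in> J"
    show "star (?a j) * Y j * ?a j + ?b j * X j * star (?b j) = S j * star (S j) + star (T j) * T j"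
      unfolding S_def T_def normal_Y[OF j, symmetric] star_mult star_star lap_def[of "x j"]
      by (simp only: mult.assoc)
  qed
  have "star ?S - ?T = (\<Sum>j\<in>J. (z - 1) * (x j * star (y j)))"
    unfolding star_sum sum_subtractf[symmetric]
  proof (intro sum.cong refl)
    fix j assume j: "j \<in> J"
    interpret p: heisenberg_pair "x j" "y j" z by (rule pair[OF j])
    show "star (S j) - T j = (z - 1) * (x j * star (y j))"
      by (simp add: S_def T_def star_simps algebra_simps p.words)
  qed
  then have D: "star ?S - ?T = (z - 1) * c"
    by (simp add: c_def sum_distrib_left)
  have zc: "comm z c" "comm z (star c)"
    by (auto simp: c_def star_sum star_mult intro!: comm_intros J_intros)
  have "star (star ?S - ?T) * (star ?S - ?T) = star c * (w * c)"
    unfolding D lap_def star_mult star_diff star_one by (simp add: algebra_simps)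
  also have "\<dots> = w * (star c * c)"
    by (rule comm_left) (intro comm_lap[OF unitary_z] comm_sym[OF zc(2)])
  finally have D2: "star (star ?S - ?T) * (star ?S - ?T) = w * (star c * c)" .
  \<comment> \<open>This replaces the quadratic gain \<open>w * (star c * c)\<close> by its tangent
    at the scalar \<open>r\<close>, which is linear in \<open>c\<close> and can be averaged over
    signs. The value of \<open>r\<close> is fixed only in
    \<open>lower_bound_combined\<close>.\<close>
  have "0 \<le> w * (star (c - r *\<^sub>R 1) * (c - r *\<^sub>R 1))"
    by (intro lap_mult_nonneg sq_nonneg)
       (auto simp: star_simps intro!: comm_mult comm_diff comm_scaleR comm_one zc)
  also have "\<dots> = w * (star c * c) - r *\<^sub>R (w * (c + star c)) + (r * r) *\<^sub>R w"
    by (simp add: star_simps algebra_simps)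
  finally have W: "0 \<le> w * (star c * c) - r *\<^sub>R (w * (c + star c)) + (r * r) *\<^sub>R w" .
  have P: "0 \<le> star (star ?S + ?T) * (star ?S + ?T)" by (rule sq_nonneg)
  have "0 \<le> (Op - (\<Sum>j\<in>J. \<Sum>k\<in>J-{j}. S j * star (S k))) + (Op - (\<Sum>j\<in>J. \<Sum>k\<in>J-{j}. star (T j) * T k))
     + (1/2) *\<^sub>R (star (star ?S + ?T) * (star ?S + ?T))
     + (1/2) *\<^sub>R (w * (star c * c) - r *\<^sub>R (w * (c + star c)) + (r * r) *\<^sub>R w)"
    by (intro add_nonneg_nonneg[OF _ scaleR_nonneg_nonneg[OF _ W]]
       add_nonneg_nonneg[OF _ scaleR_nonneg_nonneg[OF _ P]] add_nonneg_nonneg[OF S1 T1]) auto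
  also have "\<dots> = 2 *\<^sub>R Op + (\<Sum>j\<in>J. star (?a j) * Y j * ?a j + ?b j * X j * star (?b j))
     - (r/2) *\<^sub>R (w * (c + star c)) + (r * r / 2) *\<^sub>R w"
  proof -
    define s t where "s = ?S" and "t = ?T"
    have 1: "(\<Sum>j\<in>J. S j * star (S j)) = s * star s - (\<Sum>j\<in>J. \<Sum>k\<in>J-{j}. S j * star (S k))"
      "(\<Sum>j\<in>J. star (T j) * T j) = star t * t - (\<Sum>j\<in>J. \<Sum>k\<in>J-{j}. star (T j) * T k)"
      using S2 T2 by (simp_all add: s_def t_def)
    have 2: "w * (star c * c) = star (star s - t) * (star s - t)"
      using D2 by (simp add: s_def t_def)
    define p p' C where "p = (\<Sum>j\<in>J. \<Sum>k\<in>J-{j}. S j * star (S k))"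
      and "p' = (\<Sum>j\<in>J. \<Sum>k\<in>J-{j}. star (T j) * T k)" and "C = w * (c + star c)"
    show ?thesis
      unfolding diag 1 2 unfolding s_def[symmetric] t_def[symmetric]
      unfolding p_def[symmetric] p'_def[symmetric] C_def[symmetric]
      by (rule linear_functional_eqI) (simp (no_asm_simp) add: star_simps algebra_simps)
  qed
  finally show ?thesis .
qed

end

context heisenberg
begin

text \<open>Inverting one of the two families inverts the commutator \<open>z\<close>; inverting
  both restores it. None of this changes \<open>X\<close>, \<open>Y\<close> or \<open>w\<close>, so
  the four sign choices in \<open>gain\<close> share all their terms except the linear ones.\<close>

lemma flip_xy: "heisenberg J (\<lambda>j. star (x j)) (\<lambda>j. star (y j)) z"
  and flip_x: "heisenberg J (\<lambda>j. star (x j)) y (star z)"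
  and flip_y: "heisenberg J x (\<lambda>j. star (y j)) (star z)"
proof -
  have sc: "comm (star u) v" if "comm u v" "unitary u" for u v :: 'a
    by (rule comm_sym[OF comm_star[OF that(2) comm_sym[OF that(1)]]])
  have ss: "comm (star u) (star v)" if "comm u v" "unitary u" "unitary v" for u v :: 'a
    by (rule sc[OF comm_star[OF that(3,1)] that(2)])
  have z: "comm z (star (x j))" "comm z (star (y j))" "comm (star z) (x j)" "comm (star z) (y j)"
    "comm (star z) (star (x j))" "comm (star z) (star (y j))" if "j \<in> J" for j
    by (rule ss sc comm_star; rule zx zy unitary_x unitary_y unitary_z; fact that)+
  have xy: "comm (star (x j)) (star (x k))" "comm (star (y j)) (star (y k))" if "j \<in> J" "k \<in> J" for j k
    by (rule ss; rule xx yy unitary_x unitary_y; fact that)+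
  have off: "comm (star (x j)) (star (y k))" "comm (star (x j)) (y k)" "comm (x j) (star (y k))"
    if "j \<in> J" "k \<in> J" "j \<noteq> k" for j k
    by (rule ss sc comm_star; rule xy_off unitary_x unitary_y; fact that)+
  note facts = finite_J unitary_star[OF unitary_x] unitary_star[OF unitary_y] unitary_star[OF unitary_z] unitary_x unitary_y unitary_z z xy off xx yy
  show "heisenberg J (\<lambda>j. star (x j)) (\<lambda>j. star (y j)) z"
  proof (unfold_locales, goal_cases)
    case (5 j)
    interpret p: heisenberg_pair "x j" "y j" z by (rule pair[OF 5])
    show ?case by (simp add: p.words)
  qed (rule facts; assumption?)+
  show "heisenberg J (\<lambda>j. star (x j)) y (star z)"
  proof (unfold_locales, goal_cases)
    case (5 j)
    interpret p: heisenberg_pair "x j" "y j" z by (rule pair[OF 5])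
    show ?case by (simp add: p.words)
  qed (rule facts; assumption?)+
  show "heisenberg J x (\<lambda>j. star (y j)) (star z)"
  proof (unfold_locales, goal_cases)
    case (5 j)
    interpret p: heisenberg_pair "x j" "y j" z by (rule pair[OF 5])
    show ?case by (simp add: p.words)
  qed (rule facts; assumption?)+
qed

text \<open>The average over the four choices of $x_j^{\pm 1}, y_j^{\pm 1}$ replaces $x_j y_j^*$ by the product of the
  real parts of $x_j$ and $y_j$.\<close>
lemma gain:
  "0 \<le> 8 *\<^sub>R Op + 4 *\<^sub>R Chain + 2 *\<^sub>R (w * G) + (4 * card J) *\<^sub>R w
     - (2 * r) *\<^sub>R (w * G) - (r/2) *\<^sub>R (w * Chain) + (2 * r * r) *\<^sub>R w"
proof -
  define K where "K x y j = star (1 - x) * lap y * (1 - x) + (1 - y) * lap x * star (1 - y)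
      - (r/2) *\<^sub>R (w * (x * star y + y * star x))" for x y :: 'a and j :: 'i
  have lw: "lap (star z) = w"
    by (rule lap_star[OF unitary_z])
  have laps: "j \<in> J \<Longrightarrow> lap (star (x j)) = X j" "j \<in> J \<Longrightarrow> lap (star (y j)) = Y j" for j
    by (intro lap_star unitary_x unitary_y; assumption)+
  have gen: "0 \<le> 2 *\<^sub>R Op + (\<Sum>j\<in>J. K (x' j) (y' j) j) + (r * r / 2) *\<^sub>R w"
    if "heisenberg J x' y' z'" and z': "lap z' = w"
      and l: "\<And>j. j \<in> J \<Longrightarrow> lap (x' j) = X j" "\<And>j. j \<in> J \<Longrightarrow> lap (y' j) = Y j" for x' y' z'
  proof -
    interpret h: heisenberg J x' y' z' by fact
    have "h.Op = Op"
      unfolding h.Op_def Op_def using l by (intro sum.cong arg_cong2[where f = "(*)"]) auto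
    moreover have "(\<Sum>j\<in>J. K (x' j) (y' j) j)
      = (\<Sum>j\<in>J. star (1 - x' j) * lap (y' j) * (1 - x' j) + (1 - y' j) * lap (x' j) * star (1 - y' j))
        - (r/2) *\<^sub>R (w * ((\<Sum>j\<in>J. x' j * star (y' j)) + star (\<Sum>j\<in>J. x' j * star (y' j))))"
      unfolding K_def star_sum sum_subtractf scaleR_sum_right[symmetric] sum_distrib_left[symmetric]
        sum.distrib star_mult star_star ..
    ultimately show ?thesis
      using h.gain_one_sign[of r] unfolding z' by (simp only: add_diff_eq)
  qed
  have "0 \<le> (2 *\<^sub>R Op + (\<Sum>j\<in>J. K (x j) (y j) j) + (r * r / 2) *\<^sub>R w)
    + (2 *\<^sub>R Op + (\<Sum>j\<in>J. K (star (x j)) (star (y j)) j) + (r * r / 2) *\<^sub>R w)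
    + (2 *\<^sub>R Op + (\<Sum>j\<in>J. K (star (x j)) (y j) j) + (r * r / 2) *\<^sub>R w)
    + (2 *\<^sub>R Op + (\<Sum>j\<in>J. K (x j) (star (y j)) j) + (r * r / 2) *\<^sub>R w)"
    by (intro add_nonneg_nonneg gen[of x y z] gen[OF flip_xy] gen[OF flip_x] gen[OF flip_y] laps lw
         heisenberg_axioms refl)
  also have "\<dots> = 8 *\<^sub>R Op + (\<Sum>j\<in>J. K (x j) (y j) j + K (star (x j)) (star (y j)) j
      + K (star (x j)) (y j) j + K (x j) (star (y j)) j) + (2 * r * r) *\<^sub>R w"
    by (rule linear_functional_eqI) (simp (no_asm_simp) add: sum.distrib)
  also have "(\<Sum>j\<in>J. K (x j) (y j) j + K (star (x j)) (star (y j)) j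
      + K (star (x j)) (y j) j + K (x j) (star (y j)) j)
    = (\<Sum>j\<in>J. 4 *\<^sub>R chain j + 2 *\<^sub>R (w * (4 *\<^sub>R 1 - X j - Y j))
        - (r/2) *\<^sub>R (w * (8 *\<^sub>R 1 - 4 *\<^sub>R X j - 4 *\<^sub>R Y j + chain j)))"
  proof (intro sum.cong refl)
    fix j assume j: "j \<in> J"
    interpret p: heisenberg_pair "x j" "y j" z by (rule pair[OF j])
    \<comment> \<open>The left side is the symmetrised product of
      \<open>x j + star (x j) = 2 *\<^sub>R 1 - X j\<close> and
      \<open>y j + star (y j) = 2 *\<^sub>R 1 - Y j\<close>.\<close>
    have cross: "x j * star (y j) + y j * star (x j) + (star (x j) * y j + star (y j) * x j)
        + (star (x j) * star (y j) + y j * x j) + (x j * y j + star (y j) * star (x j))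
      = 8 *\<^sub>R 1 - 4 *\<^sub>R X j - 4 *\<^sub>R Y j + chain j"
      unfolding lap_eq[OF unitary_x[OF j]] lap_eq[OF unitary_y[OF j]]
      by (rule linear_functional_eqI) (simp (no_asm_simp) add: algebra_simps)
    have "K (x j) (y j) j + K (star (x j)) (star (y j)) j + K (star (x j)) (y j) j + K (x j) (star (y j)) j
      = 2 *\<^sub>R (star (1 - x j) * Y j * (1 - x j) + (1 - x j) * Y j * star (1 - x j))
        + 2 *\<^sub>R (star (1 - y j) * X j * (1 - y j) + (1 - y j) * X j * star (1 - y j))
        - (r/2) *\<^sub>R (w * (x j * star (y j) + y j * star (x j) + (star (x j) * y j + star (y j) * x j)
        + (star (x j) * star (y j) + y j * x j) + (x j * y j + star (y j) * star (x j))))"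
      unfolding K_def laps[OF j] star_diff star_one star_star scaleR_2
      by (simp only: distrib_left scaleR_right_distrib) (simp add: add_ac)
    also have "star (1 - x j) * Y j * (1 - x j) + (1 - x j) * Y j * star (1 - x j)
        = chain j + w * (2 *\<^sub>R 1 - Y j)"
      using p.chain_eq_x by simp
    also have "star (1 - y j) * X j * (1 - y j) + (1 - y j) * X j * star (1 - y j)
        = chain j + w * (2 *\<^sub>R 1 - X j)"
      using p.chain_eq_y by simp
    also have "2 *\<^sub>R (chain j + w * (2 *\<^sub>R 1 - Y j)) + 2 *\<^sub>R (chain j + w * (2 *\<^sub>R 1 - X j))
        = 4 *\<^sub>R chain j + 2 *\<^sub>R (w * (4 *\<^sub>R 1 - X j - Y j))"
      by (rule linear_functional_eqI) (simp (no_asm_simp) add: algebra_simps)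
    finally show "K (x j) (y j) j + K (star (x j)) (star (y j)) j + K (star (x j)) (y j) j + K (x j) (star (y j)) j
      = 4 *\<^sub>R chain j + 2 *\<^sub>R (w * (4 *\<^sub>R 1 - X j - Y j))
        - (r/2) *\<^sub>R (w * (8 *\<^sub>R 1 - 4 *\<^sub>R X j - 4 *\<^sub>R Y j + chain j))"
      unfolding cross .
  qed
  also have "\<dots> = 4 *\<^sub>R Chain + 2 *\<^sub>R (w * ((4 * card J) *\<^sub>R 1 - A - B))
        - (r/2) *\<^sub>R (w * ((8 * card J) *\<^sub>R 1 - 4 *\<^sub>R A - 4 *\<^sub>R B + Chain))"
    by (simp add: sum.distrib sum_subtractf A_def B_def Chain_def sum_constant_scaleR
         del: sum_constant flip: scaleR_sum_right sum_distrib_left)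
       (simp add: scaleR_right_distrib mult.commute)
  also have "8 *\<^sub>R Op + (4 *\<^sub>R Chain + 2 *\<^sub>R (w * ((4 * card J) *\<^sub>R 1 - A - B))
        - (r/2) *\<^sub>R (w * ((8 * card J) *\<^sub>R 1 - 4 *\<^sub>R A - 4 *\<^sub>R B + Chain))) + (2 * r * r) *\<^sub>R w
    = 8 *\<^sub>R Op + 4 *\<^sub>R Chain + 2 *\<^sub>R (w * G) + (4 * card J) *\<^sub>R w
     - (2 * r) *\<^sub>R (w * G) - (r/2) *\<^sub>R (w * Chain) + (2 * r * r) *\<^sub>R w"
    unfolding G_def by (rule linear_functional_eqI) (simp (no_asm_simp) add: algebra_simps)
  finally show ?thesis .
qed

end

section \<open>Balancing gain against loss, and the choice of constants\<close>

lemma star_lap: "star (lap u) = lap u"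
  by (simp add: lap_def star_simps)

lemma star_damp_power: "star (damp z ^ n) = damp z ^ n"
  by (induction n) (simp_all add: star_mult power_commutes damp_def star_simps star_lap)

context heisenberg
begin

lemma w_nonneg: "0 \<le> p \<Longrightarrow> comm z p \<Longrightarrow> 0 \<le> w * p"
  by (rule lap_mult_nonneg)

lemma comm_z_AB: "comm z (A + B)"
  by (intro comm_add comm_z_sums)

text \<open>\<open>xi_lower\<close> is multiplied by \<open>1 - w/4\<close>, and
  \<open>chain_lower\<close> restores the \<open>Chain\<close> lost in doing so. The resulting term
  \<open>- (1/4) *\<^sub>R (w * (w * G))\<close> is wanted: it offsets the term in
  \<open>w * (w * G)\<close> that arises in \<open>lower_bound_combined\<close> when
  \<open>w * Chain\<close> is removed from \<open>gain\<close>.\<close>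

lemma lower_bound_w_small:
  assumes t: "0 < t" and m: "m < card J" and J: "1 < card J"
  shows "0 \<le> Chain + w * G - (1/4) *\<^sub>R (w * (w * G)) + 2 *\<^sub>R E (1 + 1/t) t m"
proof -
  define e where "e = E (1 + 1/t) t m"
  let ?P = "Chain + w * G + e"
  have e: "0 \<le> w * e"
    unfolding e_def using t J by (intro w_nonneg E_nonneg comm_z_sums) auto
  have "comm z ?P"
    unfolding e_def by (intro comm_add comm_mult comm_z comm_z_sums)
  then have P: "0 \<le> 4 *\<^sub>R ?P - w * ?P"
    using lap_mult_le[OF unitary_z xi_lower[OF t m J]] unfolding e_def by simp
  have "0 \<le> (1/4) *\<^sub>R (4 *\<^sub>R ?P - w * ?P) + ((1/4) *\<^sub>R (w * Chain) + e) + (1/4) *\<^sub>R (w * e)"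
    by (intro add_nonneg_nonneg scaleR_nonneg_nonneg P e chain_lower[OF t m J, folded e_def]) auto
  also have "\<dots> = Chain + w * G - (1/4) *\<^sub>R (w * (w * G)) + 2 *\<^sub>R e"
    by (rule linear_functional_eqI) (simp (no_asm_simp) add: algebra_simps)
  finally show ?thesis unfolding e_def .
qed

lemma w_square_le: "0 \<le> 8 *\<^sub>R (w * (A + B)) - card J *\<^sub>R (w * w)"
proof -
  have "0 \<le> (\<Sum>j\<in>J. w * (8 *\<^sub>R (X j + Y j) - w))"
    using w_le by (intro sum_nonneg w_nonneg comm_diff comm_scaleR comm_add comm_z) auto
  also have "\<dots> = 8 *\<^sub>R (w * (A + B)) - card J *\<^sub>R (w * w)"
    by (simp add: A_def B_def right_diff_distrib sum_subtractf sum_constant_scaleR sum.distrib distrib_left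
        scaleR_right_distrib del: sum_constant flip: sum_distrib_left scaleR_sum_right)
  finally show ?thesis .
qed

text \<open>With \<open>r = sqrt (card J)\<close> the weight of \<open>gain\<close> is of order
  \<open>1 / r\<close>. Its share of \<open>Op\<close> then tends to 0 and its share of the
  quadratic loss is of order \<open>r\<close>, negligible against the main term
  \<open>2 * t * card J\<close>.\<close>

lemma lower_bound_combined:
  fixes t :: real
  assumes t: "0 < t" "t \<le> 1" and m: "m < card J" and J: "4 \<le> card J" and r: "r = sqrt (card J)"
  shows "0 \<le> Chain + (8/r) *\<^sub>R Op + (10 * r) *\<^sub>R w + 4 *\<^sub>R E (1 + 1/t) t m
     + (5 * t) *\<^sub>R (w * (A + B)) - (2 * t * card J) *\<^sub>R w"
proof -
  define e where "e = E (1 + 1/t) t m"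
  define l where "l = 2 * (1 + t) / (r + 2)"
    \<comment> \<open>the convex combination of \<open>gain\<close> (over 4) and \<open>lower_bound_w_small\<close> in which
      $w G$ keeps the coefficient $-t$, up to $O(1/r)$\<close>
  have "sqrt 4 \<le> r" using J unfolding r by (intro real_sqrt_le_mono) simp
  then have r2: "2 \<le> r" by simp
  have rr: "r * r = card J" by (simp add: r)
  have lr2: "l * (r + 2) = 2 * (1 + t)" using r2 by (simp add: l_def)
  then have t_eq: "t = l * r / 2 + l - 1"
    by (simp add: algebra_simps)
  have l0: "0 \<le> l" using t r2 by (simp add: l_def)
  from lr2 have lr: "l * r \<le> 4" and l1: "l \<le> 1"
    using t l0 r2 mult_left_mono[OF r2 l0] by (auto simp: algebra_simps)
  have l8: "2 * l \<le> 8 / r"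
    using lr r2 by (simp add: field_simps)
  have lrr: "l * r * r \<le> 4 * r"
    using lr r2 by (intro mult_right_mono) auto
  have e0: "0 \<le> e" 
    unfolding e_def using t J by (intro E_nonneg) auto
  have P: "0 \<le> w * (Chain + w * G + e)"
    unfolding e_def using xi_lower[OF t(1) m] J
    by (intro w_nonneg comm_add comm_mult comm_z comm_z_sums) auto
  have we: "0 \<le> 4 *\<^sub>R e - w * e"
    using lap_mult_le[OF unitary_z e0] comm_z_sums(5) unfolding e_def by simp
  have AB: "0 \<le> w * (A + B)"
    by (intro w_nonneg comm_z_AB add_nonneg_nonneg sums_nonneg)
  have wAB: "0 \<le> w * (w * (A + B))"
    by (intro w_nonneg AB comm_mult comm_z comm_z_AB)
  have S1: "0 \<le> Chain + w * G - (1/4) *\<^sub>R (w * (w * G)) + 2 *\<^sub>R e"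
    unfolding e_def using t m J by (intro lower_bound_w_small) auto
  \<comment> \<open>The second summand cancels the \<open>w * Chain\<close> of \<open>gain\<close>.
    It and the third leave \<open>(t/4) *\<^sub>R (w * (w * G))\<close>, which the last two summands
    turn into a multiple of \<open>w * (A + B)\<close>. The remaining summands only round
    coefficients up.\<close>
  have "0 \<le> (l/4) *\<^sub>R (8 *\<^sub>R Op + 4 *\<^sub>R Chain + 2 *\<^sub>R (w * G) + (4 * card J) *\<^sub>R w
        - (2 * r) *\<^sub>R (w * G) - (r/2) *\<^sub>R (w * Chain) + (2 * r * r) *\<^sub>R w)
    + (l * r / 8) *\<^sub>R (w * (Chain + w * G + e))
    + (1 - l) *\<^sub>R (Chain + w * G - (1/4) *\<^sub>R (w * (w * G)) + 2 *\<^sub>R e)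
    + (8 / r - 2 * l) *\<^sub>R Op + (10 * r - (5/2) * (l * r * r)) *\<^sub>R w
    + (l / 2) *\<^sub>R (w * (A + B)) + (l * r / 8) *\<^sub>R (4 *\<^sub>R e - w * e) + (1 - t + 3 * l) *\<^sub>R e
    + (t / 2) *\<^sub>R (8 *\<^sub>R (w * (A + B)) - card J *\<^sub>R (w * w)) + (t / 4) *\<^sub>R (w * (w * (A + B)))"
    using t r2 l0 l1 l8 lrr lap_nonneg[of z]
    by (intro add_nonneg_nonneg scaleR_nonneg_nonneg P S1 gain sums_nonneg AB wAB we e0 w_square_le) auto
  also have "\<dots> = Chain + (8/r) *\<^sub>R Op + (10 * r) *\<^sub>R w + 4 *\<^sub>R e
     + (5 * t) *\<^sub>R (w * (A + B)) - (2 * t * card J) *\<^sub>R w"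
  proof -
    define c where "c = 8 / r"
    have GG: "G = (2 * (r * r)) *\<^sub>R 1 - A - B"
      by (simp add: G_def rr)
    show ?thesis
      unfolding c_def[symmetric] GG rr[symmetric] unfolding t_eq
      by (rule linear_functional_eqI) (simp (no_asm_simp) add: algebra_simps add_divide_distrib diff_divide_distrib rr[symmetric])
  qed
  finally show ?thesis unfolding e_def .
qed

text \<open>Multiply \<open>w \<le> 8 *\<^sub>R (X k + Y k)\<close> by \<open>X j + Y j\<close> for
  \<open>j \<noteq> k\<close> and sum. This is how \<open>RX\<close> and \<open>RY\<close>, with
  coefficients of order \<open>1 / card J\<close>, pay for a bounded multiple of
  \<open>w * (A + B)\<close>.\<close>

lemma w_AB_le: "0 \<le> 8 *\<^sub>R (RX + RY + 2 *\<^sub>R Op) - (card J - 1) *\<^sub>R (w * (A + B))"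
proof -
  have "0 \<le> (\<Sum>j\<in>J. \<Sum>k\<in>J-{j}. X j * (8 *\<^sub>R (X k + Y k) - w) + Y j * (8 *\<^sub>R (X k + Y k) - w))"
    using w_le by (intro sum_nonneg add_nonneg_nonneg lap_mult_nonneg comm_intros J_intros) auto
  also have "\<dots> = (\<Sum>j\<in>J. \<Sum>k\<in>J-{j}. 8 *\<^sub>R (X j * X k) + 8 *\<^sub>R (Y j * Y k) + 8 *\<^sub>R (X j * Y k) + 8 *\<^sub>R (X k * Y j) - w * (X j + Y j))"
    by (intro sum.cong refl) (auto simp: algebra_simps w_move XY_off)
  also have "\<dots> = 8 *\<^sub>R RX + 8 *\<^sub>R RY + 8 *\<^sub>R Op + 8 *\<^sub>R (\<Sum>j\<in>J. \<Sum>k\<in>J-{j}. X k * Y j)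
      - (\<Sum>j\<in>J. \<Sum>k\<in>J-{j}. w * (X j + Y j))"
    by (simp add: sum.distrib sum_subtractf RX_def RY_def Op_def scaleR_sum_right)
  also have "(\<Sum>j\<in>J. \<Sum>k\<in>J-{j}. X k * Y j) = Op"
    unfolding Op_def by (rule sum_off_diag_swap)
  also have "(\<Sum>j\<in>J. \<Sum>k\<in>J-{j}. w * (X j + Y j)) = (card J - 1) *\<^sub>R (w * (A + B))"
    using finite_J by (simp add: sum_constant_scaleR A_def B_def sum.distrib distrib_left del: sum_constant
        flip: sum_distrib_left scaleR_sum_right)
  also have "8 *\<^sub>R RX + 8 *\<^sub>R RY + 8 *\<^sub>R Op + 8 *\<^sub>R Op - (card J - 1) *\<^sub>R (w * (A + B))
      = 8 *\<^sub>R (RX + RY + 2 *\<^sub>R Op) - (card J - 1) *\<^sub>R (w * (A + B))"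
    by (rule linear_functional_eqI) (simp (no_asm_simp))
  finally show ?thesis .
qed

lemma B_square_le: "0 \<le> RY + 4 *\<^sub>R B - B * B"
proof -
  have "B * B = (\<Sum>j\<in>J. Y j * Y j) + RY"
    unfolding B_def RY_def by (rule sum_mult_off_diagonal[OF finite_J])
  moreover have "(\<Sum>j\<in>J. Y j * Y j) \<le> (\<Sum>j\<in>J. 4 *\<^sub>R Y j)"
    by (intro sum_mono lap_mult_le lap_nonneg unitary_y comm_lap comm_refl)
  ultimately show ?thesis
    by (simp add: B_def scaleR_sum_right)
qed

text \<open>$w q^{2m} = O(1/m)$, so \<open>B_square_le\<close> may be multiplied by $m w q^{2m} / 16$; a square
  of the form $|u - v q^m B|^2$ then controls the linear term $w q^m B$.\<close>
lemma damped_B_le: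
  fixes t :: real
  assumes L: "0 < L" and t: "0 < t" and m: "0 < m" and J: "0 < card J"
  shows "0 \<le> (t * card J + 64 * L\<^sup>2 / t) *\<^sub>R w + (64 * L\<^sup>2 / (t * card J * m)) *\<^sub>R RY
      - (4 * L) *\<^sub>R (w * (q ^ m * B))"
proof -
  let ?Q = "q ^ (2 * m)"
  define N where "N = real (card J)"
  have N: "N > 0" using J by (simp add: N_def)
  \<comment> \<open>\<open>u\<close> and \<open>v\<close> are chosen so that the square of
    \<open>u *\<^sub>R 1 - v *\<^sub>R ?c\<close> has constant term \<open>t * N\<close> and linear
    coefficient \<open>2 * (u * v) = 4 * L\<close>.\<close>
  define u where "u = sqrt (t * N)"
  have u: "u > 0" "u * u = t * N" using t N by (simp_all add: u_def)
  define v where "v = 2 * L / u"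
  have v: "u * v = 2 * L" "v * v = 4 * L\<^sup>2 / (t * N)"
    using u by (simp_all add: v_def power2_eq_square)
  let ?c = "q ^ m * B"
  have Bq: "B * q ^ m = q ^ m * B"
    by (intro commD comm_power comm_q comm_sym[OF comm_z_sums(2)])
  have starc: "star ?c = ?c"
    using Bq by (simp add: star_mult star_damp_power B_def star_sum star_lap)
  have cc: "?c * ?c = ?Q * (B * B)"
  proof -
    have "?c * ?c = q ^ m * (B * q ^ m) * B" by (simp only: mult.assoc)
    also have "\<dots> = q ^ m * q ^ m * (B * B)" unfolding Bq by (simp only: mult.assoc)
    finally show ?thesis by (simp add: mult_2 power_add)
  qed
  have zB: "comm z (RY + 4 *\<^sub>R B - B * B)" "comm z ?c"
    by (intro comm_add comm_diff comm_scaleR comm_mult comm_z_sums comm_z)+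
  have "0 \<le> w * (star (u *\<^sub>R 1 - v *\<^sub>R ?c) * (u *\<^sub>R 1 - v *\<^sub>R ?c))"
    by (rule w_nonneg[OF sq_nonneg], unfold star_diff star_scaleR star_one starc)
      (intro comm_mult[OF comm_diff comm_diff] comm_scaleR comm_one zB(2))
  also have "\<dots> = (u * u) *\<^sub>R w - (2 * (u * v)) *\<^sub>R (w * ?c) + (v * v) *\<^sub>R (w * (?c * ?c))"
    unfolding star_diff star_scaleR star_one starc
    by (rule linear_functional_eqI) (simp (no_asm_simp) add: algebra_simps)
  finally have 1: "0 \<le> (t * N) *\<^sub>R w - (4 * L) *\<^sub>R (w * ?c) + (4 * L\<^sup>2 / (t * N)) *\<^sub>R (w * (?Q * (B * B)))"
    unfolding u v cc by simp
  have 2: "0 \<le> w * (?Q * (RY + 4 *\<^sub>R B - B * B))"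
    using damp_power_mult[OF unitary_z B_square_le zB(1)] by (intro w_nonneg comm_mult[OF comm_z(4) zB(1)]) auto
  have "(real (2 * m) / 32) *\<^sub>R (w * (?Q * RY)) \<le> RY - ?Q * RY"
    by (rule lap_damp_power_le[OF unitary_z sums_nonneg(5) comm_z_sums(8)])
  also have "\<dots> \<le> RY"
    using damp_power_mult[OF unitary_z sums_nonneg(5) comm_z_sums(8)] by simp
  \<comment> \<open>\<open>16 / m\<close> is the inverse of the factor \<open>2 * m / 32\<close>
    that \<open>lap_damp_power_le\<close> gives for the exponent \<open>2 * m\<close>.\<close>
  finally have "0 \<le> (16 / m) *\<^sub>R (RY - (real (2 * m) / 32) *\<^sub>R (w * (?Q * RY)))"
    by (intro scaleR_nonneg_nonneg) auto
  then have 3: "0 \<le> (16 / m) *\<^sub>R RY - w * (?Q * RY)"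
    using m by (simp add: scaleR_right_diff_distrib)
  have "0 \<le> w * (B - ?Q * B)"
    using damp_power_mult[OF unitary_z sums_nonneg(2) comm_z_sums(2)]
    by (intro w_nonneg comm_diff comm_mult comm_z comm_z_sums) auto
  moreover have "0 \<le> w * (\<Sum>j\<in>J. 4 *\<^sub>R 1 - Y j)"
    by (intro w_nonneg sum_nonneg comm_sum comm_diff comm_scaleR comm_one comm_z) (auto intro: lap_le unitary_y)
  ultimately have "0 \<le> w * (B - ?Q * B) + w * (\<Sum>j\<in>J. 4 *\<^sub>R 1 - Y j)"
    by (rule add_nonneg_nonneg)
  also have "(\<Sum>j\<in>J. 4 *\<^sub>R 1 - Y j) = (4 * N) *\<^sub>R 1 - B"
    by (simp add: sum_subtractf B_def N_def sum_constant_scaleR mult.commute del: sum_constant)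
  finally have 4: "0 \<le> (4 * N) *\<^sub>R w - w * (?Q * B)"
    by (simp add: algebra_simps)
  have "0 \<le> ((t * N) *\<^sub>R w - (4 * L) *\<^sub>R (w * ?c) + (4 * L\<^sup>2 / (t * N)) *\<^sub>R (w * (?Q * (B * B))))
     + (4 * L\<^sup>2 / (t * N)) *\<^sub>R (w * (?Q * (RY + 4 *\<^sub>R B - B * B)))
     + (4 * L\<^sup>2 / (t * N)) *\<^sub>R ((16 / m) *\<^sub>R RY - w * (?Q * RY))
     + (4 * (4 * L\<^sup>2 / (t * N))) *\<^sub>R ((4 * N) *\<^sub>R w - w * (?Q * B))"
    using t N by (intro add_nonneg_nonneg scaleR_nonneg_nonneg 1 2 3 4) auto
  also have "\<dots> = (t * N + 64 * L\<^sup>2 / t) *\<^sub>R w + (64 * L\<^sup>2 / (t * N * m)) *\<^sub>R RY - (4 * L) *\<^sub>R (w * ?c)"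
  proof -
    define d where "d = 4 * L\<^sup>2 / (t * N)"
    have d: "64 * L\<^sup>2 / t = 16 * N * d" "64 * L\<^sup>2 / (t * N * m) = d * (16 / m)"
      using N by (simp_all add: d_def)
    define Q M where "Q = ?Q" and "M = 16 / real m"
    show ?thesis
      unfolding d d_def[symmetric] unfolding Q_def[symmetric] M_def[symmetric]
      by (rule linear_functional_eqI) (simp (no_asm_simp) add: algebra_simps)
  qed
  finally show ?thesis unfolding N_def .
qed

lemma lower_bound_explicit:
  fixes t :: real
  assumes t: "0 < t" "t \<le> 1" and m: "0 < m" "m < card J" and J: "4 \<le> card J"
  defines "L \<equiv> 1 + 1/t"
  shows "(t * card J - 10 * sqrt (card J) - 64 * L\<^sup>2 / t) *\<^sub>R w
    \<le> Chain + (8 / sqrt (card J) + (8 * L * m + 144 * t) / (card J - 1)) *\<^sub>R Op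
      + (72 * t / (card J - 1) + 64 * L\<^sup>2 / (t * card J * m)) *\<^sub>R (RX + RY)"
proof -
  define r where "r = sqrt (card J)"
  define N where "N = real (card J)"
  define N1 where "N1 = real (card J - 1)"
  have N1: "N1 > 0" using J by (simp add: N1_def)
  have L: "L > 0" using t by (simp add: L_def add_pos_pos)
  define d where "d = 64 * L\<^sup>2 / (t * N * m)"
  define d' where "d' = 64 * L\<^sup>2 / t"
  have d: "0 \<le> d" using t by (simp add: d_def N_def)
  have 1: "0 \<le> Chain + (8/r) *\<^sub>R Op + (10 * r) *\<^sub>R w + 4 *\<^sub>R E L t m
     + (5 * t) *\<^sub>R (w * (A + B)) - (2 * t * N) *\<^sub>R w"
    unfolding L_def N_def by (rule lower_bound_combined[OF t m(2) J r_def])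
  have 2: "0 \<le> (t * N + d') *\<^sub>R w + d *\<^sub>R RY - (4 * L) *\<^sub>R (w * (q ^ m * B))"
    unfolding d_def d'_def N_def using J by (intro damped_B_le L t m) auto
  have 3: "0 \<le> 8 *\<^sub>R (RX + RY + 2 *\<^sub>R Op) - N1 *\<^sub>R (w * (A + B))"
    unfolding N1_def by (rule w_AB_le)
  \<comment> \<open>The multiplier \<open>9 * t / N1\<close> removes all of
    \<open>w * (A + B)\<close>: \<open>5 * t\<close> is explicit in the first summand and
    \<open>4 * t\<close> is inside \<open>4 *\<^sub>R E L t m\<close>. Adding
    \<open>d *\<^sub>R RX\<close> makes the bound symmetric in \<open>RX\<close> and
    \<open>RY\<close>.\<close>
  have "0 \<le> (Chain + (8/r) *\<^sub>R Op + (10 * r) *\<^sub>R w + 4 *\<^sub>R E L t m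
       + (5 * t) *\<^sub>R (w * (A + B)) - (2 * t * N) *\<^sub>R w)
     + ((t * N + d') *\<^sub>R w + d *\<^sub>R RY - (4 * L) *\<^sub>R (w * (q ^ m * B)))
     + (9 * t / N1) *\<^sub>R (8 *\<^sub>R (RX + RY + 2 *\<^sub>R Op) - N1 *\<^sub>R (w * (A + B)))
     + d *\<^sub>R RX"
    using t N1 d by (intro add_nonneg_nonneg[OF add_nonneg_nonneg[OF add_nonneg_nonneg[OF 1 2]]]
       scaleR_nonneg_nonneg 3 sums_nonneg) auto
  also have "\<dots> = Chain + (8 / r + (8 * L * m + 144 * t) / N1) *\<^sub>R Op
      + (72 * t / N1 + d) *\<^sub>R (RX + RY) - (t * N - 10 * r - d') *\<^sub>R w"
  proof -
    define i where "i = 1 / N1"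
    have i: "x / N1 = x * i" "i * N1 = 1" for x
      using N1 by (simp_all add: i_def)
    define c where "c = 8 / r"
    define wB where "wB = w * (q ^ m * B)"
    have i': "N1 * (i * x) = x" for x
      using i(2) by (simp flip: mult.assoc add: mult.commute)
    show ?thesis
      unfolding E_def N1_def[symmetric] i(1) c_def[symmetric] wB_def[symmetric]
      by (rule linear_functional_eqI) (simp (no_asm_simp) add: algebra_simps i i')
  qed
  finally show ?thesis
    unfolding N1_def d_def d'_def N_def r_def by simp
qed

end

lemma heisenberg_lower_bound:
  fixes \<kappa> :: real
  assumes "0 < \<kappa>"
  obtains N0 :: nat and c :: real where "0 < c" "0 < N0"
    "\<And>(J :: 'i set) (x :: 'i \<Rightarrow> 'a::star_algebra) y z. heisenberg J x y z \<Longrightarrow> N0 \<le> card J \<Longrightarrow>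
      (c * card J) *\<^sub>R lap z \<le> (\<Sum>j\<in>J. lap (x j) * lap (y j) + lap (y j) * lap (x j))
        + \<kappa> *\<^sub>R (\<Sum>j\<in>J. \<Sum>k\<in>J-{j}. lap (x j) * lap (y k))
        + (\<kappa> / card J) *\<^sub>R ((\<Sum>j\<in>J. \<Sum>k\<in>J-{j}. lap (x j) * lap (x k))
          + (\<Sum>j\<in>J. \<Sum>k\<in>J-{j}. lap (y j) * lap (y k)))"
proof -
  \<comment> \<open>The coefficients of \<open>RX\<close> and \<open>RY\<close> must stay below
    \<open>\<kappa> / N\<close>, one half for each of their two summands. \<open>t\<close> settles
    the first half and \<open>m\<close> the second. The coefficient of \<open>Op\<close> tends to 0
    for fixed \<open>t\<close> and \<open>m\<close>, so it is left to \<open>N0\<close>.\<close>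
  define t where "t = min 1 (\<kappa> / 288)"
  have t: "0 < t" "t \<le> 1" "144 * t \<le> \<kappa> / 2" using assms by (auto simp: t_def)
  define L where "L = 1 + 1/t"
  have L: "0 < L" using t by (simp add: L_def add_pos_pos)
  define m where "m = nat \<lceil>128 * L\<^sup>2 / (t * \<kappa>)\<rceil> + 1"
  have mL: "128 * L\<^sup>2 / (t * \<kappa>) \<le> m" and m: "0 < m"
    unfolding m_def by linarith+
  then have mt: "64 * L\<^sup>2 / (t * m) \<le> \<kappa> / 2"
    using t assms by (simp add: field_simps)
  define C where "C = 8 * L * m + 144 * t"
  define D where "D = 64 * L\<^sup>2 / t"
  have CD: "0 \<le> C" "0 \<le> D" using t L by (simp_all add: C_def D_def)
  define s where "s = 16 / \<kappa> + 40 / t"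
  have s: "16 / \<kappa> \<le> s" "40 / t \<le> s" "0 < s"
    using t assms by (simp_all add: s_def add_pos_pos)
  obtain n1 n2 n3 :: nat where n: "s\<^sup>2 \<le> n1" "2 * C / \<kappa> \<le> n2" "4 * D / t \<le> n3"
    using real_arch_simple by metis
  define N0 where "N0 = n1 + n2 + n3 + m + 4"
  show thesis
  \<comment> \<open>\<open>t / 2\<close> remains because \<open>10 * sqrt N\<close> and
    \<open>D\<close> each use up at most a quarter of \<open>t * N\<close>.\<close>
  proof (rule that[of "t / 2" N0])
    fix J :: "'i set" and x :: "'i \<Rightarrow> 'a" and y z
    assume h: "heisenberg J x y z" and J: "N0 \<le> card J"
    interpret heisenberg J x y z by fact
    define N where "N = real (card J)"
    have J4: "m < card J" "4 \<le> card J" using J by (simp_all add: N0_def)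
    have "real (n1 + n2 + n3 + m + 4) \<le> N"
      using J unfolding N0_def N_def by (simp only: of_nat_le_iff)
    with n have N: "s\<^sup>2 \<le> N" "2 * C / \<kappa> \<le> N - 1" "4 * D / t \<le> N" "4 \<le> N"
      by simp_all
    have N1: "real (card J - 1) = N - 1" using J4 by (simp add: N_def)
    have "s \<le> sqrt N" using N(1) s(3) by (simp add: real_le_rsqrt)
    with s have sN: "16 / \<kappa> \<le> sqrt N" "40 / t \<le> sqrt N" "0 < sqrt N" by linarith+
    have "8 / sqrt N \<le> \<kappa> / 2" using sN(1,3) assms by (simp add: field_simps)
    moreover have "C / (N - 1) \<le> \<kappa> / 2" using N(2,4) assms by (simp add: field_simps)
    ultimately have O: "8 / sqrt N + C / (N - 1) \<le> \<kappa>" by linarith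
    have "72 * t / (N - 1) \<le> 144 * t / N" using N(4) t by (simp add: field_simps)
    also have "\<dots> \<le> (\<kappa> / 2) / N" using t N(4) by (intro divide_right_mono) auto
    finally have "72 * t / (N - 1) \<le> (\<kappa> / 2) / N" .
    moreover have "(64 * L\<^sup>2 / (t * m)) / N \<le> (\<kappa> / 2) / N" using mt N(4) by (intro divide_right_mono) auto
    ultimately have R: "72 * t / (N - 1) + 64 * L\<^sup>2 / (t * N * m) \<le> \<kappa> / N"
      by (simp add: field_simps)
    have "40 \<le> t * sqrt N" using sN(2) t by (simp add: field_simps)
    then have "40 * sqrt N \<le> t * sqrt N * sqrt N" using sN(3) by (intro mult_right_mono) auto
    moreover have "t * sqrt N * sqrt N = t * N" using N(4) by (simp add: mult.assoc)
    ultimately have "10 * sqrt N \<le> t * N / 4" by simp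
    moreover have "D \<le> t * N / 4" using N(3) t by (simp add: field_simps)
    ultimately have W: "t / 2 * N \<le> t * N - 10 * sqrt N - D" by (simp add: field_simps)
    have "(t / 2 * N) *\<^sub>R w \<le> (t * N - 10 * sqrt N - D) *\<^sub>R w"
      by (rule scaleR_right_mono[OF W lap_nonneg])
    also have "\<dots> \<le> Chain + (8 / sqrt N + C / (N - 1)) *\<^sub>R Op
        + (72 * t / (N - 1) + 64 * L\<^sup>2 / (t * N * m)) *\<^sub>R (RX + RY)"
      using lower_bound_explicit[OF t(1,2) m J4] N1 by (simp add: N_def C_def D_def L_def)
    also have "\<dots> \<le> Chain + \<kappa> *\<^sub>R Op + (\<kappa> / N) *\<^sub>R (RX + RY)"
      by (intro add_mono order_refl scaleR_right_mono O R sums_nonneg add_nonneg_nonneg)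
    finally show "(t / 2 * card J) *\<^sub>R lap z \<le> (\<Sum>j\<in>J. lap (x j) * lap (y j) + lap (y j) * lap (x j))
        + \<kappa> *\<^sub>R (\<Sum>j\<in>J. \<Sum>k\<in>J-{j}. lap (x j) * lap (y k))
        + (\<kappa> / card J) *\<^sub>R ((\<Sum>j\<in>J. \<Sum>k\<in>J-{j}. lap (x j) * lap (x k))
          + (\<Sum>j\<in>J. \<Sum>k\<in>J-{j}. lap (y j) * lap (y k)))"
      by (simp add: N_def Chain_def Op_def RX_def RY_def)
  qed (use t in \<open>auto simp: N0_def\<close>)
qed

section \<open>Sums over tuples of distinct indices\<close>

lemma sum_distinct3:
  assumes "finite I"
  shows "(\<Sum>i\<in>I. \<Sum>j\<in>I-{i}. \<Sum>k\<in>I-{i,j}. f i j k)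
    = (\<Sum>(i,j,k)\<in>{(i,j,k). i \<in> I \<and> j \<in> I \<and> k \<in> I \<and> i \<noteq> j \<and> i \<noteq> k \<and> j \<noteq> k}. f i j k)"
proof -
  have "{(i,j,k). i \<in> I \<and> j \<in> I \<and> k \<in> I \<and> i \<noteq> j \<and> i \<noteq> k \<and> j \<noteq> k}
      = (SIGMA i:I. SIGMA j:I-{i}. I-{i,j})" by auto
  then show ?thesis using assms by (simp add: sum.Sigma)
qed

lemma sum_distinct3_swap12:
  assumes "finite I"
  shows "(\<Sum>i\<in>I. \<Sum>j\<in>I-{i}. \<Sum>k\<in>I-{i,j}. f i j k) = (\<Sum>i\<in>I. \<Sum>j\<in>I-{i}. \<Sum>k\<in>I-{i,j}. f j i k)"
  unfolding sum_distinct3[OF assms]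
  by (rule sum.reindex_bij_witness[of _ "\<lambda>(i,j,k). (j,i,k)" "\<lambda>(i,j,k). (j,i,k)"]) auto

lemma sum_distinct3_swap23:
  assumes "finite I"
  shows "(\<Sum>i\<in>I. \<Sum>j\<in>I-{i}. \<Sum>k\<in>I-{i,j}. f i j k) = (\<Sum>i\<in>I. \<Sum>j\<in>I-{i}. \<Sum>k\<in>I-{i,j}. f i k j)"
  unfolding sum_distinct3[OF assms]
  by (rule sum.reindex_bij_witness[of _ "\<lambda>(i,j,k). (i,k,j)" "\<lambda>(i,j,k). (i,k,j)"]) auto

lemma
  assumes "finite I"
  shows sum_distinct4_rotate: "(\<Sum>i\<in>I. \<Sum>j\<in>I-{i}. \<Sum>k\<in>I-{i,j}. \<Sum>l\<in>I-{i,j}-{k}. f i j k l)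
      = (\<Sum>i\<in>I. \<Sum>j\<in>I-{i}. \<Sum>k\<in>I-{i,j}. \<Sum>l\<in>I-{i,j}-{k}. f i l j k)"
    and sum_distinct4_cycle: "(\<Sum>i\<in>I. \<Sum>j\<in>I-{i}. \<Sum>k\<in>I-{i,j}. \<Sum>l\<in>I-{i,j}-{k}. f i j k l)
      = (\<Sum>i\<in>I. \<Sum>j\<in>I-{i}. \<Sum>k\<in>I-{i,j}. \<Sum>l\<in>I-{i,j}-{k}. f l j i k)"
proof -
  let ?S = "\<lambda>g. \<Sum>i\<in>I. \<Sum>j\<in>I-{i}. \<Sum>k\<in>I-{i,j}. \<Sum>l\<in>I-{i,j}-{k}. g i j k l :: 'b"
  let ?D = "{(i,j,k,l). i \<in> I \<and> j \<in> I \<and> k \<in> I \<and> l \<in> I \<and> i \<noteq> j \<and> i \<noteq> k \<and> j \<noteq> k \<and> l \<noteq> i \<and> l \<noteq> j \<and> l \<noteq> k}"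
  have eq: "(\<Sum>i\<in>I. \<Sum>j\<in>I-{i}. \<Sum>k\<in>I-{i,j}. \<Sum>l\<in>I-{i,j}-{k}. g i j k l) = (\<Sum>(i,j,k,l)\<in>?D. g i j k l)"
    for g :: "'a \<Rightarrow> 'a \<Rightarrow> 'a \<Rightarrow> 'a \<Rightarrow> 'b"
  proof -
    have "?D = (SIGMA i:I. SIGMA j:I-{i}. SIGMA k:I-{i,j}. I-{i,j}-{k})" by auto
    then show ?thesis using assms by (simp add: sum.Sigma)
  qed
  show "?S f = ?S (\<lambda>i j k l. f i l j k)"
    unfolding eq
    by (rule sum.reindex_bij_witness[of _ "\<lambda>(i,j,k,l). (i,l,j,k)" "\<lambda>(i,j,k,l). (i,k,l,j)"]) auto
  show "?S f = ?S (\<lambda>i j k l. f l j i k)"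
    unfolding eq
    by (rule sum.reindex_bij_witness[of _ "\<lambda>(i,j,k,l). (l,j,i,k)" "\<lambda>(i,j,k,l). (k,j,l,i)"]) auto
qed

lemma sum_distinct4_last:
  assumes "finite I" and n: "card I = n"
  shows "(\<Sum>i\<in>I. \<Sum>j\<in>I-{i}. \<Sum>k\<in>I-{i,j}. \<Sum>l\<in>I-{i,j}-{k}. f i j k)
      = real (n - 3) *\<^sub>R (\<Sum>i\<in>I. \<Sum>j\<in>I-{i}. \<Sum>k\<in>I-{i,j}. f i j k :: 'b::real_vector)"
proof -
  have "(\<Sum>l\<in>I-{i,j}-{k}. f i j k) = real (n - 3) *\<^sub>R f i j k"
    if "i \<in> I" "j \<in> I - {i}" "k \<in> I - {i,j}" for i j k
  proof -
    have "card {i,j} = 2" using that by auto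
    then have "card (I - {i,j} - {k}) = n - 3"
      using that assms by (simp add: card_Diff_subset)
    then show ?thesis by (simp add: sum_constant_scaleR del: sum_constant)
  qed
  then show ?thesis by (simp add: scaleR_sum_right)
qed

text \<open>The pairs \<open>(k, l)\<close> are sorted by how they meet \<open>{i, j}\<close>: in
  both indices, in one index (four ways), or not at all.\<close>

lemma off_diagonal_sum_around:
  assumes I: "finite I" "i \<in> I" "j \<in> I" "i \<noteq> j"
  shows "(\<Sum>k\<in>I. \<Sum>l\<in>I-{k}. T k l :: 'b::ab_group_add) = T i j + T j i
    + (\<Sum>l\<in>I-{i,j}. T i l) + (\<Sum>l\<in>I-{i,j}. T j l) + (\<Sum>k\<in>I-{i,j}. T k i) + (\<Sum>k\<in>I-{i,j}. T k j)
    + (\<Sum>k\<in>I-{i,j}. \<Sum>l\<in>I-{i,j}-{k}. T k l)"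
proof -
  have two: "(\<Sum>k\<in>S. g k) = g i + g j + (\<Sum>k\<in>S-{i,j}. g k)"
    if "finite S" "i \<in> S" "j \<in> S" for g :: "'a \<Rightarrow> 'b" and S
  proof -
    have "(\<Sum>k\<in>S. g k) = g i + (\<Sum>k\<in>S-{i}. g k)" using that by (simp add: sum.remove)
    also have "(\<Sum>k\<in>S-{i}. g k) = g j + (\<Sum>k\<in>S-{i}-{j}. g k)" using that I by (intro sum.remove) auto
    also have "S - {i} - {j} = S - {i,j}" by auto
    finally show ?thesis by (simp add: add.assoc)
  qed
  have i: "(\<Sum>l\<in>I-{i}. T i l) = T i j + (\<Sum>l\<in>I-{i,j}. T i l)"
    using I sum.remove[of "I-{i}" j "T i"] by (simp add: Diff_insert2[symmetric] insert_commute)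
  have j: "(\<Sum>l\<in>I-{j}. T j l) = T j i + (\<Sum>l\<in>I-{i,j}. T j l)"
    using I sum.remove[of "I-{j}" i "T j"] by (simp add: Diff_insert2[symmetric] insert_commute)
  have k: "(\<Sum>l\<in>I-{k}. T k l) = T k i + T k j + (\<Sum>l\<in>I-{i,j}-{k}. T k l)" if "k \<in> I - {i,j}" for k
  proof -
    have "I - {k} - {i,j} = I - {i,j} - {k}" by auto
    moreover have "finite (I - {k})" "i \<in> I - {k}" "j \<in> I - {k}" using that I by auto
    ultimately show ?thesis using two[of "I - {k}" "T k"] by simp
  qed
  have "(\<Sum>k\<in>I-{i,j}. \<Sum>l\<in>I-{k}. T k l) = (\<Sum>k\<in>I-{i,j}. T k i + T k j + (\<Sum>l\<in>I-{i,j}-{k}. T k l))"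
    by (intro sum.cong refl k)
  then show ?thesis
    unfolding two[OF I(1-3)] i j by (simp add: sum.distrib algebra_simps)
qed

section \<open>Systems of elementary unitaries\<close>

locale elementary_unitaries =
  fixes n d :: nat
    and e :: "nat \<Rightarrow> nat \<Rightarrow> nat \<Rightarrow> 'a::star_algebra"
    and f :: "nat \<Rightarrow> nat \<Rightarrow> nat \<Rightarrow> nat \<Rightarrow> 'a"
  assumes unitary_e: "\<And>i j r. i < n \<Longrightarrow> j < n \<Longrightarrow> i \<noteq> j \<Longrightarrow> r < d \<Longrightarrow> unitary (e i j r)"
    and unitary_f: "\<And>i j r s. i < n \<Longrightarrow> j < n \<Longrightarrow> i \<noteq> j \<Longrightarrow> r < d \<Longrightarrow> s < d \<Longrightarrow> unitary (f i j r s)"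
    and comm_e: "\<And>i j k l r s. i < n \<Longrightarrow> j < n \<Longrightarrow> k < n \<Longrightarrow> l < n \<Longrightarrow> i \<noteq> j \<Longrightarrow> k \<noteq> l \<Longrightarrow>
      j \<noteq> k \<Longrightarrow> i \<noteq> l \<Longrightarrow> r < d \<Longrightarrow> s < d \<Longrightarrow> comm (e i j r) (e k l s)"
    and comm_f: "\<And>i j k l r s s'. i < n \<Longrightarrow> j < n \<Longrightarrow> k < n \<Longrightarrow> l < n \<Longrightarrow> i \<noteq> j \<Longrightarrow> k \<noteq> l \<Longrightarrow>
      j \<noteq> k \<Longrightarrow> i \<noteq> l \<Longrightarrow> r < d \<Longrightarrow> s < d \<Longrightarrow> s' < d \<Longrightarrow> comm (f i j s s') (e k l r)"
    and commutator: "\<And>i j k r s. i < n \<Longrightarrow> j < n \<Longrightarrow> k < n \<Longrightarrow> i \<noteq> j \<Longrightarrow> j \<noteq> k \<Longrightarrow> i \<noteq> k \<Longrightarrow>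
      r < d \<Longrightarrow> s < d \<Longrightarrow> e i j r * e j k s = f i k r s * (e j k s * e i j r)"
begin

abbreviation "I \<equiv> {..<n}"
abbreviation "D i j r \<equiv> lap (e i j r)"

definition "T i j = (\<Sum>r<d. D i j r)"

lemma heis:
  assumes "i < n" "k < n" "i \<noteq> k" "r < d" "s < d"
  shows "heisenberg (I - {i,k}) (\<lambda>j. e i j r) (\<lambda>j. e j k s) (f i k r s)"
  using assms by unfold_locales (auto intro!: unitary_e unitary_f comm_e comm_f commutator)

lemma DD_nonneg:
  assumes "i < n" "j < n" "k < n" "l < n" "i \<noteq> j" "k \<noteq> l" "j \<noteq> k" "i \<noteq> l" "r < d" "s < d"
  shows "0 \<le> D i j r * D k l s"
  using assms by (intro lap_mult_nonneg lap_nonneg comm_lap unitary_e comm_e)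

lemma TT_nonneg:
  assumes "i < n" "j < n" "k < n" "l < n" "i \<noteq> j" "k \<noteq> l" "j \<noteq> k" "i \<noteq> l"
  shows "0 \<le> T i j * T k l"
  using assms unfolding T_def sum_product by (intro sum_nonneg DD_nonneg) auto

text \<open>Summing the Heisenberg bounds over \<open>r\<close> and \<open>s\<close> produces row
  and column products only for equal variables. Products for different variables are nonnegative as
  well and complete the sum to \<open>T i j * T k l\<close>.\<close>

lemma diagonal_le_TT:
  assumes "i < n" "j < n" "k < n" "l < n" "i \<noteq> j" "k \<noteq> l" "j \<noteq> k" "i \<noteq> l"
  shows "(\<Sum>r<d. D i j r * D k l r) \<le> T i j * T k l"
proof -
  have "(\<Sum>r<d. D i j r * D k l r) \<le> (\<Sum>r<d. \<Sum>s<d. D i j r * D k l s)"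
  proof (intro sum_mono)
    fix r assume r: "r \<in> {..<d}"
    have "(\<Sum>s\<in>{r}. D i j r * D k l s) \<le> (\<Sum>s<d. D i j r * D k l s)"
      using assms r by (intro sum_mono2 DD_nonneg) auto
    then show "D i j r * D k l r \<le> (\<Sum>s<d. D i j r * D k l s)" by simp
  qed
  then show ?thesis by (simp add: T_def sum_product)
qed

lemma star_T: "star (T i j) = T i j"
  by (simp add: T_def star_sum star_lap)

abbreviation "Row \<equiv> (\<Sum>i\<in>I. \<Sum>j\<in>I-{i}. \<Sum>k\<in>I-{i,j}. T i j * T i k)"
abbreviation "Col \<equiv> (\<Sum>i\<in>I. \<Sum>j\<in>I-{i}. \<Sum>k\<in>I-{i,j}. T i j * T k j)"
abbreviation "Path \<equiv> (\<Sum>i\<in>I. \<Sum>j\<in>I-{i}. \<Sum>k\<in>I-{i,j}. T i j * T j k)"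
abbreviation "PathRev \<equiv> (\<Sum>i\<in>I. \<Sum>j\<in>I-{i}. \<Sum>k\<in>I-{i,j}. T i j * T k i)"
abbreviation "Disjoint \<equiv> (\<Sum>i\<in>I. \<Sum>j\<in>I-{i}. \<Sum>k\<in>I-{i,j}. \<Sum>l\<in>I-{i,j}-{k}. T i j * T k l)"

text \<open>The pairs that meet in both indices are discarded. \<open>T i j * T j i\<close> is not
  covered by \<open>TT_nonneg\<close>, but together with \<open>T i j * T i j\<close> these terms
  sum to half of the squares of \<open>T i j + T j i\<close>.\<close>

lemma square_ge:
  "Row + Col + Path + PathRev + Disjoint \<le> (\<Sum>i\<in>I. \<Sum>j\<in>I-{i}. T i j) * (\<Sum>i\<in>I. \<Sum>j\<in>I-{i}. T i j)"
proof -
  let ?\<Delta> = "\<Sum>i\<in>I. \<Sum>j\<in>I-{i}. T i j"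
  let ?S = "\<Sum>i\<in>I. \<Sum>j\<in>I-{i}. T i j * T i j + T i j * T j i"
  have "?\<Delta> * ?\<Delta> = (\<Sum>i\<in>I. \<Sum>j\<in>I-{i}. T i j * ?\<Delta>)"
    by (simp add: sum_distrib_right)
  also have "\<dots> = (\<Sum>i\<in>I. \<Sum>j\<in>I-{i}. T i j * (T i j + T j i
    + (\<Sum>l\<in>I-{i,j}. T i l) + (\<Sum>l\<in>I-{i,j}. T j l) + (\<Sum>k\<in>I-{i,j}. T k i) + (\<Sum>k\<in>I-{i,j}. T k j)
    + (\<Sum>k\<in>I-{i,j}. \<Sum>l\<in>I-{i,j}-{k}. T k l)))"
    by (intro sum.cong refl arg_cong2[where f = "(*)"] off_diagonal_sum_around) auto
  also have "\<dots> = ?S + Row + Path + PathRev + Col + Disjoint"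
    by (simp add: distrib_left sum.distrib sum_distrib_left)
  finally have eq: "?\<Delta> * ?\<Delta> = ?S + Row + Path + PathRev + Col + Disjoint" .
  have swap: "(\<Sum>i\<in>I. \<Sum>j\<in>I-{i}. g i j) = (\<Sum>i\<in>I. \<Sum>j\<in>I-{i}. g j i)" for g :: "nat \<Rightarrow> nat \<Rightarrow> 'a"
  proof -
    have "{j \<in> I. j \<noteq> i} = I - {i}" "{j \<in> I. i \<noteq> j} = I - {i}" for i by auto
    then show ?thesis using sum.swap_restrict[of I I g "\<lambda>i j. j \<noteq> i"] by simp
  qed
  have "0 \<le> (1/2) *\<^sub>R (\<Sum>i\<in>I. \<Sum>j\<in>I-{i}. star (T i j + T j i) * (T i j + T j i))"
    by (intro scaleR_nonneg_nonneg sum_nonneg sq_nonneg) auto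
  also have "\<dots> = (1/2) *\<^sub>R (?S + (\<Sum>i\<in>I. \<Sum>j\<in>I-{i}. T j i * T j i + T j i * T i j))"
    by (simp add: star_add star_T distrib_left distrib_right sum.distrib add_ac)
  also have "(\<Sum>i\<in>I. \<Sum>j\<in>I-{i}. T j i * T j i + T j i * T i j) = ?S"
    by (rule swap)
  also have "(1/2) *\<^sub>R (?S + ?S) = ?S" by (simp only: scaleR_half_double)
  finally show ?thesis unfolding eq by (simp add: algebra_simps)
qed

lemma RowColDisjoint_nonneg: "0 \<le> Row" "0 \<le> Col" "0 \<le> Disjoint"
  by (intro sum_nonneg TT_nonneg; auto)+

lemma lower_bound_square:
  fixes c \<kappa> :: real
  assumes n: "2 < n" and \<kappa>: "0 \<le> \<kappa>" "\<kappa> \<le> 1" "\<kappa> * d \<le> 1"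
    and heis_bound: "\<And>J x y (z::'a). heisenberg J x y z \<Longrightarrow> card (J :: nat set) = n - 2 \<Longrightarrow>
      (c * card J) *\<^sub>R lap z \<le> (\<Sum>j\<in>J. lap (x j) * lap (y j) + lap (y j) * lap (x j))
        + \<kappa> *\<^sub>R (\<Sum>j\<in>J. \<Sum>k\<in>J-{j}. lap (x j) * lap (y k))
        + (\<kappa> / card J) *\<^sub>R ((\<Sum>j\<in>J. \<Sum>k\<in>J-{j}. lap (x j) * lap (x k))
          + (\<Sum>j\<in>J. \<Sum>k\<in>J-{j}. lap (y j) * lap (y k)))"
  shows "(c * real (n - 2)) *\<^sub>R (\<Sum>i\<in>I. \<Sum>k\<in>I-{i}. \<Sum>r<d. \<Sum>s<d. lap (f i k r s))
    \<le> (\<Sum>i\<in>I. \<Sum>j\<in>I-{i}. T i j) * (\<Sum>i\<in>I. \<Sum>j\<in>I-{i}. T i j)"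
proof -
  let ?N = "real (n - 2)"
  have N: "?N > 0" using n by simp
  have local: "(c * ?N) *\<^sub>R (\<Sum>r<d. \<Sum>s<d. lap (f i k r s))
      \<le> (\<Sum>j\<in>I-{i,k}. T i j * T j k + T j k * T i j)
        + \<kappa> *\<^sub>R (\<Sum>j\<in>I-{i,k}. \<Sum>l\<in>I-{i,k}-{j}. T i j * T l k)
        + (1 / ?N) *\<^sub>R ((\<Sum>j\<in>I-{i,k}. \<Sum>l\<in>I-{i,k}-{j}. T i j * T i l)
          + (\<Sum>j\<in>I-{i,k}. \<Sum>l\<in>I-{i,k}-{j}. T j k * T l k))"
    if ik: "i < n" "k < n" "i \<noteq> k" for i k
  proof -
    let ?J = "I - {i,k}"
    have cJ: "card ?J = n - 2"
    proof -
      have "card {i,k} = 2" using ik by simp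
      then show ?thesis using ik by (simp add: card_Diff_subset)
    qed
    let ?R = "\<lambda>r. \<Sum>j\<in>?J. \<Sum>l\<in>?J-{j}. D i j r * D i l r"
    let ?C = "\<lambda>s. \<Sum>j\<in>?J. \<Sum>l\<in>?J-{j}. D j k s * D l k s"
    have "(c * ?N) *\<^sub>R (\<Sum>r<d. \<Sum>s<d. lap (f i k r s)) = (\<Sum>r<d. \<Sum>s<d. (c * card ?J) *\<^sub>R lap (f i k r s))"
      by (simp add: cJ scaleR_sum_right)
    also have "\<dots> \<le> (\<Sum>r<d. \<Sum>s<d. (\<Sum>j\<in>?J. D i j r * D j k s + D j k s * D i j r)
        + \<kappa> *\<^sub>R (\<Sum>j\<in>?J. \<Sum>l\<in>?J-{j}. D i j r * D l k s)
        + (\<kappa> / card ?J) *\<^sub>R (?R r + ?C s))"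
      by (intro sum_mono heis_bound heis) (use ik cJ in auto)
    \<comment> \<open>\<open>?R r\<close> does not depend on \<open>s\<close>, nor
      \<open>?C s\<close> on \<open>r\<close>, so each is counted \<open>d\<close> times. The bound
      \<open>\<kappa> * d \<le> 1\<close> absorbs this factor.\<close>
    also have "\<dots> = (\<Sum>r<d. \<Sum>s<d. \<Sum>j\<in>?J. D i j r * D j k s + D j k s * D i j r)
        + \<kappa> *\<^sub>R (\<Sum>r<d. \<Sum>s<d. \<Sum>j\<in>?J. \<Sum>l\<in>?J-{j}. D i j r * D l k s)
        + (\<kappa> / ?N) *\<^sub>R (d *\<^sub>R (\<Sum>r<d. ?R r) + d *\<^sub>R (\<Sum>s<d. ?C s))"
      by (simp add: sum.distrib cJ sum_constant_scaleR del: sum_constant flip: scaleR_sum_right)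
    also have "(\<Sum>r<d. \<Sum>s<d. \<Sum>j\<in>?J. D i j r * D j k s + D j k s * D i j r)
      = (\<Sum>j\<in>?J. T i j * T j k + T j k * T i j)"
    proof -
      have "(\<Sum>r<d. \<Sum>s<d. \<Sum>j\<in>?J. D i j r * D j k s + D j k s * D i j r)
        = (\<Sum>r<d. \<Sum>j\<in>?J. \<Sum>s<d. D i j r * D j k s + D j k s * D i j r)"
        by (intro sum.cong refl sum.swap)
      also have "\<dots> = (\<Sum>j\<in>?J. \<Sum>r<d. \<Sum>s<d. D i j r * D j k s + D j k s * D i j r)"
        by (rule sum.swap)
      also have "\<dots> = (\<Sum>j\<in>?J. T i j * T j k + T j k * T i j)"
      proof (intro sum.cong refl)
        fix j
        have "(\<Sum>r<d. \<Sum>s<d. D j k s * D i j r) = (\<Sum>s<d. \<Sum>r<d. D j k s * D i j r)"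
          by (rule sum.swap)
        then show "(\<Sum>r<d. \<Sum>s<d. D i j r * D j k s + D j k s * D i j r) = T i j * T j k + T j k * T i j"
          by (simp add: T_def sum_product sum.distrib)
      qed
      finally show ?thesis .
    qed
    also have "(\<Sum>r<d. \<Sum>s<d. \<Sum>j\<in>?J. \<Sum>l\<in>?J-{j}. D i j r * D l k s)
      = (\<Sum>j\<in>?J. \<Sum>l\<in>?J-{j}. T i j * T l k)"
    proof -
      have "(\<Sum>r<d. \<Sum>s<d. \<Sum>j\<in>?J. \<Sum>l\<in>?J-{j}. D i j r * D l k s)
        = (\<Sum>r<d. \<Sum>j\<in>?J. \<Sum>s<d. \<Sum>l\<in>?J-{j}. D i j r * D l k s)"
        by (rule sum.cong[OF refl]) (rule sum.swap)
      also have "\<dots> = (\<Sum>j\<in>?J. \<Sum>r<d. \<Sum>s<d. \<Sum>l\<in>?J-{j}. D i j r * D l k s)"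
        by (rule sum.swap)
      also have "\<dots> = (\<Sum>j\<in>?J. \<Sum>r<d. \<Sum>l\<in>?J-{j}. \<Sum>s<d. D i j r * D l k s)"
        by (rule sum.cong[OF refl], rule sum.cong[OF refl]) (rule sum.swap)
      also have "\<dots> = (\<Sum>j\<in>?J. \<Sum>l\<in>?J-{j}. \<Sum>r<d. \<Sum>s<d. D i j r * D l k s)"
        by (rule sum.cong[OF refl]) (rule sum.swap)
      finally show ?thesis by (simp add: T_def sum_product)
    qed
    also have "(\<kappa> / ?N) *\<^sub>R (d *\<^sub>R (\<Sum>r<d. ?R r) + d *\<^sub>R (\<Sum>s<d. ?C s))
      \<le> (1 / ?N) *\<^sub>R ((\<Sum>j\<in>?J. \<Sum>l\<in>?J-{j}. T i j * T i l) + (\<Sum>j\<in>?J. \<Sum>l\<in>?J-{j}. T j k * T l k))"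
    proof -
      have swap3: "(\<Sum>r<d. \<Sum>j\<in>?J. \<Sum>l\<in>?J-{j}. g r j l) = (\<Sum>j\<in>?J. \<Sum>l\<in>?J-{j}. \<Sum>r<d. g r j l)"
        for g :: "nat \<Rightarrow> nat \<Rightarrow> nat \<Rightarrow> 'a"
        by (subst sum.swap, rule sum.cong[OF refl], rule sum.swap)
      have R: "(\<Sum>r<d. ?R r) \<le> (\<Sum>j\<in>?J. \<Sum>l\<in>?J-{j}. T i j * T i l)"
        unfolding swap3 using ik by (intro sum_mono diagonal_le_TT) auto
      have C: "(\<Sum>s<d. ?C s) \<le> (\<Sum>j\<in>?J. \<Sum>l\<in>?J-{j}. T j k * T l k)"
        unfolding swap3 using ik by (intro sum_mono diagonal_le_TT) auto
      have R0: "0 \<le> (\<Sum>r<d. ?R r) + (\<Sum>s<d. ?C s)"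
        using ik by (intro add_nonneg_nonneg sum_nonneg DD_nonneg) auto
      have "(\<kappa> / ?N) *\<^sub>R (d *\<^sub>R (\<Sum>r<d. ?R r) + d *\<^sub>R (\<Sum>s<d. ?C s))
          = (\<kappa> * d / ?N) *\<^sub>R ((\<Sum>r<d. ?R r) + (\<Sum>s<d. ?C s))"
        by (simp add: scaleR_right_distrib)
      also have "\<dots> \<le> (1 / ?N) *\<^sub>R ((\<Sum>r<d. ?R r) + (\<Sum>s<d. ?C s))"
        by (rule scaleR_right_mono[OF divide_right_mono[OF \<kappa>(3)] R0]) (use N in simp)
      also have "\<dots> \<le> (1 / ?N) *\<^sub>R ((\<Sum>j\<in>?J. \<Sum>l\<in>?J-{j}. T i j * T i l) + (\<Sum>j\<in>?J. \<Sum>l\<in>?J-{j}. T j k * T l k))"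
        by (rule scaleR_left_mono[OF add_mono[OF R C]]) (use N in simp)
      finally show ?thesis .
    qed
    finally show ?thesis by simp
  qed
  have "(c * ?N) *\<^sub>R (\<Sum>i\<in>I. \<Sum>k\<in>I-{i}. \<Sum>r<d. \<Sum>s<d. lap (f i k r s))
    = (\<Sum>i\<in>I. \<Sum>k\<in>I-{i}. (c * ?N) *\<^sub>R (\<Sum>r<d. \<Sum>s<d. lap (f i k r s)))"
    by (simp add: scaleR_sum_right)
  also have "\<dots> \<le> (\<Sum>i\<in>I. \<Sum>k\<in>I-{i}. (\<Sum>j\<in>I-{i,k}. T i j * T j k + T j k * T i j)
        + \<kappa> *\<^sub>R (\<Sum>j\<in>I-{i,k}. \<Sum>l\<in>I-{i,k}-{j}. T i j * T l k)
        + (1 / ?N) *\<^sub>R ((\<Sum>j\<in>I-{i,k}. \<Sum>l\<in>I-{i,k}-{j}. T i j * T i l)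
          + (\<Sum>j\<in>I-{i,k}. \<Sum>l\<in>I-{i,k}-{j}. T j k * T l k)))"
    by (intro sum_mono local) auto
  also have "\<dots> = (\<Sum>i\<in>I. \<Sum>k\<in>I-{i}. \<Sum>j\<in>I-{i,k}. T i j * T j k)
      + (\<Sum>i\<in>I. \<Sum>k\<in>I-{i}. \<Sum>j\<in>I-{i,k}. T j k * T i j)
      + \<kappa> *\<^sub>R (\<Sum>i\<in>I. \<Sum>k\<in>I-{i}. \<Sum>j\<in>I-{i,k}. \<Sum>l\<in>I-{i,k}-{j}. T i j * T l k)
      + (1 / ?N) *\<^sub>R ((\<Sum>i\<in>I. \<Sum>k\<in>I-{i}. \<Sum>j\<in>I-{i,k}. \<Sum>l\<in>I-{i,k}-{j}. T i j * T i l)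
          + (\<Sum>i\<in>I. \<Sum>k\<in>I-{i}. \<Sum>j\<in>I-{i,k}. \<Sum>l\<in>I-{i,k}-{j}. T j k * T l k))"
    using n by (simp add: sum.distrib of_nat_diff flip: scaleR_sum_right)
  also have "(\<Sum>i\<in>I. \<Sum>k\<in>I-{i}. \<Sum>j\<in>I-{i,k}. T i j * T j k) = Path"
    by (rule sum_distinct3_swap23) simp
  also have "(\<Sum>i\<in>I. \<Sum>k\<in>I-{i}. \<Sum>j\<in>I-{i,k}. T j k * T i j) = PathRev"
    by (subst sum_distinct3_swap23, simp, subst sum_distinct3_swap12, simp, subst sum_distinct3_swap23, simp) simp
  also have "(\<Sum>i\<in>I. \<Sum>k\<in>I-{i}. \<Sum>j\<in>I-{i,k}. \<Sum>l\<in>I-{i,k}-{j}. T i j * T l k) = Disjoint"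
    by (rule sum_distinct4_rotate) simp
  \<comment> \<open>A product \<open>T i j * T i l\<close> arises once for each \<open>k\<close>
    outside \<open>{i, j, l}\<close>, that is \<open>n - 3\<close> times, against the prefactor
    \<open>1 / (n - 2)\<close>.\<close>
  also have "(\<Sum>i\<in>I. \<Sum>k\<in>I-{i}. \<Sum>j\<in>I-{i,k}. \<Sum>l\<in>I-{i,k}-{j}. T i j * T i l) = real (n - 3) *\<^sub>R Row"
    by (subst sum_distinct4_rotate, simp) (rule sum_distinct4_last; simp)
  also have "(\<Sum>i\<in>I. \<Sum>k\<in>I-{i}. \<Sum>j\<in>I-{i,k}. \<Sum>l\<in>I-{i,k}-{j}. T j k * T l k) = real (n - 3) *\<^sub>R Col"
    by (subst sum_distinct4_cycle, simp) (rule sum_distinct4_last; simp)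
  also have "Path + PathRev + \<kappa> *\<^sub>R Disjoint + (1 / ?N) *\<^sub>R (real (n - 3) *\<^sub>R Row + real (n - 3) *\<^sub>R Col)
    = Path + PathRev + \<kappa> *\<^sub>R Disjoint + (real (n - 3) / ?N) *\<^sub>R (Row + Col)"
    by (simp add: scaleR_right_distrib)
  also have "\<dots> \<le> Path + PathRev + 1 *\<^sub>R Disjoint + 1 *\<^sub>R (Row + Col)"
    using N \<kappa> RowColDisjoint_nonneg by (intro add_mono order_refl scaleR_right_mono add_nonneg_nonneg) auto
  also have "\<dots> = Row + Col + Path + PathRev + Disjoint" by (simp add: algebra_simps)
  also note square_ge
  finally show ?thesis .
qed

end

section \<open>Real group rings\<close>

text \<open>A copy of the type of finitely supported functions, because the latter is already ordered
  lexicographically.\<close>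
typedef 'g group_ring = "UNIV :: ('g \<Rightarrow>\<^sub>0 real) set"
  morphisms coeffs of_coeffs by simp

setup_lifting type_definition_group_ring

section \<open>Involution, trace and sums of squares for finitely supported functions\<close>

lemma sum_singles: "(\<Sum>k\<in>Poly_Mapping.keys p. Poly_Mapping.single k (Poly_Mapping.lookup p k)) = p"
  by (rule poly_mapping_eqI)
    (auto simp: lookup_sum lookup_single when_def in_keys_iff sum.delta)

lemma single_commute: "Poly_Mapping.single 0 (c::real) * p = p * Poly_Mapping.single 0 c"
  for p :: "'g::monoid_add \<Rightarrow>\<^sub>0 real"
proof -
  have *: "Poly_Mapping.single 0 c * (\<Sum>k\<in>S. Poly_Mapping.single k (g k)) = (\<Sum>k\<in>S. Poly_Mapping.single k (g k)) * Poly_Mapping.single 0 c"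
    for S :: "'g set" and g
    by (simp add: sum_distrib_left sum_distrib_right mult_single mult.commute)
  from *[where S = "Poly_Mapping.keys p" and g = "Poly_Mapping.lookup p"] show ?thesis
    by (simp only: sum_singles)
qed

definition pstar :: "('g::group_add \<Rightarrow>\<^sub>0 real) \<Rightarrow> 'g \<Rightarrow>\<^sub>0 real"
  where "pstar p = Poly_Mapping.map_key uminus p"

lemma pstar_single: "pstar (Poly_Mapping.single k c) = Poly_Mapping.single (- k) c"
  using map_key_single[of uminus "- k" c] by (simp add: pstar_def)

lemma pstar_add: "pstar (p + q) = pstar p + pstar q"
  by (simp add: pstar_def map_key_plus)

lemma pstar_zero: "pstar 0 = 0"
  by (simp add: pstar_def)

lemma pstar_sum: "pstar (sum f S) = (\<Sum>x\<in>S. pstar (f x))"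
  by (induction S rule: infinite_finite_induct) (simp_all add: pstar_add pstar_zero)

lemma pstar_eq: "pstar p = (\<Sum>k\<in>Poly_Mapping.keys p. Poly_Mapping.single (- k) (Poly_Mapping.lookup p k))"
proof -
  have "pstar p = pstar (\<Sum>k\<in>Poly_Mapping.keys p. Poly_Mapping.single k (Poly_Mapping.lookup p k))"
    by (simp only: sum_singles)
  then show ?thesis by (simp only: pstar_sum pstar_single)
qed

lemma times_eq: "p * q = (\<Sum>k\<in>Poly_Mapping.keys p. \<Sum>l\<in>Poly_Mapping.keys q.
    Poly_Mapping.single (k + l) (Poly_Mapping.lookup p k * Poly_Mapping.lookup q l))"
  for p q :: "'g::monoid_add \<Rightarrow>\<^sub>0 real"
proof -
  have "p * q = (\<Sum>k\<in>Poly_Mapping.keys p. Poly_Mapping.single k (Poly_Mapping.lookup p k))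
     * (\<Sum>k\<in>Poly_Mapping.keys q. Poly_Mapping.single k (Poly_Mapping.lookup q k))"
    by (simp only: sum_singles)
  then show ?thesis by (simp only: sum_product mult_single)
qed

lemma pstar_mult: "pstar (p * q) = pstar q * pstar p"
proof -
  have "pstar (p * q) = (\<Sum>k\<in>Poly_Mapping.keys p. \<Sum>l\<in>Poly_Mapping.keys q.
    Poly_Mapping.single (- l) (Poly_Mapping.lookup q l) * Poly_Mapping.single (- k) (Poly_Mapping.lookup p k))"
    by (subst times_eq) (simp add: pstar_sum pstar_single mult_single minus_add mult.commute)
  also have "\<dots> = pstar q * pstar p"
    unfolding pstar_eq[of p] pstar_eq[of q] sum_product by (rule sum.swap)
  finally show ?thesis .
qed

lemma pstar_pstar: "pstar (pstar p) = p"
  by (subst pstar_eq) (simp add: pstar_sum pstar_single sum_singles)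

lemma pstar_mult_self:
  "pstar p * p = (\<Sum>k\<in>Poly_Mapping.keys p. \<Sum>l\<in>Poly_Mapping.keys p.
    Poly_Mapping.single (- k + l) (Poly_Mapping.lookup p k * Poly_Mapping.lookup p l))"
proof -
  have "pstar p * p = (\<Sum>k\<in>Poly_Mapping.keys p. Poly_Mapping.single (- k) (Poly_Mapping.lookup p k))
     * (\<Sum>k\<in>Poly_Mapping.keys p. Poly_Mapping.single k (Poly_Mapping.lookup p k))"
    by (simp only: pstar_eq sum_singles)
  then show ?thesis by (simp only: sum_product mult_single)
qed

lemma trace_pstar_mult_self:
  "Poly_Mapping.lookup (pstar p * p) 0 = (\<Sum>k\<in>Poly_Mapping.keys p. (Poly_Mapping.lookup p k)\<^sup>2)"
  unfolding pstar_mult_self lookup_sum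
proof (rule sum.cong[OF refl])
  fix k assume k: "k \<in> Poly_Mapping.keys p"
  have "(- k + l = 0) = (l = k)" for l :: 'a
    by (metis add.right_inverse add.left_inverse add_left_cancel)
  then show "(\<Sum>l\<in>Poly_Mapping.keys p. Poly_Mapping.lookup (Poly_Mapping.single (- k + l)
       (Poly_Mapping.lookup p k * Poly_Mapping.lookup p l)) 0) = (Poly_Mapping.lookup p k)\<^sup>2"
    using k by (simp add: lookup_single when_def power2_eq_square sum.delta)
qed

definition psd :: "('g::group_add \<Rightarrow>\<^sub>0 real) \<Rightarrow> bool"
  where "psd p \<longleftrightarrow> (\<exists>xs. p = (\<Sum>x\<leftarrow>xs. pstar x * x))"

lemma psd_zero: "psd 0"
  unfolding psd_def by (rule exI[of _ "[]"]) simp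

lemma psd_add: assumes "psd p" "psd q" shows "psd (p + q)"
proof -
  from assms obtain xs ys where "p = (\<Sum>x\<leftarrow>xs. pstar x * x)" "q = (\<Sum>x\<leftarrow>ys. pstar x * x)"
    by (auto simp: psd_def)
  then show ?thesis unfolding psd_def by (intro exI[of _ "xs @ ys"]) simp
qed

lemma psd_conj: assumes "psd p" shows "psd (pstar a * p * a)"
proof -
  from assms obtain xs where p: "p = (\<Sum>x\<leftarrow>xs. pstar x * x)"
    by (auto simp: psd_def)
  have "pstar a * (\<Sum>x\<leftarrow>xs. pstar x * x) * a = (\<Sum>x\<leftarrow>map (\<lambda>x. x * a) xs. pstar x * x)"
    by (induction xs) (simp_all add: algebra_simps pstar_mult)
  then show ?thesis unfolding psd_def p by blast
qed

lemma psd_one: "psd 1"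
proof -
  have "pstar 1 = (1 :: 'a \<Rightarrow>\<^sub>0 real)"
    using pstar_single[of 0 1] by simp
  then show ?thesis unfolding psd_def by (intro exI[of _ "[1]"]) simp
qed

lemma psd_scale: assumes "psd p" "0 \<le> c" shows "psd (Poly_Mapping.single 0 c * p)"
proof -
  have "psd (pstar (Poly_Mapping.single 0 (sqrt c)) * p * Poly_Mapping.single 0 (sqrt c))"
    by (rule psd_conj[OF assms(1)])
  also have "pstar (Poly_Mapping.single 0 (sqrt c)) * p * Poly_Mapping.single 0 (sqrt c)
      = Poly_Mapping.single 0 (sqrt c) * Poly_Mapping.single 0 (sqrt c) * p"
    by (simp only: pstar_single minus_zero mult.assoc single_commute[of _ p, symmetric])
  also have "Poly_Mapping.single 0 (sqrt c) * Poly_Mapping.single 0 (sqrt c) = (Poly_Mapping.single 0 c :: 'a \<Rightarrow>\<^sub>0 real)"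
    using assms(2) by (simp add: mult_single)
  finally show ?thesis .
qed

text \<open>The trace, that is the coefficient at 0, is faithful: on \<open>pstar x * x\<close> it
  is the sum of the squared coefficients of \<open>x\<close>. If \<open>p\<close> and
  \<open>- p\<close> are sums of squares, their traces vanish, and hence so does every square in
  \<open>p\<close>.\<close>

lemma psd_antisym: assumes "psd p" "psd (- p)" shows "p = 0"
proof -
  have sq: "0 \<le> Poly_Mapping.lookup (pstar x * x) 0" for x :: "'a \<Rightarrow>\<^sub>0 real"
    unfolding trace_pstar_mult_self by (intro sum_nonneg) auto
  have tr: "0 \<le> Poly_Mapping.lookup (\<Sum>x\<leftarrow>xs. pstar x * x) 0" for xs :: "('a \<Rightarrow>\<^sub>0 real) list"
    using sq by (induction xs) (simp_all add: lookup_add)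
  have z: "Poly_Mapping.lookup (\<Sum>x\<leftarrow>xs. pstar x * x) 0 \<le> 0 \<Longrightarrow> (\<Sum>x\<leftarrow>xs. pstar x * x) = 0"
    for xs :: "('a \<Rightarrow>\<^sub>0 real) list"
  proof (induction xs)
    case (Cons x xs)
    then have 0: "Poly_Mapping.lookup (pstar x * x) 0 = 0" "Poly_Mapping.lookup (\<Sum>x\<leftarrow>xs. pstar x * x) 0 \<le> 0"
      using sq[of x] tr[of xs] by (auto simp: lookup_add)
    from 0(1) have "\<forall>k\<in>Poly_Mapping.keys x. (Poly_Mapping.lookup x k)\<^sup>2 = 0"
      unfolding trace_pstar_mult_self by (subst (asm) sum_nonneg_eq_0_iff) auto
    then have "x = 0"
      by (intro poly_mapping_eqI) (auto simp: in_keys_iff)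
    then show ?case using Cons.IH[OF 0(2)] by simp
  qed simp
  from assms obtain xs ys where xs: "p = (\<Sum>x\<leftarrow>xs. pstar x * x)" and ys: "- p = (\<Sum>x\<leftarrow>ys. pstar x * x)"
    by (auto simp: psd_def)
  have "0 \<le> Poly_Mapping.lookup (- p) 0" unfolding ys by (rule tr)
  then show ?thesis using z[of xs] unfolding xs by simp
qed

text \<open>The order says that the difference is a finite sum of hermitian squares. Every
  inequality derived from the class axioms is therefore an algebraic certificate in the group
  ring.\<close>

instantiation group_ring :: (group_add) star_algebra
begin

lift_definition zero_group_ring :: "'a group_ring" is 0 .
lift_definition one_group_ring :: "'a group_ring" is 1 .
lift_definition plus_group_ring :: "'a group_ring \<Rightarrow> 'a group_ring \<Rightarrow> 'a group_ring" is "(+)" .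
lift_definition minus_group_ring :: "'a group_ring \<Rightarrow> 'a group_ring \<Rightarrow> 'a group_ring" is "(-)" .
lift_definition uminus_group_ring :: "'a group_ring \<Rightarrow> 'a group_ring" is uminus .
lift_definition times_group_ring :: "'a group_ring \<Rightarrow> 'a group_ring \<Rightarrow> 'a group_ring" is "(*)" .
lift_definition scaleR_group_ring :: "real \<Rightarrow> 'a group_ring \<Rightarrow> 'a group_ring"
  is "\<lambda>c p. Poly_Mapping.single 0 c * p" .
lift_definition star_group_ring :: "'a group_ring \<Rightarrow> 'a group_ring" is pstar .
lift_definition less_eq_group_ring :: "'a group_ring \<Rightarrow> 'a group_ring \<Rightarrow> bool"
  is "\<lambda>p q. psd (q - p)" .
definition less_group_ring :: "'a group_ring \<Rightarrow> 'a group_ring \<Rightarrow> bool"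
  where "less_group_ring p q \<longleftrightarrow> p \<le> q \<and> \<not> q \<le> p"

instance
proof
  fix a b c :: "'a group_ring" and r s :: real
  show "a * b * c = a * (b * c)" "1 * a = a" "a * 1 = a" "(a + b) * c = a * c + b * c"
    "a * (b + c) = a * b + a * c" "a + b + c = a + (b + c)" "a + b = b + a" "0 + a = a"
    "- a + a = 0" "a - b = a + - b"
    by (transfer; simp add: algebra_simps)+
  show "(0::'a group_ring) \<noteq> 1" by transfer simp
  show "r *\<^sub>R (a + b) = r *\<^sub>R a + r *\<^sub>R b" "(r + s) *\<^sub>R a = r *\<^sub>R a + s *\<^sub>R a"
    "r *\<^sub>R s *\<^sub>R a = (r * s) *\<^sub>R a" "1 *\<^sub>R a = a" "r *\<^sub>R a * b = r *\<^sub>R (a * b)"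
    by (transfer; simp add: distrib_left distrib_right single_add mult_single flip: mult.assoc)+
  show "a * r *\<^sub>R b = r *\<^sub>R (a * b)"
    by transfer (simp add: single_commute mult.assoc)
  show "a \<le> a" by transfer (simp add: psd_zero)
  show "a \<le> b \<Longrightarrow> b \<le> c \<Longrightarrow> a \<le> c"
    by transfer (drule (1) psd_add, simp add: algebra_simps)
  show "a \<le> b \<Longrightarrow> b \<le> a \<Longrightarrow> a = b"
    by transfer (drule psd_antisym, simp, simp)
  show "a < b \<longleftrightarrow> a \<le> b \<and> \<not> b \<le> a" by (rule less_group_ring_def)
  show "a \<le> b \<Longrightarrow> c + a \<le> c + b" by transfer simp
  show "a \<le> b \<Longrightarrow> 0 \<le> r \<Longrightarrow> r *\<^sub>R a \<le> r *\<^sub>R b"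
    by transfer (simp add: psd_scale flip: right_diff_distrib)
  show "r \<le> s \<Longrightarrow> 0 \<le> a \<Longrightarrow> r *\<^sub>R a \<le> s *\<^sub>R a"
    by transfer (simp add: psd_scale flip: left_diff_distrib single_diff)
  show "star (a + b) = star a + star b" by transfer (rule pstar_add)
  show "star (a * b) = star b * star a" by transfer (rule pstar_mult)
  show "star (r *\<^sub>R a) = r *\<^sub>R star a"
    by transfer (simp add: pstar_mult pstar_single single_commute)
  show "star (star a) = a" by transfer (rule pstar_pstar)
  show "0 \<le> (1::'a group_ring)" by transfer (simp add: psd_one)
  show "0 \<le> a \<Longrightarrow> 0 \<le> star b * a * b" by transfer (simp add: psd_conj)
qed

end

text \<open>The convolution product of \<^typ>\<open>'g \<Rightarrow>\<^sub>0 real\<close> needs a group that is the universe of a type and is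
  written additively; by Cayley's theorem every group embeds into the bijections of a type.\<close>
typedef 'a bijection = "{f :: 'a \<Rightarrow> 'a. bij f}"
  by (rule exI[of _ id]) simp

setup_lifting type_definition_bijection

instantiation bijection :: (type) group_add
begin

lift_definition zero_bijection :: "'a bijection" is id by simp
lift_definition plus_bijection :: "'a bijection \<Rightarrow> 'a bijection \<Rightarrow> 'a bijection" is "(\<circ>)"
  by (rule bij_comp)
lift_definition uminus_bijection :: "'a bijection \<Rightarrow> 'a bijection" is "inv_into UNIV"
  by (rule bij_imp_bij_inv)
definition minus_bijection :: "'a bijection \<Rightarrow> 'a bijection \<Rightarrow> 'a bijection"
  where "minus_bijection f g = f + - g"

instance
proof
  fix a b c :: "'a bijection"
  show "a + b + c = a + (b + c)" by transfer (simp add: comp_assoc)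
  show "0 + a = a" "a + 0 = a" by (transfer; simp)+
  show "- a + a = 0" by transfer (simp add: bij_is_inj)
  show "a + - b = a - b" by (simp add: minus_bijection_def)
qed

end

section \<open>Transfer to the group algebra\<close>

definition push :: "('a \<Rightarrow> 'g) \<Rightarrow> ('a \<Rightarrow>\<^sub>0 real) \<Rightarrow> 'g \<Rightarrow>\<^sub>0 real"
  where "push \<phi> \<xi> = (\<Sum>x\<in>Poly_Mapping.keys \<xi>. Poly_Mapping.single (\<phi> x) (Poly_Mapping.lookup \<xi> x))"

lemma push_superset:
  assumes "finite A" "Poly_Mapping.keys \<xi> \<subseteq> A"
  shows "push \<phi> \<xi> = (\<Sum>x\<in>A. Poly_Mapping.single (\<phi> x) (Poly_Mapping.lookup \<xi> x))"
  unfolding push_def by (rule sum.mono_neutral_left) (use assms in \<open>auto simp: in_keys_iff\<close>)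

lemma push_zero [simp]: "push \<phi> 0 = 0"
  by (simp add: push_def)

lemma push_single [simp]: "push \<phi> (Poly_Mapping.single x c) = Poly_Mapping.single (\<phi> x) c"
  by (simp add: push_superset[of "{x}"])

lemma push_add: "push \<phi> (\<xi> + \<eta>) = push \<phi> \<xi> + push \<phi> \<eta>"
proof -
  let ?A = "Poly_Mapping.keys \<xi> \<union> Poly_Mapping.keys \<eta>"
  have "Poly_Mapping.keys (\<xi> + \<eta>) \<subseteq> ?A" by (rule keys_add)
  then show ?thesis
    by (simp add: push_superset[of ?A] lookup_add single_add sum.distrib)
qed

lemma push_diff: "push \<phi> (\<xi> - \<eta>) = push \<phi> \<xi> - push \<phi> \<eta>"
  using push_add[of \<phi> "\<xi> - \<eta>" \<eta>] by (simp add: algebra_simps)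

lemma push_sum: "push \<phi> (sum f S) = (\<Sum>x\<in>S. push \<phi> (f x))"
  by (induction S rule: infinite_finite_induct) (simp_all add: push_add)

lemma push_sum_list: "push \<phi> (sum_list \<xi>s) = (\<Sum>\<xi>\<leftarrow>\<xi>s. push \<phi> \<xi>)"
  by (induction \<xi>s) (simp_all add: push_add)

lemma lookup_gscale: "Poly_Mapping.lookup (gscale c \<xi>) x = c * Poly_Mapping.lookup \<xi> x"
  by (simp add: gscale_def Poly_Mapping.map.rep_eq when_def)

lemma push_gscale: "push \<phi> (gscale c \<xi>) = Poly_Mapping.single 0 c * push \<phi> \<xi>"
  for \<phi> :: "'a \<Rightarrow> 'g::monoid_add"
proof -
  have "Poly_Mapping.keys (gscale c \<xi>) \<subseteq> Poly_Mapping.keys \<xi>"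
    by (auto simp: in_keys_iff lookup_gscale)
  then show ?thesis
    by (simp add: push_superset[of "Poly_Mapping.keys \<xi>"] lookup_gscale sum_distrib_left mult_single)
qed

lemma lookup_push:
  assumes "Poly_Mapping.keys \<xi> \<subseteq> S" "inj_on \<phi> S" "x \<in> S"
  shows "Poly_Mapping.lookup (push \<phi> \<xi>) (\<phi> x) = Poly_Mapping.lookup \<xi> x"
proof -
  have "(\<phi> y = \<phi> x) = (y = x)" if "y \<in> Poly_Mapping.keys \<xi>" for y
    using assms that by (auto dest: inj_onD)
  then have "Poly_Mapping.lookup (push \<phi> \<xi>) (\<phi> x)
     = (\<Sum>y\<in>Poly_Mapping.keys \<xi>. if y = x then Poly_Mapping.lookup \<xi> y else 0)"
    unfolding push_def lookup_sum lookup_single when_def by (intro sum.cong) auto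
  then show ?thesis by (simp add: sum.delta' in_keys_iff)
qed

text \<open>For a subgroup \<open>H\<close> this is the conditional expectation onto the group
  algebra of \<open>H\<close>.\<close>

definition restrict_to :: "'g set \<Rightarrow> ('g \<Rightarrow>\<^sub>0 real) \<Rightarrow> 'g \<Rightarrow>\<^sub>0 real"
  where "restrict_to H p = (\<Sum>k\<in>Poly_Mapping.keys p. if k \<in> H then Poly_Mapping.single k (Poly_Mapping.lookup p k) else 0)"

lemma lookup_restrict_to: "Poly_Mapping.lookup (restrict_to H p) k = (if k \<in> H then Poly_Mapping.lookup p k else 0)"
proof -
  have "Poly_Mapping.lookup (restrict_to H p) k
    = (\<Sum>l\<in>Poly_Mapping.keys p. if l = k then (if k \<in> H then Poly_Mapping.lookup p k else 0) else 0)"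
    unfolding restrict_to_def lookup_sum by (intro sum.cong) (auto simp: lookup_single when_def)
  then show ?thesis by (simp add: sum.delta' in_keys_iff)
qed

lemma restrict_to_add: "restrict_to H (p + q) = restrict_to H p + restrict_to H q"
  by (rule poly_mapping_eqI) (simp add: lookup_restrict_to lookup_add)

lemma restrict_to_zero: "restrict_to H 0 = 0"
  by (simp add: restrict_to_def)

lemma restrict_to_sum: "restrict_to H (sum f S) = (\<Sum>x\<in>S. restrict_to H (f x))"
  by (induction S rule: infinite_finite_induct) (simp_all add: restrict_to_add restrict_to_zero)

lemma restrict_to_single: "restrict_to H (Poly_Mapping.single k c) = (if k \<in> H then Poly_Mapping.single k c else 0)"
  by (rule poly_mapping_eqI) (auto simp: lookup_restrict_to lookup_single when_def)

section \<open>Group algebras along an injective homomorphism\<close>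

locale group_embedding = group G for G :: "('a, 'b) monoid_scheme" (structure) +
  fixes \<phi> :: "'a \<Rightarrow> 'g::group_add"
  assumes hom: "\<And>x y. x \<in> carrier G \<Longrightarrow> y \<in> carrier G \<Longrightarrow> \<phi> (x \<otimes> y) = \<phi> x + \<phi> y"
    and inj: "inj_on \<phi> (carrier G)"
begin

lemma hom_one: "\<phi> \<one> = 0"
proof -
  have "\<phi> \<one> + \<phi> \<one> = \<phi> \<one> + 0"
    using hom[of \<one> \<one>] by simp
  then show ?thesis by (simp only: add_left_cancel)
qed

lemma hom_inv: "x \<in> carrier G \<Longrightarrow> \<phi> (inv x) = - \<phi> x"
  using hom[of "inv x" x] by (simp add: hom_one eq_neg_iff_add_eq_0)

lemma push_gmult:
  assumes "\<xi> \<in> galg G" "\<eta> \<in> galg G"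
  shows "push \<phi> (gmult G \<xi> \<eta>) = push \<phi> \<xi> * push \<phi> \<eta>"
proof -
  have "push \<phi> (gmult G \<xi> \<eta>) = (\<Sum>x\<in>Poly_Mapping.keys \<xi>. \<Sum>y\<in>Poly_Mapping.keys \<eta>.
     Poly_Mapping.single (\<phi> x) (Poly_Mapping.lookup \<xi> x) * Poly_Mapping.single (\<phi> y) (Poly_Mapping.lookup \<eta> y))"
    unfolding gmult_def push_sum push_single mult_single
    using assms by (intro sum.cong refl) (simp add: galg_def subset_iff hom)
  then show ?thesis by (simp add: push_def sum_product)
qed

lemma push_gstar:
  assumes "\<xi> \<in> galg G"
  shows "push \<phi> (gstar G \<xi>) = pstar (push \<phi> \<xi>)"
proof -
  have "push \<phi> (gstar G \<xi>) = (\<Sum>x\<in>Poly_Mapping.keys \<xi>. Poly_Mapping.single (- \<phi> x) (Poly_Mapping.lookup \<xi> x))"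
    unfolding gstar_def push_sum push_single
    using assms by (intro sum.cong refl) (auto simp: galg_def hom_inv)
  then show ?thesis by (simp add: push_def pstar_sum pstar_single)
qed

lemma galg_zero: "0 \<in> galg G"
  by (simp add: galg_def)

lemma galg_single: "x \<in> carrier G \<Longrightarrow> Poly_Mapping.single x c \<in> galg G"
  by (simp add: galg_def)

lemma galg_add: "\<xi> \<in> galg G \<Longrightarrow> \<eta> \<in> galg G \<Longrightarrow> \<xi> + \<eta> \<in> galg G"
  using keys_add[of \<xi> \<eta>] by (auto simp: galg_def)

lemma galg_diff: "\<xi> \<in> galg G \<Longrightarrow> \<eta> \<in> galg G \<Longrightarrow> \<xi> - \<eta> \<in> galg G"
  using keys_diff[of \<xi> \<eta>] by (auto simp: galg_def)

lemma galg_sum: "(\<And>x. x \<in> S \<Longrightarrow> f x \<in> galg G) \<Longrightarrow> sum f S \<in> galg G"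
  by (induction S rule: infinite_finite_induct) (simp_all add: galg_zero galg_add)

lemma galg_sum_list: "set \<xi>s \<subseteq> galg G \<Longrightarrow> sum_list \<xi>s \<in> galg G"
  by (induction \<xi>s) (simp_all add: galg_zero galg_add)

lemma galg_gscale: "\<xi> \<in> galg G \<Longrightarrow> gscale c \<xi> \<in> galg G"
  by (auto simp: galg_def in_keys_iff lookup_gscale subset_iff)

lemma galg_gmult: "\<xi> \<in> galg G \<Longrightarrow> \<eta> \<in> galg G \<Longrightarrow> gmult G \<xi> \<eta> \<in> galg G"
  unfolding gmult_def by (intro galg_sum galg_single) (auto simp: galg_def)

lemma galg_gstar: "\<xi> \<in> galg G \<Longrightarrow> gstar G \<xi> \<in> galg G"
  unfolding gstar_def by (intro galg_sum galg_single) (auto simp: galg_def)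

lemma push_inj:
  assumes "\<xi> \<in> galg G" "\<eta> \<in> galg G" "push \<phi> \<xi> = push \<phi> \<eta>"
  shows "\<xi> = \<eta>"
proof (rule poly_mapping_eqI)
  fix x
  show "Poly_Mapping.lookup \<xi> x = Poly_Mapping.lookup \<eta> x"
  proof (cases "x \<in> carrier G")
    case True
    then show ?thesis
      using lookup_push[OF _ inj True, of \<xi>] lookup_push[OF _ inj True, of \<eta>] assms by (simp add: galg_def)
  next
    case False
    then have "x \<notin> Poly_Mapping.keys \<xi>" "x \<notin> Poly_Mapping.keys \<eta>" using assms by (auto simp: galg_def)
    then show ?thesis by (simp add: in_keys_iff)
  qed
qed

lemma restrict_to_push: "\<xi> \<in> galg G \<Longrightarrow> restrict_to (\<phi> ` carrier G) (push \<phi> \<xi>) = push \<phi> \<xi>"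
  unfolding push_def restrict_to_sum restrict_to_single by (intro sum.cong) (auto simp: galg_def)

text \<open>The restriction of $\eta^* \eta$ to a subgroup $H$ is the sum of the squares of the parts of
  $\eta$ that are supported on the left cosets of $H$, each translated into $H$.\<close>
lemma restrict_to_square:
  "\<exists>\<zeta>s. set \<zeta>s \<subseteq> galg G \<and> restrict_to (\<phi> ` carrier G) (pstar \<eta> * \<eta>) = (\<Sum>\<zeta>\<leftarrow>\<zeta>s. push \<phi> (gmult G (gstar G \<zeta>) \<zeta>))"
proof -
  let ?H = "\<phi> ` carrier G" and ?K = "Poly_Mapping.keys \<eta>"
  have H_add: "a + b \<in> ?H" if "a \<in> ?H" "b \<in> ?H" for a b
    using that by (force simp flip: hom)
  have H_neg: "- a \<in> ?H" if "a \<in> ?H" for a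
    using that by (force simp flip: hom_inv)
  \<comment> \<open>\<open>\<rho> k\<close> is a representative of the left coset of
    \<open>k\<close>. It depends on the coset alone, because the predicate under \<open>SOME\<close>
    does; this is what \<open>rel\<close> records.\<close>
  define \<rho> where "\<rho> k = (SOME c. - c + k \<in> ?H)" for k
  have \<rho>: "- \<rho> k + k \<in> ?H" for k
    unfolding \<rho>_def by (rule someI[of _ k]) (force simp flip: hom_one)
  have rel: "- k + l \<in> ?H \<longleftrightarrow> \<rho> k = \<rho> l" for k l
  proof
    assume kl: "- k + l \<in> ?H"
    have "(- c + k \<in> ?H) = (- c + l \<in> ?H)" for c
    proof
      assume "- c + k \<in> ?H"
      from H_add[OF this kl] show "- c + l \<in> ?H" by (simp add: add.assoc)
    next
      assume "- c + l \<in> ?H"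
      from H_add[OF this H_neg[OF kl]] show "- c + k \<in> ?H" by (simp add: add.assoc minus_add)
    qed
    then show "\<rho> k = \<rho> l" by (simp add: \<rho>_def)
  next
    assume "\<rho> k = \<rho> l"
    then show "- k + l \<in> ?H"
      using H_add[OF H_neg[OF \<rho>[of k]] \<rho>[of l]] by (simp add: add.assoc minus_add)
  qed
  define \<psi> where "\<psi> = the_inv_into (carrier G) \<phi>"
  have \<psi>: "\<phi> (\<psi> h) = h" "\<psi> h \<in> carrier G" if "h \<in> ?H" for h
    using that inj by (auto simp: \<psi>_def the_inv_into_f_f)
  define \<zeta> where "\<zeta> c = (\<Sum>k | k \<in> ?K \<and> \<rho> k = c. Poly_Mapping.single (\<psi> (- c + k)) (Poly_Mapping.lookup \<eta> k))" for c
  have \<zeta>: "\<zeta> c \<in> galg G" for c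
    unfolding \<zeta>_def using \<rho> by (intro galg_sum galg_single \<psi>(2)) auto
  have push_\<zeta>: "push \<phi> (\<zeta> c) = (\<Sum>k | k \<in> ?K \<and> \<rho> k = c. Poly_Mapping.single (- c + k) (Poly_Mapping.lookup \<eta> k))" for c
    unfolding \<zeta>_def push_sum push_single using \<rho> by (intro sum.cong refl arg_cong2[where f = Poly_Mapping.single] \<psi>(1)) auto
  let ?g = "\<lambda>k l. Poly_Mapping.single (- k + l) (Poly_Mapping.lookup \<eta> k * Poly_Mapping.lookup \<eta> l)"
  have sq: "push \<phi> (gmult G (gstar G (\<zeta> c)) (\<zeta> c)) = (\<Sum>k | k \<in> ?K \<and> \<rho> k = c. \<Sum>l | l \<in> ?K \<and> \<rho> l = c. ?g k l)" for c
  proof -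
    have "push \<phi> (gmult G (gstar G (\<zeta> c)) (\<zeta> c)) = pstar (push \<phi> (\<zeta> c)) * push \<phi> (\<zeta> c)"
      using \<zeta> by (simp add: push_gmult push_gstar galg_gstar)
    also have "\<dots> = (\<Sum>k | k \<in> ?K \<and> \<rho> k = c. \<Sum>l | l \<in> ?K \<and> \<rho> l = c. ?g k l)"
      by (simp add: push_\<zeta> pstar_sum pstar_single sum_product mult_single minus_add add.assoc)
    finally show ?thesis .
  qed
  have "restrict_to ?H (pstar \<eta> * \<eta>) = (\<Sum>k\<in>?K. \<Sum>l\<in>?K. if \<rho> l = \<rho> k then ?g k l else 0)"
    unfolding pstar_mult_self restrict_to_sum restrict_to_single rel by (simp add: eq_commute)
  also have "\<dots> = (\<Sum>k\<in>?K. \<Sum>l | l \<in> ?K \<and> \<rho> l = \<rho> k. ?g k l)"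
    by (rule sum.cong[OF refl]) (simp add: sum.inter_filter)
  also have "\<dots> = (\<Sum>c\<in>\<rho> ` ?K. \<Sum>k | k \<in> ?K \<and> \<rho> k = c. \<Sum>l | l \<in> ?K \<and> \<rho> l = \<rho> k. ?g k l)"
    by (rule sum.image_gen) simp
  also have "\<dots> = (\<Sum>c\<in>\<rho> ` ?K. push \<phi> (gmult G (gstar G (\<zeta> c)) (\<zeta> c)))"
    unfolding sq by (rule sum.cong[OF refl], rule sum.cong[OF refl]) auto
  also obtain cs where cs: "set cs = \<rho> ` ?K" "distinct cs"
    using finite_distinct_list[of "\<rho> ` ?K"] by auto
  have "(\<Sum>c\<in>\<rho> ` ?K. push \<phi> (gmult G (gstar G (\<zeta> c)) (\<zeta> c)))
      = (\<Sum>\<zeta>\<leftarrow>map \<zeta> cs. push \<phi> (gmult G (gstar G \<zeta>) \<zeta>))"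
    using sum_list_distinct_conv_sum_set[OF cs(2), of "\<lambda>c. push \<phi> (gmult G (gstar G (\<zeta> c)) (\<zeta> c))"] cs(1)
    by (simp add: o_def)
  finally show ?thesis
    by (intro exI[of _ "map \<zeta> cs"]) (use \<zeta> in auto)
qed

text \<open>The squares witnessing \<open>psd\<close> may use elements outside the image of the
  group. Restriction to the image fixes \<open>push \<phi> \<xi>\<close>, maps squares to sums of
  squares from \<open>galg G\<close>, and \<open>push \<phi>\<close> is injective there.\<close>

theorem sum_squares_if_psd:
  assumes \<xi>: "\<xi> \<in> galg G" and psd: "psd (push \<phi> \<xi>)"
  shows "\<xi> \<in> sum_squares G"
proof -
  let ?H = "\<phi> ` carrier G"
  have sq: "\<exists>\<zeta>s. set \<zeta>s \<subseteq> galg G \<and> restrict_to ?H (\<Sum>\<eta>\<leftarrow>\<eta>s. pstar \<eta> * \<eta>) = (\<Sum>\<zeta>\<leftarrow>\<zeta>s. push \<phi> (gmult G (gstar G \<zeta>) \<zeta>))"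
    for \<eta>s
  proof (induction \<eta>s)
    case Nil
    show ?case by (rule exI[of _ "[]"]) (simp add: restrict_to_zero)
  next
    case (Cons \<eta> \<eta>s)
    then obtain \<zeta>s where "set \<zeta>s \<subseteq> galg G"
      "restrict_to ?H (\<Sum>\<eta>\<leftarrow>\<eta>s. pstar \<eta> * \<eta>) = (\<Sum>\<zeta>\<leftarrow>\<zeta>s. push \<phi> (gmult G (gstar G \<zeta>) \<zeta>))" by blast
    moreover obtain \<zeta>s' where "set \<zeta>s' \<subseteq> galg G"
      "restrict_to ?H (pstar \<eta> * \<eta>) = (\<Sum>\<zeta>\<leftarrow>\<zeta>s'. push \<phi> (gmult G (gstar G \<zeta>) \<zeta>))"
      using restrict_to_square by blast
    ultimately show ?case
      by (intro exI[of _ "\<zeta>s' @ \<zeta>s"]) (simp add: restrict_to_add)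
  qed
  obtain \<eta>s where \<eta>s: "push \<phi> \<xi> = (\<Sum>\<eta>\<leftarrow>\<eta>s. pstar \<eta> * \<eta>)"
    using psd by (auto simp: psd_def)
  obtain \<zeta>s where \<zeta>s: "set \<zeta>s \<subseteq> galg G"
    "restrict_to ?H (\<Sum>\<eta>\<leftarrow>\<eta>s. pstar \<eta> * \<eta>) = (\<Sum>\<zeta>\<leftarrow>\<zeta>s. push \<phi> (gmult G (gstar G \<zeta>) \<zeta>))"
    using sq by blast
  let ?S = "\<Sum>\<zeta>\<leftarrow>\<zeta>s. gmult G (gstar G \<zeta>) \<zeta>"
  have "push \<phi> \<xi> = restrict_to ?H (push \<phi> \<xi>)" using \<xi> by (simp add: restrict_to_push)
  also have "\<dots> = push \<phi> ?S"
    unfolding \<eta>s \<zeta>s(2) by (simp add: push_sum_list o_def)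
  finally have "\<xi> = ?S"
    using \<zeta>s(1) by (intro push_inj[OF \<xi>] galg_sum_list) (auto intro!: galg_gmult galg_gstar)
  then show ?thesis using \<zeta>s(1) unfolding sum_squares_def by blast
qed

definition embed :: "('a \<Rightarrow>\<^sub>0 real) \<Rightarrow> 'g group_ring"
  where "embed \<xi> = of_coeffs (push \<phi> \<xi>)"

lemma coeffs_embed: "coeffs (embed \<xi>) = push \<phi> \<xi>"
  by (simp add: embed_def of_coeffs_inverse)

lemma embed_add: "embed (\<xi> + \<eta>) = embed \<xi> + embed \<eta>"
  by (simp add: coeffs_inject[symmetric] coeffs_embed plus_group_ring.rep_eq push_add)

lemma embed_diff: "embed (\<xi> - \<eta>) = embed \<xi> - embed \<eta>"
  by (simp add: coeffs_inject[symmetric] coeffs_embed minus_group_ring.rep_eq push_diff)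

lemma embed_zero: "embed 0 = 0"
  by (simp add: coeffs_inject[symmetric] coeffs_embed zero_group_ring.rep_eq)

lemma embed_sum: "embed (sum f S) = (\<Sum>x\<in>S. embed (f x))"
  by (induction S rule: infinite_finite_induct) (simp_all add: embed_add embed_zero)

lemma embed_gscale: "embed (gscale c \<xi>) = c *\<^sub>R embed \<xi>"
  by (simp add: coeffs_inject[symmetric] coeffs_embed scaleR_group_ring.rep_eq push_gscale)

lemma embed_gmult: "\<xi> \<in> galg G \<Longrightarrow> \<eta> \<in> galg G \<Longrightarrow> embed (gmult G \<xi> \<eta>) = embed \<xi> * embed \<eta>"
  by (simp add: coeffs_inject[symmetric] coeffs_embed times_group_ring.rep_eq push_gmult)

lemma embed_gstar: "\<xi> \<in> galg G \<Longrightarrow> embed (gstar G \<xi>) = star (embed \<xi>)"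
  by (simp add: coeffs_inject[symmetric] coeffs_embed star_group_ring.rep_eq push_gstar)

lemma embed_gone: "embed (gone G) = 1"
  by (simp add: coeffs_inject[symmetric] coeffs_embed one_group_ring.rep_eq gone_def gelem_def hom_one)

definition elem :: "'a \<Rightarrow> 'g group_ring"
  where "elem x = embed (gelem x)"

lemma elem_mult: "x \<in> carrier G \<Longrightarrow> y \<in> carrier G \<Longrightarrow> elem (x \<otimes> y) = elem x * elem y"
  by (simp add: elem_def coeffs_inject[symmetric] coeffs_embed times_group_ring.rep_eq gelem_def hom mult_single)

lemma unitary_elem: "x \<in> carrier G \<Longrightarrow> unitary (elem x)"
  by (simp add: unitary_def elem_def coeffs_inject[symmetric] coeffs_embed times_group_ring.rep_eq
      star_group_ring.rep_eq one_group_ring.rep_eq gelem_def pstar_single mult_single)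

lemma galg_gone_gelem: "x \<in> carrier G \<Longrightarrow> gone G - gelem x \<in> galg G"
  unfolding gone_def gelem_def by (intro galg_diff galg_single) auto

lemma galg_one_minus_sq: "x \<in> carrier G \<Longrightarrow> one_minus_sq G x \<in> galg G"
  unfolding one_minus_sq_def by (intro galg_gmult galg_gstar galg_gone_gelem)

lemma embed_one_minus_sq: "x \<in> carrier G \<Longrightarrow> embed (one_minus_sq G x) = lap (elem x)"
  unfolding one_minus_sq_def lap_def elem_def
  by (simp add: embed_gmult embed_gstar galg_gstar galg_gone_gelem embed_diff embed_gone)

text \<open>Nonnegativity of \<open>embed \<xi>\<close> already means a sum of squares in the larger
  group ring, and adding \<open>\<epsilon>\<close> times the unit keeps it one; the descent to
  \<open>G\<close> is \<open>sum_squares_if_psd\<close>.\<close>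

theorem arch_closure_if_nonneg:
  assumes \<xi>: "\<xi> \<in> galg G" and nonneg: "0 \<le> embed \<xi>"
  shows "\<xi> \<in> arch_closure_sum_squares G"
proof -
  have "\<xi> + gscale \<epsilon> (gone G) \<in> sum_squares G" if "\<epsilon> > 0" for \<epsilon>
  proof (rule sum_squares_if_psd)
    show "\<xi> + gscale \<epsilon> (gone G) \<in> galg G"
      unfolding gone_def gelem_def by (intro galg_add galg_gscale galg_single \<xi> one_closed)
    have "0 \<le> embed \<xi> + \<epsilon> *\<^sub>R (1 :: 'g group_ring)"
      using that nonneg zero_le_one_star by (intro add_nonneg_nonneg scaleR_nonneg_nonneg) auto
    then have "0 \<le> embed (\<xi> + gscale \<epsilon> (gone G))"
      by (simp add: embed_add embed_gscale embed_gone)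
    then show "psd (push \<phi> (\<xi> + gscale \<epsilon> (gone G)))"
      by (simp add: less_eq_group_ring.rep_eq coeffs_embed zero_group_ring.rep_eq)
  qed
  with \<xi> show ?thesis by (simp add: arch_closure_sum_squares_def)
qed

end

text \<open>Points outside the carrier are fixed, so that a group element acts as a bijection of the
  whole type \<open>'a\<close>.\<close>

definition left_translation :: "('a, 'b) monoid_scheme \<Rightarrow> 'a \<Rightarrow> 'a bijection"
  where "left_translation G x = Abs_bijection (\<lambda>y. if y \<in> carrier G then x \<otimes>\<^bsub>G\<^esub> y else y)"

lemma (in group) cayley: "group_embedding G (left_translation G)"
proof -
  let ?L = "\<lambda>x y. if y \<in> carrier G then x \<otimes> y else y"
  have comp: "?L x \<circ> ?L y = ?L (x \<otimes> y)" if "x \<in> carrier G" "y \<in> carrier G" for x y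
    using that by (auto simp: fun_eq_iff m_assoc)
  have one: "?L \<one> = id" by (auto simp: fun_eq_iff)
  have "bij (?L x)" if "x \<in> carrier G" for x
    by (rule o_bij[of "?L (inv x)"]) (simp_all only: comp inv_closed l_inv r_inv that one)
  then have Rep: "Rep_bijection (left_translation G x) = ?L x" if "x \<in> carrier G" for x
    using that by (simp add: left_translation_def Abs_bijection_inverse)
  show ?thesis
  proof
    fix x y assume "x \<in> carrier G" "y \<in> carrier G"
    then show "left_translation G (x \<otimes> y) = left_translation G x + left_translation G y"
      by (simp add: Rep_bijection_inject[symmetric] plus_bijection.rep_eq Rep comp)
  next
    show "inj_on (left_translation G) (carrier G)"
    proof (rule inj_onI)
      fix x y assume xy: "x \<in> carrier G" "y \<in> carrier G" "left_translation G x = left_translation G y"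
      then have "?L x = ?L y" by (simp only: flip: Rep)
      then have "?L x \<one> = ?L y \<one>" by (rule fun_cong)
      then show "x = y" using xy by simp
    qed
  qed
qed

section \<open>Elementary matrices over the polynomial rng\<close>

lemma elem_mat_carrier [simp]: "elem_mat n i j r \<in> carrier_mat n n"
  by (simp add: elem_mat_def)

lemma dim_elem_mat [simp]: "dim_row (elem_mat n i j r) = n" "dim_col (elem_mat n i j r) = n"
  by (simp_all add: elem_mat_def)

text \<open>Reading the product as a row operation lets entries of products be computed without
  expanding scalar products; the matrix identities below rest on this.\<close>

lemma elem_mat_mult:
  assumes "A \<in> carrier_mat n n" "j < n"
  shows "elem_mat n i j r * A = addrow r i j A"
  using addrow_mat[OF assms, of r i] by (simp add: elem_mat_def)

lemma elem_mat_mult_elem_mat: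
  assumes "j < n" "p < n" "c < n"
  shows "(elem_mat n i j a * elem_mat n k l b) $$ (p, c)
    = (if p = i then a * elem_mat n k l b $$ (j, c) + elem_mat n k l b $$ (p, c) else elem_mat n k l b $$ (p, c))"
  using assms by (simp add: elem_mat_mult del: index_mult_mat(1))

lemma index_elem_mat:
  assumes "p < n" "c < n"
  shows "elem_mat n i j a $$ (p, c) = (if i = p \<and> j = c then (if i = j then a + 1 else a) else if p = c then 1 else 0)"
  using assms by (simp add: elem_mat_def)

lemma elem_mat_add:
  fixes a b :: "'a::comm_ring_1"
  assumes "i < n" "j < n" "i \<noteq> j"
  shows "elem_mat n i j a * elem_mat n i j b = elem_mat n i j (a + b)"
  by (rule eq_matI) (use assms in \<open>auto simp: elem_mat_mult_elem_mat index_elem_mat simp del: index_mult_mat(1)\<close>)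

lemma elem_mat_zero: "i \<noteq> j \<Longrightarrow> elem_mat n i j (0::'a::comm_ring_1) = 1\<^sub>m n"
  by (rule eq_matI) (auto simp: elem_mat_def)

lemma elem_mat_commute:
  fixes a b :: "'a::comm_ring_1"
  assumes "i < n" "j < n" "k < n" "l < n" "i \<noteq> j" "k \<noteq> l" "j \<noteq> k" "i \<noteq> l"
  shows "elem_mat n i j a * elem_mat n k l b = elem_mat n k l b * elem_mat n i j a"
  by (rule eq_matI) (use assms in \<open>auto simp: elem_mat_mult_elem_mat index_elem_mat simp del: index_mult_mat(1)\<close>)

text \<open>The Steinberg commutator relation, freed of inverses and put in the shape
  \<open>x * y = z * (y * x)\<close> of a Heisenberg pair.\<close>

lemma elem_mat_commutator:
  fixes a b :: "'a::comm_ring_1"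
  assumes "i < n" "j < n" "k < n" "i \<noteq> j" "j \<noteq> k" "i \<noteq> k"
  shows "elem_mat n i j a * elem_mat n j k b
    = elem_mat n i k (a * b) * (elem_mat n j k b * elem_mat n i j a)"
proof (rule eq_matI)
  let ?B = "elem_mat n j k b * elem_mat n i j a"
  have B: "?B \<in> carrier_mat n n" by (rule mult_carrier_mat[of _ n n]) simp_all
  fix p c assume "p < dim_row (elem_mat n i k (a * b) * ?B)" "c < dim_col (elem_mat n i k (a * b) * ?B)"
  then have pc: "p < n" "c < n" by simp_all
  then show "(elem_mat n i j a * elem_mat n j k b) $$ (p, c) = (elem_mat n i k (a * b) * ?B) $$ (p, c)"
    using assms B unfolding elem_mat_mult[OF B assms(3)]
    by (auto simp: elem_mat_mult_elem_mat index_elem_mat carrier_matD[OF B] algebra_simps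
        simp del: index_mult_mat(1))
qed simp_all

lemma SL_group_simps: "monoid.mult (SL_group n S) = (*)" "monoid.one (SL_group n S) = 1\<^sub>m n"
  by (simp_all add: SL_group_def)

lemma EL_group_simps:
  "monoid.mult (EL_group n R S) = (*)" "monoid.one (EL_group n R S) = 1\<^sub>m n"
  by (simp_all add: EL_group_def SL_group_def)

text \<open>Under these hypotheses \<open>SL_group n S\<close> need not be a group, so the group
  axioms are checked on the generated set itself. Left inverses suffice, and they are built along
  the induction on \<open>generate\<close>.\<close>

lemma EL_group_group:
  fixes R S :: "'a::comm_ring_1 set"
  assumes S: "0 \<in> S" "1 \<in> S" "R \<subseteq> S" and neg: "\<And>r. r \<in> R \<Longrightarrow> - r \<in> R"
  shows "group (EL_group n R S)"
    and "\<And>i j r. i < n \<Longrightarrow> j < n \<Longrightarrow> i \<noteq> j \<Longrightarrow> r \<in> R \<Longrightarrow> elem_mat n i j r \<in> carrier (EL_group n R S)"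
proof -
  let ?E = "{elem_mat n i j r | i j r. i < n \<and> j < n \<and> i \<noteq> j \<and> r \<in> R}"
  let ?SL = "SL_group n S"
  have carrier: "carrier (EL_group n R S) = generate ?SL ?E"
    by (simp add: EL_group_def)
  have SL: "elem_mat n i j r \<in> carrier ?SL" if "i < n" "j < n" "i \<noteq> j" "r \<in> R" for i j r
  proof -
    have "det (elem_mat n i j r) = 1"
      using that det_addrow_mat[of i j n r] by (simp add: elem_mat_def)
    then show ?thesis
      using that S by (auto simp: SL_group_def index_elem_mat)
  qed
  have inv_SL: "inv\<^bsub>?SL\<^esub> (elem_mat n i j r) = elem_mat n i j (- r)"
    if "i < n" "j < n" "i \<noteq> j" "r \<in> R" for i j r
    \<comment> \<open>The inverse is a definite description in \<open>SL_group n S\<close>; its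
      uniqueness comes from cancelling \<open>elem_mat n i j r\<close> on the left.\<close>
    unfolding m_inv_def
  proof (rule the_equality)
    show "elem_mat n i j (- r) \<in> carrier ?SL \<and> elem_mat n i j r \<otimes>\<^bsub>?SL\<^esub> elem_mat n i j (- r) = \<one>\<^bsub>?SL\<^esub>
        \<and> elem_mat n i j (- r) \<otimes>\<^bsub>?SL\<^esub> elem_mat n i j r = \<one>\<^bsub>?SL\<^esub>"
      using that SL neg elem_mat_add[of i n j r "- r"] elem_mat_add[of i n j "- r" r]
      by (simp add: SL_group_def elem_mat_zero)
  next
    fix y assume "y \<in> carrier ?SL \<and> elem_mat n i j r \<otimes>\<^bsub>?SL\<^esub> y = \<one>\<^bsub>?SL\<^esub> \<and> y \<otimes>\<^bsub>?SL\<^esub> elem_mat n i j r = \<one>\<^bsub>?SL\<^esub>"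
    then have y: "y \<in> carrier_mat n n" "elem_mat n i j r * y = 1\<^sub>m n"
      by (simp_all add: SL_group_def)
    have "y = elem_mat n i j (- r) * elem_mat n i j r * y"
      using that y elem_mat_add[of i n j "- r" r] by (simp add: elem_mat_zero)
    also have "\<dots> = elem_mat n i j (- r) * (elem_mat n i j r * y)"
      by (rule assoc_mult_mat) (use y in auto)
    also have "\<dots> = elem_mat n i j (- r)" by (simp add: y(2) right_mult_one_mat[OF elem_mat_carrier])
    finally show "y = elem_mat n i j (- r)" .
  qed
  have gen: "A \<in> carrier_mat n n \<and> (\<exists>B\<in>generate ?SL ?E. B \<in> carrier_mat n n \<and> B * A = 1\<^sub>m n)" if "A \<in> generate ?SL ?E" for A
    using that
  proof (induction rule: generate.induct)
    case one
    show ?case using generate.one[of ?SL ?E] by (intro conjI bexI[of _ "1\<^sub>m n"]) (simp_all add: SL_group_simps)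
  next
    case (incl A)
    then obtain i j r where A: "A = elem_mat n i j r" "i < n" "j < n" "i \<noteq> j" "r \<in> R" by blast
    have "elem_mat n i j (- r) \<in> generate ?SL ?E"
      using A neg by (intro generate.incl) blast
    then show ?case
      using A elem_mat_add[of i n j "- r" r]
      by (intro conjI bexI[of _ "elem_mat n i j (- r)"]) (simp_all add: elem_mat_zero)
  next
    case (inv A)
    then obtain i j r where A: "A = elem_mat n i j r" "i < n" "j < n" "i \<noteq> j" "r \<in> R" by blast
    have "elem_mat n i j r \<in> generate ?SL ?E"
      using A by (intro generate.incl) blast
    then show ?case
      unfolding A(1) inv_SL[OF A(2-)] using A elem_mat_add[of i n j r "- r"]
      by (intro conjI bexI[of _ "elem_mat n i j r"]) (simp_all add: elem_mat_zero)
  next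
    case (eng A B)
    then obtain A' B' where AB: "A' \<in> generate ?SL ?E" "A' * A = 1\<^sub>m n" "B' \<in> generate ?SL ?E" "B' * B = 1\<^sub>m n"
      "A \<in> carrier_mat n n" "B \<in> carrier_mat n n"
      and dims: "A' \<in> carrier_mat n n" "B' \<in> carrier_mat n n" by blast
    have "A' * (A * B) = A' * A * B"
      by (rule assoc_mult_mat[symmetric]) (use AB dims in auto)
    also have "\<dots> = B" using AB by simp
    finally have "B' * A' * (A * B) = 1\<^sub>m n"
      using AB dims by (simp add: assoc_mult_mat[of B' n n A' n "A * B" n])
    moreover have "B' * A' \<in> generate ?SL ?E"
      using generate.eng[OF AB(3,1)] by (simp add: SL_group_simps)
    ultimately show ?case
      using AB(5,6) dims by (intro conjI bexI[of _ "B' * A'"]) (simp_all add: SL_group_simps)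
  qed
  show "group (EL_group n R S)"
  proof (rule groupI)
    fix A B C assume "A \<in> carrier (EL_group n R S)" "B \<in> carrier (EL_group n R S)" "C \<in> carrier (EL_group n R S)"
    then have "A \<in> carrier_mat n n" "B \<in> carrier_mat n n" "C \<in> carrier_mat n n"
      using gen by (auto simp: carrier)
    then show "A \<otimes>\<^bsub>EL_group n R S\<^esub> B \<otimes>\<^bsub>EL_group n R S\<^esub> C = A \<otimes>\<^bsub>EL_group n R S\<^esub> (B \<otimes>\<^bsub>EL_group n R S\<^esub> C)"
      by (simp add: EL_group_simps assoc_mult_mat[of _ n n _ n _ n])
  next
    fix A B assume "A \<in> carrier (EL_group n R S)" "B \<in> carrier (EL_group n R S)"
    then show "A \<otimes>\<^bsub>EL_group n R S\<^esub> B \<in> carrier (EL_group n R S)"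
      using generate.eng[of A ?SL ?E B] by (simp add: carrier EL_group_simps SL_group_simps)
  next
    show "\<one>\<^bsub>EL_group n R S\<^esub> \<in> carrier (EL_group n R S)"
      using generate.one[of ?SL ?E] by (simp add: carrier EL_group_simps SL_group_simps)
  next
    fix A assume "A \<in> carrier (EL_group n R S)"
    then show "\<one>\<^bsub>EL_group n R S\<^esub> \<otimes>\<^bsub>EL_group n R S\<^esub> A = A"
      "\<exists>B\<in>carrier (EL_group n R S). B \<otimes>\<^bsub>EL_group n R S\<^esub> A = \<one>\<^bsub>EL_group n R S\<^esub>"
      using gen[of A] by (auto simp: carrier EL_group_simps)
  qed
  show "elem_mat n i j r \<in> carrier (EL_group n R S)" if "i < n" "j < n" "i \<noteq> j" "r \<in> R" for i j r
    unfolding carrier using that by (intro generate.incl) blast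
qed

section \<open>The generators over the polynomial rng, and the final assembly\<close>

lemma tvar_mult: "tvar r * tvar s = Poly_Mapping.single (Poly_Mapping.single r 1 + Poly_Mapping.single s 1) 1"
  by (simp add: tvar_def mult_single)

lemma tvar_in: "r < d \<Longrightarrow> tvar r \<in> int_polys_zero_const d"
proof -
  assume r: "r < d"
  have "(Poly_Mapping.single r 1 :: nat \<Rightarrow>\<^sub>0 nat) \<noteq> 0"
    by (metis lookup_single_eq lookup_zero one_neq_zero)
  then show ?thesis
    using r by (auto simp: int_polys_zero_const_def int_polys_def tvar_def lookup_single when_def)
qed

lemma tvar_mult_in: "r < d \<Longrightarrow> s < d \<Longrightarrow> tvar r * tvar s \<in> int_polys_zero_const d"
proof -
  assume rs: "r < d" "s < d"
  let ?m = "Poly_Mapping.single r 1 + Poly_Mapping.single s 1 :: nat \<Rightarrow>\<^sub>0 nat"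
  have "Poly_Mapping.lookup ?m r \<noteq> 0"
    by (simp add: lookup_add)
  then have "?m \<noteq> 0" by auto
  moreover have "Poly_Mapping.keys ?m \<subseteq> {..<d}"
    using keys_add[of "Poly_Mapping.single r (1::nat)" "Poly_Mapping.single s 1"] rs by auto
  ultimately show ?thesis
    unfolding tvar_mult by (simp add: int_polys_zero_const_def int_polys_def lookup_single when_def)
qed

lemma EL_poly_group: "group (EL_poly d n)"
  and EL_poly_elem: "\<And>i j r. i < n \<Longrightarrow> j < n \<Longrightarrow> i \<noteq> j \<Longrightarrow> r \<in> int_polys_zero_const d
    \<Longrightarrow> elem_mat n i j r \<in> carrier (EL_poly d n)"
proof -
  have "0 \<in> int_polys d" "1 \<in> int_polys d" "int_polys_zero_const d \<subseteq> int_polys d"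
    "\<And>r. r \<in> int_polys_zero_const d \<Longrightarrow> - r \<in> int_polys_zero_const d"
    by (auto simp: int_polys_def int_polys_zero_const_def)
  from EL_group_group[OF this] show "group (EL_poly d n)"
    "\<And>i j r. i < n \<Longrightarrow> j < n \<Longrightarrow> i \<noteq> j \<Longrightarrow> r \<in> int_polys_zero_const d
    \<Longrightarrow> elem_mat n i j r \<in> carrier (EL_poly d n)"
    by (auto simp: EL_poly_def)
qed

lemma EL_poly_mult: "monoid.mult (EL_poly d n) = (*)"
  by (simp add: EL_poly_def EL_group_simps)

lemma sum_off_diagonal_pairs:
  "(\<Sum>(i, j)\<in>{(i, j). i < n \<and> j < n \<and> i \<noteq> j}. f i j) = (\<Sum>i<n. \<Sum>j\<in>{..<n}-{i}. f i j)" for n :: nat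
proof -
  have "{(i, j). i < n \<and> j < n \<and> i \<noteq> j} = (SIGMA i:{..<n}. {..<n} - {i})" by auto
  moreover have "(\<Sum>i<n. \<Sum>j\<in>{..<n}-{i}. f i j) = (\<Sum>(i, j)\<in>(SIGMA i:{..<n}. {..<n} - {i}). f i j)"
    by (rule sum.Sigma) auto
  ultimately show ?thesis by simp
qed

theorem mainTheorem1:
  fixes d :: nat
  shows "\<exists>(n0::nat) (\<epsilon>::real). \<epsilon> > 0 \<and>
    (\<forall>n\<ge>n0.
       gmult (EL_poly d n) (Delta d n) (Delta d n) - gscale (real n * \<epsilon>) (Delta2 d n)
         \<in> arch_closure_sum_squares (EL_poly d n))"
proof -
  \<comment> \<open>The \<open>+ 1\<close> keeps \<open>\<kappa>\<close> defined for
    \<open>d = 0\<close> and gives \<open>\<kappa> \<le> 1\<close> as well as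
    \<open>\<kappa> * d \<le> 1\<close>.\<close>
  define \<kappa> where "\<kappa> = 1 / (real d + 1)"
  have \<kappa>: "0 < \<kappa>" "\<kappa> \<le> 1" "\<kappa> * d \<le> 1" by (simp_all add: \<kappa>_def field_simps)
  obtain N0 :: nat and c :: real where c: "0 < c" "0 < N0" and lower:
    "\<And>(J :: nat set) (x :: nat \<Rightarrow> zpoly mat bijection group_ring) y z. heisenberg J x y z \<Longrightarrow> N0 \<le> card J \<Longrightarrow>
      (c * card J) *\<^sub>R lap z \<le> (\<Sum>j\<in>J. lap (x j) * lap (y j) + lap (y j) * lap (x j))
        + \<kappa> *\<^sub>R (\<Sum>j\<in>J. \<Sum>k\<in>J-{j}. lap (x j) * lap (y k))
        + (\<kappa> / card J) *\<^sub>R ((\<Sum>j\<in>J. \<Sum>k\<in>J-{j}. lap (x j) * lap (x k))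
          + (\<Sum>j\<in>J. \<Sum>k\<in>J-{j}. lap (y j) * lap (y k)))"
    by (rule heisenberg_lower_bound[OF \<kappa>(1)]) (rule that)
  \<comment> \<open>For fixed \<open>i\<close> and \<open>k\<close> there are \<open>n - 2\<close>
    intermediate indices, so \<open>n\<close> must exceed \<open>N0\<close> by at least 2. From
    \<open>n \<ge> 4\<close> also follows \<open>n / 2 \<le> n - 2\<close>, which turns the factor
    \<open>c * (n - 2)\<close> into \<open>n * (c / 2)\<close>.\<close>
  have "gmult (EL_poly d n) (Delta d n) (Delta d n) - gscale (real n * (c / 2)) (Delta2 d n)
         \<in> arch_closure_sum_squares (EL_poly d n)" if n: "N0 + 4 \<le> n" for n
  proof -
    let ?G = "EL_poly d n"
    interpret group_embedding ?G "left_translation ?G"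
      by (rule group.cayley[OF EL_poly_group])
    define e where "e i j r = elem (elem_mat n i j (tvar r))" for i j r
    define f where "f i j r s = elem (elem_mat n i j (tvar r * tvar s))" for i j r s
    note in_G = EL_poly_elem[OF _ _ _ tvar_in] EL_poly_elem[OF _ _ _ tvar_mult_in]
    have mult: "elem A * elem B = elem (A * B)" if "A \<in> carrier ?G" "B \<in> carrier ?G" for A B
      using elem_mult[OF that] by (simp add: EL_poly_mult)
    have mult_closed: "A * B \<in> carrier ?G" if "A \<in> carrier ?G" "B \<in> carrier ?G" for A B
      using m_closed[OF that] by (simp add: EL_poly_mult)
    interpret elementary_unitaries n d e f
    proof
      fix i j k l r s s' :: nat
      assume *: "i < n" "j < n" "k < n" "l < n" "i \<noteq> j" "k \<noteq> l" "j \<noteq> k" "i \<noteq> l" "r < d" "s < d"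
      then show "comm (e i j r) (e k l s)"
        by (simp add: comm_def e_def mult in_G elem_mat_commute)
      assume "s' < d"
      with * show "comm (f i j s s') (e k l r)"
        by (simp add: comm_def e_def f_def mult in_G elem_mat_commute)
    next
      fix i j k r s :: nat
      assume "i < n" "j < n" "k < n" "i \<noteq> j" "j \<noteq> k" "i \<noteq> k" "r < d" "s < d"
      then show "e i j r * e j k s = f i k r s * (e j k s * e i j r)"
        by (simp add: e_def f_def mult mult_closed in_G elem_mat_commutator[of i n j k])
    qed (auto simp: e_def f_def intro!: unitary_elem in_G)
    have D: "embed (Delta d n) = (\<Sum>i<n. \<Sum>j\<in>{..<n}-{i}. T i j)"
      unfolding Delta_def sum_off_diagonal_pairs embed_sum T_def
      by (intro sum.cong refl) (simp add: embed_one_minus_sq in_G e_def)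
    have D2: "embed (Delta2 d n) = (\<Sum>i<n. \<Sum>j\<in>{..<n}-{i}. \<Sum>r<d. \<Sum>s<d. lap (f i j r s))"
      unfolding Delta2_def sum_off_diagonal_pairs embed_sum
      by (intro sum.cong refl) (simp add: embed_one_minus_sq in_G f_def)
    have galg: "Delta d n \<in> galg ?G" "Delta2 d n \<in> galg ?G"
      unfolding Delta_def Delta2_def sum_off_diagonal_pairs
      by (intro galg_sum galg_one_minus_sq in_G; auto)+
    have "(real n * (c / 2)) *\<^sub>R embed (Delta2 d n) \<le> (c * real (n - 2)) *\<^sub>R embed (Delta2 d n)"
    proof (rule scaleR_right_mono)
      show "real n * (c / 2) \<le> c * real (n - 2)" using n c by (simp add: of_nat_diff field_simps)
      show "0 \<le> embed (Delta2 d n)" unfolding D2 by (intro sum_nonneg lap_nonneg)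
    qed
    also have "\<dots> \<le> embed (Delta d n) * embed (Delta d n)"
      unfolding D D2
    proof (rule lower_bound_square)
      show "2 < n" "0 \<le> \<kappa>" "\<kappa> \<le> 1" "\<kappa> * d \<le> 1" using n \<kappa> by simp_all
    next
      fix J :: "nat set" and x y :: "nat \<Rightarrow> zpoly mat bijection group_ring" and z
      assume "heisenberg J x y z" "card J = n - 2"
      moreover from this n have "N0 \<le> card J" by simp
      ultimately show "(c * card J) *\<^sub>R lap z \<le> (\<Sum>j\<in>J. lap (x j) * lap (y j) + lap (y j) * lap (x j))
        + \<kappa> *\<^sub>R (\<Sum>j\<in>J. \<Sum>k\<in>J-{j}. lap (x j) * lap (y k))
        + (\<kappa> / card J) *\<^sub>R ((\<Sum>j\<in>J. \<Sum>k\<in>J-{j}. lap (x j) * lap (x k))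
          + (\<Sum>j\<in>J. \<Sum>k\<in>J-{j}. lap (y j) * lap (y k)))"
        by (intro lower)
    qed
    finally have "0 \<le> embed (gmult ?G (Delta d n) (Delta d n) - gscale (real n * (c / 2)) (Delta2 d n))"
      using galg by (simp add: embed_diff embed_gmult embed_gscale)
    then show ?thesis
      using galg by (intro arch_closure_if_nonneg galg_diff galg_gmult galg_gscale)
  qed
  then show ?thesis using c by (intro exI[of _ "N0 + 4"] exI[of _ "c / 2"]) simp
qed

end
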